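(* Consider the ALE schemes version 1 and version 2 defined in the context. (i) For version 2, the quantity $\int_{\mathbb R^d}\mathbf u_h^n\,d\mathbf x$ is conserved, i.e. $\int_{\mathbb R^d}\mathbf u_h^n\,d\mathbf x=\int_{\mathbb R^d}\mathbf u_h^0\,d\mathbf x$ for all $n\ge0$. (ii) For version 1, the quantity $\sum_{i=1}^N\mathfrak m_i^n\mathbf U_i^n$ is conserved, i.e. it is independent of $n$.
   Context: **Hyperbolic system.** Consider $\partial_t\mathbf u+\nabla\cdot\mathbf f(\mathbf u)=0$ on $\mathbb R^d\times\mathbb R_+$, $\mathbf u\in\mathbb R^m$, $\mathbf f(\mathbf u)\in\mathbb R^{m\times d}$. For $A\in\mathbb R^{m\times d}$ and $\mathbf n\in\mathbb R^d$, $A\cdot\mathbf n\in\mathbb R^m$ has entries $\sum_l A_{il}n_l$; $(\mathbf u\otimes\mathbf v)_{ij}=u_iv_j$. For a flux $\mathbf h$ (with values in $\mathbb R^{m\times d}$), $(\eta,\mathbf q)$ is an entropy pair if $\eta$ is convex and $\partial_{v_k}(\mathbf q(\mathbf v)\cdot\mathbf n)=\sum_{i=1}^m\partial_{v_i}\eta(\mathbf v)\,\partial_{v_k}(\mathbf h_i(\mathbf v)\cdot\mathbf n)$ for all $k$ and all unit $\mathbf n$ ($\mathbf h_i$ is the $i$-th row). Standing assumption: there is a nonempty admissible set $\mathcal A_{\mathbf h}\subset\mathbb R^m$ such that for all $\mathbf u_L,\mathbf u_R\in\mathcal A_{\mathbf h}$ and every unit vector $\mathbf n$ the Riemann problem $\partial_t\mathbf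 u+\partial_x(\mathbf h(\mathbf u)\cdot\mathbf n)=0$, $\mathbf u(x,0)=\mathbf u_L$ if $x<0$, $\mathbf u_R$ if $x>0$, has a unique entropy satisfying solution (i.e. $\partial_t\eta(\mathbf u)+\partial_x(\mathbf q(\mathbf u)\cdot\mathbf n)\le 0$ in the distribution sense for every entropy pair), and there are $\lambda_L\le\lambda_R$ (depending on $\mathbf h,\mathbf n,\mathbf u_L,\mathbf u_R$) such that it equals $\mathbf u_L$ for $x\le t\lambda_L$ and $\mathbf u_R$ for $x\ge t\lambda_R$. Set $\lambda_{\max}(\mathbf h,\mathbf n,\mathbf u_L,\mathbf u_R)=\max(|\lambda_L|,|\lambda_R|)$. **Boundary conditions.** The problem is the Cauchy problem in $\mathbb R^d$ with data constant outside a compact set, or periodic boundary conditions are used (integrals over $\mathbb R^d$ then being over the periodic domain); no boundary terms arise in integrations by parts. **Finite elements.** $\mathcal T_h^n$ is a matching mesh at time $t^n$ with fixed connectivity. Every cell $K$ is $T_K^n(\widehat K)$, where $\widehat K$ is one of finitely many reference elements, $T_K^n(\widehat{\mathbf x})=\sum_{i=1}^{n_f^{geo}}\mathbf a^n_{\mathsf j^{geo}(i,K)}\widehat\theta_i^{geo}(\widehat{\mathbf x})$ is a diffeomorphism, $\{\mathbf a_i^n\}_{1\le i\le N_{geo}}$ are the geometric Lagrange nodes, $\widehat\theta_i^{geo}$ the reference Lagrange shape functions spanning $\widehat P^{geo}$, and $\mathsf j^{geo}$ the (time independent) geometric connectivity array. The approximation uses reference shape functions $\widehat\theta_i$ ($1\le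 i\le n_f$), spanning $\widehat P$, with $\widehat\theta_i\ge0$ and $\sum_i\widehat\theta_i=1$ on $\widehat K$. $P(\mathcal T_h^n)$ is the space of continuous scalar functions $v$ with $v|_K\circ T_K^n\in\widehat P$ for all $K$; $\mathbf P_d=[P]^d$, $\mathbf P_m=[P]^m$. Its global shape functions $\{\psi_i^n\}_{1\le i\le N}$ satisfy $\psi^n_{\mathsf j(i,K)}=\widehat\theta_i\circ(T_K^n)^{-1}$ on $K$, with time independent connectivity array $\mathsf j$, so $\psi_i^n\ge0$, $\sum_i\psi_i^n=1$. $S_i^n$ is the support of $\psi_i^n$, and for a union of cells $E$, $\mathcal I(E)=\{j: |S_j^n\cap E|\ne0\}$ (independent of $n$). $m_i^n:=\int\psi_i^n\,d\mathbf x$. The approximate solution is $\mathbf u_h^n=\sum_i\mathbf U_i^n\psi_i^n\in\mathbf P_m(\mathcal T_h^n)$. Time steps: $t^{n+1}=t^n+\tau$. **Version 1.** Given an ALE velocity $\mathbf w^n=\sum_i\mathbf W_i^n\psi_i^n\in\mathbf P_d(\mathcal T_h^n)$, nodes move by $\mathbf a_i^{n+1}=\mathbf a_i^n+\tau\mathbf w^n(\mathbf a_i^n)$, defining $\mathcal T_h^{n+1}$. Masses: $\mathfrak m_i^0=m_i^0$, $\mathfrak m_i^{n+1}=\mathfrak m_i^n+\tau\int_{S_i^n}\psi_i^n\,\nabla\cdot\mathbf w^n\,d\mathbf x$, assumed positive. With $\mathbf c_{ij}^n=\int_{S_i^n}\psi_i^n\nabla\psi_j^n\,d\mathbf x$,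 $$\frac{\mathfrak m_i^{n+1}\mathbf U_i^{n+1}-\mathfrak m_i^n\mathbf U_i^n}{\tau}+\sum_{j\in\mathcal I(S_i^n)}\Big[(\mathbf f(\mathbf U_j^n)-\mathbf U_j^n\otimes\mathbf W_j^n)\cdot\mathbf c_{ij}^n-d_{ij}^n\mathbf U_j^n\Big]=0.$$ **Version 2.** Assume $\widehat P^{geo}\subset\widehat P$. The ALE velocity $\mathbf w^n=\sum_{i=1}^{N_{geo}}\mathbf W_i^{geo,n}\psi_i^{geo,n}$ is in $[P^{geo}(\mathcal T_h^n)]^d$ (defined like $P$ with $\widehat P^{geo}$ and the geometric shape functions $\psi^{geo,n}_{\mathsf j^{geo}(i,K)}=\widehat\theta_i^{geo}\circ(T_K^n)^{-1}$); $\mathbf W_j^n$ are its coefficients in the basis $\{\psi_j^n\}$: $\mathbf w^n=\sum_j\mathbf W_j^n\psi_j^n$. For $t\in[t^n,t^{n+1}]$, $\mathbf a_i(t)=\mathbf a_i^n+(t-t^n)\mathbf W_i^{geo,n}$ defines a mesh $\mathcal T_h(t)$, geometric maps $T_K(t)$, and shape functions $\varphi_i(\cdot,t)$ with $\varphi_{\mathsf j(i,K)}(\cdot,t)=\widehat\theta_i\circ T_K(t)^{-1}$ on the cell $T_K(t)(\widehat K)$; the mesh motion map $\boldsymbol\Phi_t$ ($=T_K(t)\circ(T_K^n)^{-1}$ on $K$) is assumed invertible for $t\in[t^n,t^{n+1}]$; $\mathcal T_h^{n+1}=\mathcal T_h(t^{n+1})$ and $\psi_i^{n+1}=\varphi_i(\cdot,t^{n+1})$.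 $(\omega_l,\zeta_l)_{l\in\mathcal L}$ is a quadrature on $[0,1]$ exact for polynomials of degree at most $d-1$; $t_l^n=t^n+\tau\zeta_l$. Put $m_i^{n+1}=\int\psi_i^{n+1}\,d\mathbf x$, $\mathbf c_{ij}(t_l^n)=\int\varphi_i(\mathbf x,t_l^n)\nabla\varphi_j(\mathbf x,t_l^n)\,d\mathbf x$, $\mathbf c_{ij}^n=\sum_{l}\omega_l\mathbf c_{ij}(t_l^n)$, and $$\frac{m_i^{n+1}\mathbf U_i^{n+1}-m_i^n\mathbf U_i^n}{\tau}+\sum_{j\in\mathcal I(S_i^n)}\Big[(\mathbf f(\mathbf U_j^n)-\mathbf U_j^n\otimes\mathbf W_j^n)\cdot\mathbf c_{ij}^n-d_{ij}^n\mathbf U_j^n\Big]=0.$$ **Artificial viscosity (both versions).** $\mathbf g_j^n(\mathbf v)=\mathbf f(\mathbf v)-\mathbf v\otimes\mathbf W_j^n$, $\mathbf n_{ij}^n=\mathbf c_{ij}^n/\|\mathbf c_{ij}^n\|_{\ell^2}$ (terms with $\mathbf c_{ij}^n=0$ are counted as zero). For $i\neq j$, $j\in\mathcal I(S_i^n)$, $$d_{ij}^n=\max\big(\lambda_{\max}(\mathbf g_j^n,\mathbf n_{ij}^n,\mathbf U_i^n,\mathbf U_j^n)\|\mathbf c_{ij}^n\|_{\ell^2},\ \lambda_{\max}(\mathbf g_i^n,\mathbf n_{ji}^n,\mathbf U_j^n,\mathbf U_i^n)\|\mathbf c_{ji}^n\|_{\ell^2}\big),$$ $d_{ij}^n=0$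 if $j\notin\mathcal I(S_i^n)$, and $d_{ii}^n=-\sum_{i\ne j\in\mathcal I(S_i^n)}d_{ji}^n$. In particular $d_{ij}^n=d_{ji}^n$ and $d_{ij}^n\ge0$ for $i\ne j$.
   Formalization: For the Cauchy problem the mesh of R^d has infinitely many cells and shape functions, and if the constant far-field state u is nonzero, where the integral and sum diverge, the conserved quantities are the integral of u_h^n - u and the sum of m_i^n (U_i^n - u). *)

theory Defs
  imports "HOL-Analysis.Analysis" "HOL-Computational_Algebra.Polynomial"
begin

section \<open>Hyperbolic systems and the Riemann problem\<close>

text \<open>A flux with values in the \<open>m \<times> d\<close> matrices has type \<open>real^'m \<Rightarrow> real^'d^'m\<close>; the product
  written \<open>A \<cdot> n\<close> on paper is the matrix-vector product \<open>A *v n\<close>.\<close>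

type_synonym ('d, 'm) flux = "real^'m \<Rightarrow> real^'d^'m"

definition tensor :: "real^'m \<Rightarrow> real^'d \<Rightarrow> real^'d^'m" where
  "tensor u v = (\<chi> i j. u $ i * v $ j)"

definition ale_flux :: "('d::finite, 'm::finite) flux \<Rightarrow> real^'d \<Rightarrow> ('d, 'm) flux" where
  "ale_flux f w = (\<lambda>v. f v - tensor v w)"

definition entropy_pair ::
    "('d::finite, 'm::finite) flux \<Rightarrow> (real^'m \<Rightarrow> real) \<Rightarrow> (real^'m \<Rightarrow> real^'d) \<Rightarrow> bool" where
  "entropy_pair h \<eta> q \<longleftrightarrow>
     convex_on UNIV \<eta> \<and> \<eta> differentiable_on UNIV \<and> q differentiable_on UNIV \<and> h differentiable_on UNIV \<and>
     (\<forall>n. norm n = 1 \<longrightarrow> (\<forall>v k.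
        frechet_derivative (\<lambda>v. q v \<bullet> n) (at v) (axis k 1) =
        (\<Sum>i\<in>UNIV. frechet_derivative \<eta> (at v) (axis i 1) *
                   frechet_derivative (\<lambda>v. (h v *v n) $ i) (at v) (axis k 1))))"

text \<open>Points of the space-time plane are pairs \<open>(x, t)\<close>. A test function is a compactly supported
  smooth function on the plane; \<open>D i j\<close> is its mixed partial derivative, of order \<open>i\<close> in \<open>x\<close> and
  \<open>j\<close> in \<open>t\<close>. Since every \<open>D i j\<close> is differentiable, all of them are continuous.\<close>

definition test_function :: "(real \<times> real \<Rightarrow> real) \<Rightarrow> bool" where
  "test_function \<phi> \<longleftrightarrow> compact (closure {p. \<phi> p \<noteq> 0}) \<and>
     (\<exists>D :: nat \<Rightarrow> nat \<Rightarrow> real \<times> real \<Rightarrow> real. D 0 0 = \<phi> \<and>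
        (\<forall>i j p. (D i j has_derivative
           (\<lambda>v. fst v * D (Suc i) j p + snd v * D i (Suc j) p)) (at p)))"

definition d_x :: "(real \<times> real \<Rightarrow> real) \<Rightarrow> real \<times> real \<Rightarrow> real" where
  "d_x \<phi> p = frechet_derivative \<phi> (at p) (1, 0)"

definition d_t :: "(real \<times> real \<Rightarrow> real) \<Rightarrow> real \<times> real \<Rightarrow> real" where
  "d_t \<phi> p = frechet_derivative \<phi> (at p) (0, 1)"

definition half_plane :: "(real \<times> real) set" where
  "half_plane = {p. snd p > 0}"

definition riemann_data :: "real^'m \<Rightarrow> real^'m \<Rightarrow> real \<Rightarrow> real^'m" where
  "riemann_data uL uR x = (if x < 0 then uL else uR)"

text \<open>Weak solutions are taken among essentially bounded functions. The initial datum enters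
  through test functions that need not vanish at \<open>t = 0\<close>.\<close>

definition weak_riemann_solution ::
    "('d::finite, 'm::finite) flux \<Rightarrow> real^'d \<Rightarrow> real^'m \<Rightarrow> real^'m \<Rightarrow> (real \<times> real \<Rightarrow> real^'m) \<Rightarrow> bool" where
  "weak_riemann_solution h n uL uR u \<longleftrightarrow>
     set_borel_measurable lborel half_plane u \<and>
     (\<exists>B. AE p in lborel. p \<in> half_plane \<longrightarrow> norm (u p) \<le> B) \<and>
     (\<forall>C. compact C \<longrightarrow> set_integrable lborel (half_plane \<inter> C) (\<lambda>p. h (u p))) \<and>
     (\<forall>\<phi>. test_function \<phi> \<longrightarrow>
        (LINT p:half_plane|lborel. d_t \<phi> p *\<^sub>R u p + d_x \<phi> p *\<^sub>R (h (u p) *v n))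
        + (LINT x|lborel. \<phi> (x, 0) *\<^sub>R riemann_data uL uR x) = 0)"

definition entropy_riemann_solution ::
    "('d::finite, 'm::finite) flux \<Rightarrow> real^'d \<Rightarrow> real^'m \<Rightarrow> real^'m \<Rightarrow> (real \<times> real \<Rightarrow> real^'m) \<Rightarrow> bool" where
  "entropy_riemann_solution h n uL uR u \<longleftrightarrow>
     weak_riemann_solution h n uL uR u \<and>
     (\<forall>\<eta> q \<phi>. entropy_pair h \<eta> q \<and> test_function \<phi> \<and>
        closure {p. \<phi> p \<noteq> 0} \<subseteq> half_plane \<and> (\<forall>p. \<phi> p \<ge> 0) \<longrightarrow>
        (LINT p:half_plane|lborel. \<eta> (u p) * d_t \<phi> p + (q (u p) \<bullet> n) * d_x \<phi> p) \<ge> 0)"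

text \<open>\<open>A h\<close> is the admissible set of the flux \<open>h\<close>. The speeds \<open>lamL\<close> and \<open>lamR\<close> are given functions
  of the flux, the direction, and the left and right states, since they are not determined uniquely
  by the property required of them. Uniqueness is uniqueness almost everywhere.\<close>

type_synonym ('d, 'm) speed = "('d, 'm) flux \<Rightarrow> real^'d \<Rightarrow> real^'m \<Rightarrow> real^'m \<Rightarrow> real"

definition riemann_well_posed ::
    "(('d::finite, 'm::finite) flux \<Rightarrow> (real^'m) set) \<Rightarrow> ('d, 'm) speed \<Rightarrow> ('d, 'm) speed
     \<Rightarrow> ('d, 'm) flux \<Rightarrow> bool" where
  "riemann_well_posed A lamL lamR h \<longleftrightarrow> A h \<noteq> {} \<and>
     (\<forall>uL\<in>A h. \<forall>uR\<in>A h. \<forall>n. norm n = 1 \<longrightarrow>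
        lamL h n uL uR \<le> lamR h n uL uR \<and>
        (\<exists>u. entropy_riemann_solution h n uL uR u \<and>
             (\<forall>v. entropy_riemann_solution h n uL uR v \<longrightarrow>
                  (AE p in lborel. p \<in> half_plane \<longrightarrow> v p = u p)) \<and>
             (AE p in lborel. p \<in> half_plane \<longrightarrow>
                (fst p \<le> snd p * lamL h n uL uR \<longrightarrow> u p = uL) \<and>
                (fst p \<ge> snd p * lamR h n uL uR \<longrightarrow> u p = uR))))"

definition lambda_max :: "('d::finite, 'm::finite) speed \<Rightarrow> ('d, 'm) speed \<Rightarrow> ('d, 'm) speed" where
  "lambda_max lamL lamR h n uL uR = max \<bar>lamL h n uL uR\<bar> \<bar>lamR h n uL uR\<bar>"

section \<open>Boundary conditions\<close>

text \<open>Either the Cauchy problem in the whole space, with the constant state taken by the data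
  outside a compact set, or periodic boundary conditions with the vector of the periods.
  A function on the periodic domain is a periodic function on the whole space, and is integrated
  over one period.

  In the Cauchy case with a nonzero far-field state \<open>u\<close>, the integral of the approximate solution
  over the whole space does not exist. What is conserved is the excess over \<open>u\<close>. For a zero far-field
  state, and in the periodic case, \<open>far_state\<close> is \<open>0\<close> and the excess is the solution itself.\<close>

datatype ('d::finite, 'm::finite) boundary = Cauchy "real^'m" | Periodic "real^'d"

fun far_state :: "('d::finite, 'm::finite) boundary \<Rightarrow> real^'m" where
  "far_state (Cauchy u) = u"
| "far_state (Periodic L) = 0"

fun periods :: "('d::finite, 'm::finite) boundary \<Rightarrow> (real^'d) set" where
  "periods (Cauchy u) = {0}"
| "periods (Periodic L) = {s. \<exists>k :: 'd \<Rightarrow> int. s = (\<chi> l. of_int (k l) * L $ l)}"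

fun domain :: "('d::finite, 'm::finite) boundary \<Rightarrow> (real^'d) set" where
  "domain (Cauchy u) = UNIV"
| "domain (Periodic L) = cbox 0 L"

section \<open>Finite elements\<close>

text \<open>Maps that are \<open>C\<^sup>1\<close> up to the boundary of a set, and their diffeomorphisms onto the image.\<close>

definition C1_on :: "'a set \<Rightarrow> ('a::euclidean_space \<Rightarrow> 'b::euclidean_space) \<Rightarrow> bool" where
  "C1_on S g \<longleftrightarrow> (\<exists>g' :: 'a \<Rightarrow> 'a \<Rightarrow>\<^sub>L 'b. continuous_on S g' \<and>
     (\<forall>x\<in>S. (g has_derivative blinfun_apply (g' x)) (at x within S)))"

definition diffeo_on :: "'a set \<Rightarrow> ('a::euclidean_space \<Rightarrow> 'a) \<Rightarrow> bool" where
  "diffeo_on S g \<longleftrightarrow> inj_on g S \<and> C1_on S g \<and> C1_on (g ` S) (inv_into S g)"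

text \<open>A reference element: the reference cell, the number of geometric Lagrange nodes, these nodes
  and their shape functions, and the number of shape functions of the approximation and these
  functions. Local indices run from \<open>0\<close>.\<close>

record ('d::finite) ref_element =
  rdom :: "(real^'d) set"
  ngeo :: nat
  lagr :: "nat \<Rightarrow> real^'d"
  thgeo :: "nat \<Rightarrow> real^'d \<Rightarrow> real"
  nsh :: nat
  th :: "nat \<Rightarrow> real^'d \<Rightarrow> real"

definition ref_element_ok :: "('d::finite) ref_element \<Rightarrow> bool" where
  "ref_element_ok R \<longleftrightarrow>
     polytope (rdom R) \<and> interior (rdom R) \<noteq> {} \<and>
     (\<forall>i<ngeo R. lagr R i \<in> rdom R \<and> C1_on (rdom R) (thgeo R i) \<and>
        (\<forall>k<ngeo R. thgeo R i (lagr R k) = (if i = k then 1 else 0))) \<and>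
     (\<forall>i<nsh R. C1_on (rdom R) (th R i)) \<and>
     (\<forall>x\<in>rdom R. (\<forall>i<nsh R. th R i x \<ge> 0) \<and> (\<Sum>i<nsh R. th R i x) = 1) \<and>
     (\<forall>c. (\<forall>x\<in>rdom R. (\<Sum>i<nsh R. c i * th R i x) = 0) \<longrightarrow> (\<forall>i<nsh R. c i = 0))"

text \<open>The geometric reference space is contained in the approximation reference space.\<close>

definition geo_subspace :: "('d::finite) ref_element \<Rightarrow> bool" where
  "geo_subspace R \<longleftrightarrow>
     (\<forall>i<ngeo R. \<exists>c. \<forall>x\<in>rdom R. thgeo R i x = (\<Sum>k<nsh R. c k * th R k x))"

text \<open>The time-independent structure of a mesh: cells, the reference element of each cell,
  geometric nodes with their connectivity array, and degrees of freedom with theirs. In a periodic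
  domain the vertices of a cell are the representatives of the geometric nodes translated by the
  periods \<open>offset K i\<close>. The index sets are infinite in the Cauchy problem, as bounded cells have to
  cover the whole space.\<close>

record ('d::finite) mesh_data =
  cells :: "nat set"
  relem :: "nat \<Rightarrow> 'd ref_element"
  gnodes :: "nat set"
  jgeo :: "nat \<Rightarrow> nat \<Rightarrow> nat"
  offset :: "nat \<Rightarrow> nat \<Rightarrow> real^'d"
  dofs :: "nat set"
  jsh :: "nat \<Rightarrow> nat \<Rightarrow> nat"

definition mesh_data_ok :: "('d::finite, 'm::finite) boundary \<Rightarrow> 'd mesh_data \<Rightarrow> bool" where
  "mesh_data_ok bc M \<longleftrightarrow>
     finite (relem M ` cells M) \<and>
     (\<forall>K\<in>cells M. ref_element_ok (relem M K) \<and>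
        inj_on (jgeo M K) {..<ngeo (relem M K)} \<and>
        inj_on (jsh M K) {..<nsh (relem M K)} \<and>
        (\<forall>i<ngeo (relem M K). offset M K i \<in> periods bc)) \<and>
     gnodes M = (\<Union>K\<in>cells M. jgeo M K ` {..<ngeo (relem M K)}) \<and>
     dofs M = (\<Union>K\<in>cells M. jsh M K ` {..<nsh (relem M K)}) \<and>
     (\<forall>i. finite {K\<in>cells M. i \<in> jgeo M K ` {..<ngeo (relem M K)}}) \<and>
     (\<forall>i. finite {K\<in>cells M. i \<in> jsh M K ` {..<nsh (relem M K)}}) \<and>
     (case bc of Cauchy u \<Rightarrow> True | Periodic L \<Rightarrow> (\<forall>l. L $ l > 0) \<and> finite (cells M))"

text \<open>Below, \<open>a\<close> is the array of the positions of the geometric nodes; it determines the geometric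
  maps and hence the mesh and its shape functions.\<close>

type_synonym 'd nodes = "nat \<Rightarrow> real^'d"

definition gmap :: "('d::finite) mesh_data \<Rightarrow> 'd nodes \<Rightarrow> nat \<Rightarrow> real^'d \<Rightarrow> real^'d" where
  "gmap M a K x =
     (\<Sum>i<ngeo (relem M K). thgeo (relem M K) i x *\<^sub>R (a (jgeo M K i) + offset M K i))"

text \<open>The copy of the cell \<open>K\<close> translated by the period \<open>s\<close>, as the image of the reference cell.\<close>

definition cmap :: "('d::finite) mesh_data \<Rightarrow> 'd nodes \<Rightarrow> nat \<times> (real^'d) \<Rightarrow> real^'d \<Rightarrow> real^'d" where
  "cmap M a c x = gmap M a (fst c) x + snd c"

definition rcell :: "('d::finite) mesh_data \<Rightarrow> nat \<times> (real^'d) \<Rightarrow> (real^'d) set" where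
  "rcell M c = rdom (relem M (fst c))"

text \<open>The function which is \<open>loc K \<circ> T\<^sub>K\<^sup>-\<^sup>1\<close> on the cell \<open>K\<close>, for given functions \<open>loc K\<close> on the reference
  cells. The second predicate says that the values on common faces agree and the result is
  continuous.\<close>

definition glue :: "('d::finite, 'm::finite) boundary \<Rightarrow> 'd mesh_data \<Rightarrow> 'd nodes
    \<Rightarrow> (nat \<Rightarrow> real^'d \<Rightarrow> real) \<Rightarrow> real^'d \<Rightarrow> real" where
  "glue bc M a loc x =
     (SOME y. \<exists>c\<in>cells M \<times> periods bc. \<exists>z\<in>rcell M c. x = cmap M a c z \<and> y = loc (fst c) z)"

definition glues :: "('d::finite, 'm::finite) boundary \<Rightarrow> 'd mesh_data \<Rightarrow> 'd nodes
    \<Rightarrow> (nat \<Rightarrow> real^'d \<Rightarrow> real) \<Rightarrow> bool" where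
  "glues bc M a loc \<longleftrightarrow> continuous_on UNIV (glue bc M a loc) \<and>
     (\<forall>c\<in>cells M \<times> periods bc. \<forall>z\<in>rcell M c. glue bc M a loc (cmap M a c z) = loc (fst c) z)"

text \<open>The restriction of the global shape function of index \<open>j\<close> to a cell, on the reference cell.
  By injectivity of the connectivity arrays there is at most one summand; there is none if the
  function vanishes on the cell.\<close>

definition loc_shape :: "('d::finite) mesh_data \<Rightarrow> nat \<Rightarrow> nat \<Rightarrow> real^'d \<Rightarrow> real" where
  "loc_shape M j K z = (\<Sum>i | i < nsh (relem M K) \<and> jsh M K i = j. th (relem M K) i z)"

definition loc_shape_geo :: "('d::finite) mesh_data \<Rightarrow> nat \<Rightarrow> nat \<Rightarrow> real^'d \<Rightarrow> real" where
  "loc_shape_geo M j K z = (\<Sum>i | i < ngeo (relem M K) \<and> jgeo M K i = j. thgeo (relem M K) i z)"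

definition psi :: "('d::finite, 'm::finite) boundary \<Rightarrow> 'd mesh_data \<Rightarrow> 'd nodes \<Rightarrow> nat \<Rightarrow> real^'d \<Rightarrow> real" where
  "psi bc M a j = glue bc M a (loc_shape M j)"

definition psi_geo :: "('d::finite, 'm::finite) boundary \<Rightarrow> 'd mesh_data \<Rightarrow> 'd nodes \<Rightarrow> nat \<Rightarrow> real^'d \<Rightarrow> real" where
  "psi_geo bc M a j = glue bc M a (loc_shape_geo M j)"

text \<open>A matching mesh: distinct cells meet in a (possibly empty) common proper face.\<close>

definition matching_mesh :: "('d::finite, 'm::finite) boundary \<Rightarrow> 'd mesh_data \<Rightarrow> 'd nodes \<Rightarrow> bool" where
  "matching_mesh bc M a \<longleftrightarrow>
     (\<forall>K\<in>cells M. diffeo_on (rdom (relem M K)) (gmap M a K)) \<and>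
     (\<Union>c\<in>cells M \<times> periods bc. cmap M a c ` rcell M c) = UNIV \<and>
     (\<forall>B. bounded B \<longrightarrow> finite {c\<in>cells M \<times> periods bc. cmap M a c ` rcell M c \<inter> B \<noteq> {}}) \<and>
     (\<forall>c\<in>cells M \<times> periods bc. \<forall>c'\<in>cells M \<times> periods bc. c \<noteq> c' \<longrightarrow>
        (\<exists>F F'. F face_of rcell M c \<and> F \<noteq> rcell M c \<and> F' face_of rcell M c' \<and> F' \<noteq> rcell M c' \<and>
           cmap M a c ` rcell M c \<inter> cmap M a c' ` rcell M c' = cmap M a c ` F \<and>
           cmap M a c ` F = cmap M a c' ` F')) \<and>
     (\<forall>j\<in>dofs M. glues bc M a (loc_shape M j)) \<and>
     (\<forall>j\<in>gnodes M. glues bc M a (loc_shape_geo M j))"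

text \<open>Invertibility of the map that moves the mesh with nodes \<open>a\<close> to the mesh with nodes \<open>b\<close>.\<close>

definition motion_invertible :: "('d::finite, 'm::finite) boundary \<Rightarrow> 'd mesh_data \<Rightarrow> 'd nodes \<Rightarrow> 'd nodes \<Rightarrow> bool" where
  "motion_invertible bc M a b \<longleftrightarrow> (\<exists>\<Phi>. bij \<Phi> \<and>
     (\<forall>c\<in>cells M \<times> periods bc. \<forall>z\<in>rcell M c. \<Phi> (cmap M a c z) = cmap M b c z))"

text \<open>The finite element function with given coefficients. At every point only finitely many summands
  are nonzero.\<close>

definition fe_fun :: "('d::finite, 'm::finite) boundary \<Rightarrow> 'd mesh_data \<Rightarrow> 'd nodes
    \<Rightarrow> (nat \<Rightarrow> 'a::real_normed_vector) \<Rightarrow> real^'d \<Rightarrow> 'a" where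
  "fe_fun bc M a V x = (\<Sum>\<^sub>\<infinity>i\<in>dofs M. psi bc M a i x *\<^sub>R V i)"

definition fe_fun_geo :: "('d::finite, 'm::finite) boundary \<Rightarrow> 'd mesh_data \<Rightarrow> 'd nodes
    \<Rightarrow> (nat \<Rightarrow> 'a::real_normed_vector) \<Rightarrow> real^'d \<Rightarrow> 'a" where
  "fe_fun_geo bc M a V x = (\<Sum>\<^sub>\<infinity>i\<in>gnodes M. psi_geo bc M a i x *\<^sub>R V i)"

text \<open>The gradient and divergence of piecewise smooth functions are only integrated; their values on
  the boundaries of the cells, where the functions may not be differentiable, are irrelevant.\<close>

definition grad :: "(real^'d \<Rightarrow> real) \<Rightarrow> real^'d \<Rightarrow> real^'d" where
  "grad g x = (\<chi> l. frechet_derivative g (at x) (axis l 1))"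

definition divg :: "(real^'d \<Rightarrow> real^'d) \<Rightarrow> real^'d \<Rightarrow> real" where
  "divg w x = (\<Sum>l\<in>UNIV. frechet_derivative w (at x) (axis l 1) $ l)"

definition supp :: "('d::finite, 'm::finite) boundary \<Rightarrow> 'd mesh_data \<Rightarrow> 'd nodes \<Rightarrow> nat \<Rightarrow> (real^'d) set" where
  "supp bc M a i = closure {x. psi bc M a i x \<noteq> 0}"

definition infl :: "('d::finite, 'm::finite) boundary \<Rightarrow> 'd mesh_data \<Rightarrow> 'd nodes \<Rightarrow> (real^'d) set \<Rightarrow> nat set" where
  "infl bc M a E = {j\<in>dofs M. emeasure lebesgue (supp bc M a j \<inter> E \<inter> domain bc) \<noteq> 0}"

definition mass :: "('d::finite, 'm::finite) boundary \<Rightarrow> 'd mesh_data \<Rightarrow> 'd nodes \<Rightarrow> nat \<Rightarrow> real" where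
  "mass bc M a i = (LINT x:domain bc|lebesgue. psi bc M a i x)"

text \<open>Integrals over the support of a shape function may be taken over the whole domain when the
  integrand has that shape function as a factor.\<close>

definition cvec :: "('d::finite, 'm::finite) boundary \<Rightarrow> 'd mesh_data \<Rightarrow> 'd nodes \<Rightarrow> nat \<Rightarrow> nat \<Rightarrow> real^'d" where
  "cvec bc M a i j = (LINT x:domain bc|lebesgue. psi bc M a i x *\<^sub>R grad (psi bc M a j) x)"

section \<open>The schemes\<close>

text \<open>Artificial viscosity, for coefficients \<open>c\<close>, neighborhoods \<open>N i\<close> (the set \<open>\<I>(S\<^sub>i)\<close>), ALE velocity
  coefficients \<open>W\<close> and states \<open>U\<close>. If \<open>c i j = 0\<close> the corresponding term of the maximum is zero.\<close>

definition visc_off :: "('d::finite, 'm::finite) speed \<Rightarrow> ('d, 'm) flux \<Rightarrow> (nat \<Rightarrow> nat set)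
    \<Rightarrow> (nat \<Rightarrow> nat \<Rightarrow> real^'d) \<Rightarrow> (nat \<Rightarrow> real^'d) \<Rightarrow> (nat \<Rightarrow> real^'m) \<Rightarrow> nat \<Rightarrow> nat \<Rightarrow> real" where
  "visc_off lmax f N c W U i j =
     (if j \<in> N i then
        max (lmax (ale_flux f (W j)) (c i j /\<^sub>R norm (c i j)) (U i) (U j) * norm (c i j))
            (lmax (ale_flux f (W i)) (c j i /\<^sub>R norm (c j i)) (U j) (U i) * norm (c j i))
      else 0)"

definition visc :: "('d::finite, 'm::finite) speed \<Rightarrow> ('d, 'm) flux \<Rightarrow> (nat \<Rightarrow> nat set)
    \<Rightarrow> (nat \<Rightarrow> nat \<Rightarrow> real^'d) \<Rightarrow> (nat \<Rightarrow> real^'d) \<Rightarrow> (nat \<Rightarrow> real^'m) \<Rightarrow> nat \<Rightarrow> nat \<Rightarrow> real" where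
  "visc lmax f N c W U i j =
     (if i = j then - (\<Sum>k\<in>N i - {i}. visc_off lmax f N c W U k i)
      else visc_off lmax f N c W U i j)"

definition ale_step :: "('d::finite, 'm::finite) speed \<Rightarrow> ('d, 'm) flux \<Rightarrow> nat set \<Rightarrow> (nat \<Rightarrow> nat set)
    \<Rightarrow> (nat \<Rightarrow> nat \<Rightarrow> real^'d) \<Rightarrow> (nat \<Rightarrow> real^'d) \<Rightarrow> real
    \<Rightarrow> (nat \<Rightarrow> real) \<Rightarrow> (nat \<Rightarrow> real^'m) \<Rightarrow> (nat \<Rightarrow> real) \<Rightarrow> (nat \<Rightarrow> real^'m) \<Rightarrow> bool" where
  "ale_step lmax f I N c W \<tau> m U m' U' \<longleftrightarrow>
     (\<forall>i\<in>I. (m' i *\<^sub>R U' i - m i *\<^sub>R U i) /\<^sub>R \<tau> +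
        (\<Sum>j\<in>N i. (f (U j) - tensor (U j) (W j)) *v c i j - visc lmax f N c W U i j *\<^sub>R U j) = 0)"

text \<open>In the Cauchy problem the initial approximation is constant outside a compact set.\<close>

definition data_ok :: "('d::finite, 'm::finite) boundary \<Rightarrow> 'd mesh_data \<Rightarrow> 'd nodes \<Rightarrow> (nat \<Rightarrow> real^'m) \<Rightarrow> bool" where
  "data_ok bc M a U \<longleftrightarrow> (case bc of
     Cauchy u \<Rightarrow> (\<exists>C. compact C \<and> (\<forall>x. x \<notin> C \<longrightarrow> fe_fun bc M a U x = u))
   | Periodic L \<Rightarrow> True)"

text \<open>Time steps may vary: the \<open>n\<close>-th one is \<open>t (Suc n) - t n\<close>. In Version 1, \<open>mm n\<close> are the masses
  evolved by the scheme, which are in general not the integrals of the shape functions for \<open>n > 0\<close>.\<close>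

definition scheme1 :: "('d::finite, 'm::finite) boundary \<Rightarrow> 'd mesh_data \<Rightarrow> ('d, 'm) speed \<Rightarrow> ('d, 'm) flux
    \<Rightarrow> (nat \<Rightarrow> real) \<Rightarrow> (nat \<Rightarrow> 'd nodes) \<Rightarrow> (nat \<Rightarrow> nat \<Rightarrow> real^'d)
    \<Rightarrow> (nat \<Rightarrow> nat \<Rightarrow> real) \<Rightarrow> (nat \<Rightarrow> nat \<Rightarrow> real^'m) \<Rightarrow> bool" where
  "scheme1 bc M lmax f t a W mm U \<longleftrightarrow>
     strict_mono t \<and> data_ok bc M (a 0) (U 0) \<and>
     (\<forall>i\<in>dofs M. mm 0 i = mass bc M (a 0) i) \<and>
     (\<forall>n. let \<tau> = t (Suc n) - t n; w = fe_fun bc M (a n) (W n) in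
        matching_mesh bc M (a n) \<and>
        (\<forall>i\<in>gnodes M. a (Suc n) i = a n i + \<tau> *\<^sub>R w (a n i)) \<and>
        (\<forall>i\<in>dofs M. mm n i > 0 \<and>
           mm (Suc n) i = mm n i + \<tau> * (LINT x:supp bc M (a n) i \<inter> domain bc|lebesgue.
                                            psi bc M (a n) i x * divg w x)) \<and>
        ale_step lmax f (dofs M) (\<lambda>i. infl bc M (a n) (supp bc M (a n) i)) (cvec bc M (a n)) (W n) \<tau>
          (mm n) (U n) (mm (Suc n)) (U (Suc n)))"

text \<open>A quadrature rule on \<open>[0, 1]\<close> with weights \<open>\<omega> l\<close> and points \<open>\<zeta> l\<close> for \<open>l \<in> Q\<close>.\<close>

definition quadrature_exact :: "nat set \<Rightarrow> (nat \<Rightarrow> real) \<Rightarrow> (nat \<Rightarrow> real) \<Rightarrow> nat \<Rightarrow> bool" where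
  "quadrature_exact Q \<omega> \<zeta> k \<longleftrightarrow> finite Q \<and> (\<forall>l\<in>Q. 0 \<le> \<zeta> l \<and> \<zeta> l \<le> 1) \<and>
     (\<forall>p :: real poly. degree p \<le> k \<longrightarrow> (\<Sum>l\<in>Q. \<omega> l * poly p (\<zeta> l)) = integral {0..1} (poly p))"

text \<open>Node positions at time \<open>s\<close> during the time step starting at time \<open>tn\<close>.\<close>

definition moving :: "('d::finite) nodes \<Rightarrow> (nat \<Rightarrow> real^'d) \<Rightarrow> real \<Rightarrow> real \<Rightarrow> 'd nodes" where
  "moving a Wg tn s i = a i + (s - tn) *\<^sub>R Wg i"

text \<open>In Version 2, \<open>Wg n\<close> and \<open>W n\<close> are the coefficients of the ALE velocity in the geometric basis and
  in the basis of the approximation space.\<close>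

definition scheme2 :: "('d::finite, 'm::finite) boundary \<Rightarrow> 'd mesh_data \<Rightarrow> ('d, 'm) speed \<Rightarrow> ('d, 'm) flux
    \<Rightarrow> nat set \<Rightarrow> (nat \<Rightarrow> real) \<Rightarrow> (nat \<Rightarrow> real)
    \<Rightarrow> (nat \<Rightarrow> real) \<Rightarrow> (nat \<Rightarrow> 'd nodes) \<Rightarrow> (nat \<Rightarrow> nat \<Rightarrow> real^'d) \<Rightarrow> (nat \<Rightarrow> nat \<Rightarrow> real^'d)
    \<Rightarrow> (nat \<Rightarrow> nat \<Rightarrow> real^'m) \<Rightarrow> bool" where
  "scheme2 bc M lmax f Q \<omega> \<zeta> t a Wg W U \<longleftrightarrow>
     strict_mono t \<and> data_ok bc M (a 0) (U 0) \<and>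
     (\<forall>K\<in>cells M. geo_subspace (relem M K)) \<and>
     quadrature_exact Q \<omega> \<zeta> (CARD('d) - 1) \<and>
     (\<forall>n. let \<tau> = t (Suc n) - t n; b = moving (a n) (Wg n) (t n) in
        (\<forall>x. fe_fun_geo bc M (a n) (Wg n) x = fe_fun bc M (a n) (W n) x) \<and>
        (\<forall>s\<in>{t n..t (Suc n)}. matching_mesh bc M (b s) \<and> motion_invertible bc M (a n) (b s)) \<and>
        (\<forall>i\<in>gnodes M. a (Suc n) i = b (t (Suc n)) i) \<and>
        ale_step lmax f (dofs M) (\<lambda>i. infl bc M (a n) (supp bc M (a n) i))
          (\<lambda>i j. \<Sum>l\<in>Q. \<omega> l *\<^sub>R cvec bc M (b (t n + \<tau> * \<zeta> l)) i j) (W n) \<tau>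
          (mass bc M (a n)) (U n) (mass bc M (a (Suc n))) (U (Suc n)))"

end

theory Submission
  imports Defs
begin

text \<open>
Both schemes have the same algebraic core. Let \<open>u\<close> be the far-field state and
\<open>e\<^sub>j = U\<^sub>j - u\<close> the excess of the state \<open>U\<^sub>j\<close> over it. If

  \<^item> the coefficients have vanishing row sums, \<open>\<Sum>\<^sub>j c\<^sub>i\<^sub>j = 0\<close>,
  \<^item> the viscosities are symmetric with vanishing row sums, and
  \<^item> the masses obey \<open>(m'\<^sub>i - m\<^sub>i) u = \<tau> (\<Sum>\<^sub>j W\<^sub>j \<bullet> c\<^sub>i\<^sub>j) u\<close>,

then a constant state is preserved, and one step can be written
\<open>m'\<^sub>i e'\<^sub>i = m\<^sub>i e\<^sub>i - \<tau> \<Sum>\<^sub>j H\<^sub>i\<^sub>j\<close>, where \<open>H\<^sub>i\<^sub>j\<close> is linear in \<open>c\<^sub>i\<^sub>j\<close> and \<open>d\<^sub>i\<^sub>j\<close> and vanishes when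
\<open>e\<^sub>j = 0\<close>. Hence the excess spreads only to neighbors and stays finitely supported, so that all sums
can be interchanged, and \<open>\<Sum>\<^sub>i \<Sum>\<^sub>j H\<^sub>i\<^sub>j = 0\<close> as soon as the columns \<open>\<Sum>\<^sub>i c\<^sub>i\<^sub>j\<close> vanish as well. This is
\<open>ale_step_conserves_excess\<close>. In Version 2 the weighted sum of the excess is the integral of
\<open>u\<^sub>h - u\<close> (\<open>excess_integral\<close>). It remains to verify the hypotheses on \<open>c\<close> and on the masses.

\<^bold>\<open>Row and column sums.\<close> As the shape functions sum to \<open>1\<close>, the column sum is \<open>\<integral> \<nabla>\<psi>\<^sub>j\<close>
(\<open>cvec_column_sum\<close>). This integral is shown to vanish without boundary terms on curved cells:
\<open>\<psi>\<^sub>j\<close> is globally Lipschitz (\<open>psi_lipschitz\<close>) and differentiable off the null set of cell boundaries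
(\<open>negligible_cell_boundaries\<close>), so its partial derivatives are bounded limits of difference quotients,
whose integrals are zero because translations, or shifts of a periodic function, do not change the
integral (\<open>integral_directional_derivative_eq_0\<close>). The row sums are the case of a constant velocity in
\<open>\<integral> \<psi>\<^sub>i \<nabla>\<cdot>w = \<Sum>\<^sub>j W\<^sub>j \<bullet> c\<^sub>i\<^sub>j\<close> (\<open>divergence_integral\<close>), which also is the mass law of Version 1.

The sums run over the neighborhoods at the beginning of the step, whereas Version 2 uses coefficients
at later times. A coefficient can only be nonzero if the product of the two shape functions is, and
this is decided on the reference cells (\<open>overlap_iff\<close>), independently of the node positions.

\<^bold>\<open>The mass law of Version 2.\<close> In the periodic case \<open>u = 0\<close> and it holds trivially. In the
Cauchy problem (\<open>geometric_conservation_law\<close>) pull everything back to the reference cells. The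
Jacobian matrix of the geometric map is \<open>A + r C\<close> after the fraction \<open>r\<close> of the step, the mass density
is a shape function times \<open>\<bar>det (A + r C)\<bar>\<close>, and by Jacobi's formula the \<open>r\<close>-derivative of the
determinant is the determinant times the pulled back divergence of \<open>\<tau> w\<close>. The determinant keeps
its sign, and is a polynomial of degree at most \<open>d\<close> in \<open>r\<close>, so the quadrature integrates its
derivative exactly
(\<open>quadrature_abs_det_increment\<close>), at every point of the reference cell.
\<close>

section \<open>Lipschitz bounds\<close>

text \<open>A bound on the local slope at every point gives a global Lipschitz bound: on a segment, increments
  bounded by slope times length add up, and short intervals containing a given point satisfy the bound
  because both halves do. Compactness of the segment enters through the bisection principle
  \<open>Bolzano\<close>.\<close>

lemma lipschitz_from_pointwise_bound:
  fixes f :: "'a::real_normed_vector \<Rightarrow> real"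
  assumes "0 \<le> C"
    and loc: "\<And>x e. e > 0 \<Longrightarrow> \<exists>d>0. \<forall>y. norm (y - x) < d \<longrightarrow> \<bar>f y - f x\<bar> \<le> (C + e) * norm (y - x)"
  shows "\<bar>f y - f x\<bar> \<le> C * norm (y - x)"
proof -
  have main: "\<bar>f y - f x\<bar> \<le> (C + e) * norm (y - x)" if "e > 0" for e
  proof -
    define p where "p s = x + s *\<^sub>R (y - x)" for s
    have diff: "norm (p b - p a) = \<bar>b - a\<bar> * norm (y - x)" for a b
      by (simp add: p_def flip: scaleR_left_diff_distrib)
    have "\<bar>f (p 1) - f (p 0)\<bar> \<le> (C + e) * ((1 - 0) * norm (y - x))"
    proof (rule Bolzano[of 0 1])
      show "\<bar>f (p c) - f (p a)\<bar> \<le> (C + e) * ((c - a) * norm (y - x))"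
        if "\<bar>f (p b) - f (p a)\<bar> \<le> (C + e) * ((b - a) * norm (y - x))"
          "\<bar>f (p c) - f (p b)\<bar> \<le> (C + e) * ((c - b) * norm (y - x))" for a b c
        using that by (simp add: algebra_simps)
    next
      fix s :: real
      obtain d where "d > 0"
        and d: "\<And>z. norm (z - p s) < d \<Longrightarrow> \<bar>f z - f (p s)\<bar> \<le> (C + e) * norm (z - p s)"
        using loc[OF \<open>e > 0\<close>] by blast
      \<comment> \<open>The summand \<open>1\<close> avoids a case distinction for \<open>y = x\<close>.\<close>
      define r where "r = d / (norm (y - x) + 1)"
      have "r > 0" unfolding r_def
        by (intro divide_pos_pos \<open>d > 0\<close>) (simp add: add_nonneg_pos)
      have near: "\<bar>f (p z) - f (p s)\<bar> \<le> (C + e) * (\<bar>z - s\<bar> * norm (y - x))" if "\<bar>z - s\<bar> < r" for z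
      proof -
        have "\<bar>z - s\<bar> * norm (y - x) \<le> \<bar>z - s\<bar> * (norm (y - x) + 1)"
          by (simp add: mult_left_mono)
        also have "\<dots> < r * (norm (y - x) + 1)"
          by (intro mult_strict_right_mono that) (simp add: add_nonneg_pos)
        also have "\<dots> = d"
          unfolding r_def by (metis add_nonneg_pos less_numeral_extra(3) nonzero_divide_eq_eq norm_ge_zero zero_less_one)
        finally show ?thesis using d[of "p z"] by (simp add: diff)
      qed
      have "\<bar>f (p b) - f (p a)\<bar> \<le> (C + e) * ((b - a) * norm (y - x))"
        if "a \<le> s" "s \<le> b" "b - a < r" for a b
        using near[of a] near[of b] that by (simp add: algebra_simps)
      then show "\<exists>d>0. \<forall>a b. a \<le> s \<and> s \<le> b \<and> b - a < d \<longrightarrow>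
          \<bar>f (p b) - f (p a)\<bar> \<le> (C + e) * ((b - a) * norm (y - x))"
        using \<open>r > 0\<close> by blast
    qed simp
    then show ?thesis by (simp add: p_def)
  qed
  show ?thesis
  proof (rule field_le_epsilon)
    fix e :: real assume "e > 0"
    define e' where "e' = e / (norm (y - x) + 1)"
    have n1: "norm (y - x) + 1 > 0" by (simp add: add_nonneg_pos)
    then have "e' > 0" using \<open>e > 0\<close> by (simp add: e'_def)
    have "e' * norm (y - x) \<le> e"
      using n1 \<open>e > 0\<close> unfolding e'_def by (simp add: field_simps)
    then show "\<bar>f y - f x\<bar> \<le> C * norm (y - x) + e"
      using main[OF \<open>e' > 0\<close>] by (simp add: algebra_simps)
  qed
qed

text \<open>At a point, only the finitely many pieces containing it matter nearby, the others having positive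
  distance. So the local slope is bounded by the derivatives of these pieces, although the function may
  have no derivative there. The pieces need not be convex.\<close>

lemma lipschitz_piecewise:
  fixes f :: "'a::euclidean_space \<Rightarrow> real"
  assumes "0 \<le> B"
    and cover: "(\<Union>i\<in>I. C i) = UNIV" and closed: "\<And>i. i \<in> I \<Longrightarrow> closed (C i)"
    and fin: "\<And>x. finite {i \<in> I. C i \<inter> ball x 1 \<noteq> {}}"
    and der: "\<And>i x. i \<in> I \<Longrightarrow> x \<in> C i \<Longrightarrow>
      \<exists>f'. (f has_derivative f') (at x within C i) \<and> (\<forall>v. \<bar>f' v\<bar> \<le> B * norm v)"
  shows "\<bar>f y - f x\<bar> \<le> B * norm (y - x)"
proof (rule lipschitz_from_pointwise_bound[OF \<open>0 \<le> B\<close>])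
  fix x and e :: real assume "e > 0"
  define J where "J = {i \<in> I. C i \<inter> ball x 1 \<noteq> {}}"
  have "\<exists>d>0. \<forall>y\<in>C i. norm (y - x) < d \<longrightarrow> \<bar>f y - f x\<bar> \<le> (B + e) * norm (y - x)" if i: "i \<in> I" for i
  proof (cases "x \<in> C i")
    case True
    from der[OF i this] obtain f' where f': "(f has_derivative f') (at x within C i)"
      and B: "\<And>v. \<bar>f' v\<bar> \<le> B * norm v" by blast
    from f' \<open>e > 0\<close> obtain d where "d > 0"
      and d: "\<And>y. y \<in> C i \<Longrightarrow> norm (y - x) < d \<Longrightarrow> norm (f y - f x - f' (y - x)) \<le> e * norm (y - x)"
      unfolding has_derivative_within_alt by blast
    have "\<bar>f y - f x\<bar> \<le> (B + e) * norm (y - x)" if "y \<in> C i" "norm (y - x) < d" for y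
      using d[OF that] B[of "y - x"] by (simp add: algebra_simps)
    with \<open>d > 0\<close> show ?thesis by blast
  next
    case False
    then obtain d where "d > 0" "ball x d \<subseteq> - C i"
      using open_contains_ball[of "- C i"] closed[OF i] by (auto simp: open_Compl)
    then have "norm (y - x) \<ge> d" if "y \<in> C i" for y
      using that by (force simp: dist_norm norm_minus_commute)
    with \<open>d > 0\<close> show ?thesis by force
  qed
  then obtain d where d: "\<And>i. i \<in> I \<Longrightarrow> d i > 0"
    "\<And>i y. i \<in> I \<Longrightarrow> y \<in> C i \<Longrightarrow> norm (y - x) < d i \<Longrightarrow> \<bar>f y - f x\<bar> \<le> (B + e) * norm (y - x)"
    by metis
  define r where "r = Min (insert 1 (d ` J))"
  have J: "finite J" "J \<subseteq> I" using fin by (auto simp: J_def)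
  have r: "r > 0" "r \<le> 1" "\<And>i. i \<in> J \<Longrightarrow> r \<le> d i"
    using J d(1) by (auto simp: r_def)
  have "\<bar>f y - f x\<bar> \<le> (B + e) * norm (y - x)" if y: "norm (y - x) < r" for y
  proof -
    obtain i where i: "i \<in> I" "y \<in> C i" using cover by blast
    moreover have "y \<in> ball x 1" using y r(2) by (simp add: dist_norm norm_minus_commute)
    ultimately have "i \<in> J" by (auto simp: J_def)
    then show ?thesis using d(2)[OF i] r(3) y by fastforce
  qed
  with r(1) show "\<exists>d>0. \<forall>y. norm (y - x) < d \<longrightarrow> \<bar>f y - f x\<bar> \<le> (B + e) * norm (y - x)" by blast
qed

section \<open>Integrals of derivatives\<close>

lemma has_derivative_difference_quotients:
  fixes g :: "'a::real_normed_vector \<Rightarrow> real"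
  assumes g: "(g has_derivative g') (at x)" and h: "h \<longlonglongrightarrow> 0" "\<And>k::nat. h k \<noteq> 0"
  shows "(\<lambda>k. (g (x + h k *\<^sub>R e) - g x) / h k) \<longlonglongrightarrow> g' e"
proof -
  have "((\<lambda>s. x + s *\<^sub>R e) has_derivative (\<lambda>s. s *\<^sub>R e)) (at 0)"
    by (auto intro!: derivative_eq_intros)
  moreover have "(g has_derivative g') (at (x + 0 *\<^sub>R e))"
    using g by simp
  ultimately have "((\<lambda>s. g (x + s *\<^sub>R e)) has_derivative (\<lambda>s. g' (s *\<^sub>R e))) (at 0)"
    by (rule has_derivative_compose)
  moreover have "(\<lambda>s. g' (s *\<^sub>R e)) = (*) (g' e)"
    using linear_scale[OF has_derivative_linear[OF g]] by (auto simp: mult.commute)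
  ultimately have "((\<lambda>s. g (x + s *\<^sub>R e)) has_field_derivative g' e) (at 0)"
    by (simp add: has_field_derivative_def)
  then have *: "((\<lambda>s. (g (x + s *\<^sub>R e) - g x) / s) \<longlongrightarrow> g' e) (at 0)"
    by (simp add: DERIV_def)
  have "filterlim h (at 0) sequentially"
    using h by (auto simp: filterlim_at)
  with * show ?thesis
    by (rule filterlim_compose)
qed

text \<open>The derivative is almost everywhere the limit of difference quotients, which the Lipschitz constant
  bounds. By dominated convergence its integral is the limit of their integrals, and these vanish when
  small shifts do not change the integral of the function. Both boundary conditions provide this
  invariance.\<close>

lemma integral_directional_derivative_eq_0:
  fixes g :: "'a::euclidean_space \<Rightarrow> real"
  assumes lip: "\<And>x y. \<bar>g y - g x\<bar> \<le> L * norm (y - x)"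
    and N: "negligible N" and diff: "\<And>x. x \<notin> N \<Longrightarrow> g differentiable at x"
    and "r > 0" and inv: "\<And>h. 0 < h \<Longrightarrow> h < r \<Longrightarrow>
      integral (cbox a b) (\<lambda>x. g (x + h *\<^sub>R e)) = integral (cbox a b) g"
  shows "(\<lambda>x. frechet_derivative g (at x) e) absolutely_integrable_on cbox a b"
    and "integral (cbox a b) (\<lambda>x. frechet_derivative g (at x) e) = 0"
proof -
  \<comment> \<open>A null sequence of admissible shifts; halving \<open>r\<close> makes the first one strictly smaller than \<open>r\<close>.\<close>
  define h where "h k = (r / 2) / real (Suc k)" for k
  have h0: "h k > 0" "h k < r" for k
  proof -
    show "h k > 0" using \<open>r > 0\<close> by (simp add: h_def)
    have "h k \<le> r / 2" using \<open>r > 0\<close> by (simp add: h_def field_simps)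
    then show "h k < r" using \<open>r > 0\<close> by linarith
  qed
  have hlim: "h \<longlonglongrightarrow> 0"
    unfolding h_def by (rule lim_const_over_n[THEN LIMSEQ_Suc])
  define q where "q k x = (g (x + h k *\<^sub>R e) - g x) / h k" for k x
  \<comment> \<open>On the exceptional set the quotients may diverge, so they are replaced by \<open>0\<close> there.\<close>
  define f where "f k x = (if x \<in> N then 0 else q k x)" for k x
  define G where "G x = (if x \<in> N then 0 else frechet_derivative g (at x) e)" for x
  have cont: "continuous_on S g" for S
  proof (rule lipschitz_on_continuous_on)
    show "\<bar>L\<bar>-lipschitz_on S g"
    proof (rule lipschitz_onI)
      fix x y
      have "\<bar>g x - g y\<bar> \<le> L * norm (x - y)" by (rule lip)
      also have "\<dots> \<le> \<bar>L\<bar> * norm (x - y)" by (intro mult_right_mono) auto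
      finally show "dist (g x) (g y) \<le> \<bar>L\<bar> * dist x y" by (simp add: dist_norm)
    qed simp
  qed
  have gint: "g integrable_on cbox a b" "(\<lambda>x. g (x + c)) integrable_on cbox a b" for c
    by (intro integrable_continuous cont continuous_on_compose2[OF cont[of UNIV]] continuous_intros; simp)+
  have qint: "q k integrable_on cbox a b" "integral (cbox a b) (q k) = 0" for k
  proof -
    show "q k integrable_on cbox a b"
      unfolding q_def by (intro integrable_on_divide integrable_diff gint)
    show "integral (cbox a b) (q k) = 0"
      unfolding q_def using h0[of k] by (simp add: integral_diff gint inv)
  qed
  have qbound: "\<bar>q k x\<bar> \<le> \<bar>L\<bar> * norm e" for k x
  proof -
    have "\<bar>g (x + h k *\<^sub>R e) - g x\<bar> \<le> L * norm (h k *\<^sub>R e)"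
      using lip[of "x + h k *\<^sub>R e" x] by simp
    also have "\<dots> = h k * (L * norm e)" using h0[of k] by simp
    also have "\<dots> \<le> h k * (\<bar>L\<bar> * norm e)"
      using h0[of k] by (intro mult_left_mono mult_right_mono) auto
    finally show ?thesis using h0[of k] by (simp add: q_def field_simps)
  qed
  have fint: "f k integrable_on cbox a b" "integral (cbox a b) (f k) = 0" for k
  proof -
    have "(q k has_integral 0) (cbox a b)"
      using qint[of k] by (simp add: has_integral_iff)
    then have "(f k has_integral 0) (cbox a b)"
      by (rule has_integral_spike[OF N, rotated]) (auto simp: f_def)
    then show "f k integrable_on cbox a b" "integral (cbox a b) (f k) = 0"
      by (auto simp: has_integral_iff)
  qed
  have flim: "(\<lambda>k. f k x) \<longlonglongrightarrow> G x" for x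
  proof (cases "x \<in> N")
    case False
    then have "(g has_derivative frechet_derivative g (at x)) (at x)"
      using diff frechet_derivative_works by blast
    from has_derivative_difference_quotients[OF this hlim, of e] h0 False
    show ?thesis by (simp add: f_def G_def q_def less_imp_neq[symmetric])
  qed (simp add: f_def G_def)
  have fbound: "norm (f k x) \<le> \<bar>L\<bar> * norm e" for k x
    using qbound[of k x] by (auto simp: f_def)
  have Gbound: "norm (G x) \<le> \<bar>L\<bar> * norm e" for x
    by (rule LIMSEQ_le_const2[OF tendsto_norm[OF flim[of x]]]) (use fbound in blast)
  have fabs: "f k absolutely_integrable_on cbox a b" for k
    by (rule absolutely_integrable_integrable_bound[where g="\<lambda>_. \<bar>L\<bar> * norm e"])
      (use fbound fint in auto)
  have "G absolutely_integrable_on cbox a b"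
    by (rule dominated_convergence_absolutely_integrable[where h="\<lambda>_. \<bar>L\<bar> * norm e" and f=f])
      (use Gbound flim fabs in auto)
  then show "(\<lambda>x. frechet_derivative g (at x) e) absolutely_integrable_on cbox a b"
    by (rule absolutely_integrable_spike[OF _ N]) (auto simp: G_def)
  have "(\<lambda>k. integral (cbox a b) (f k)) \<longlonglongrightarrow> integral (cbox a b) G"
    by (rule dominated_convergence(2)[where h="\<lambda>_. \<bar>L\<bar> * norm e"])
      (use fbound fint flim in auto)
  then have "integral (cbox a b) G = 0"
    using fint by (simp add: LIMSEQ_const_iff)
  moreover have "integral (cbox a b) (\<lambda>x. frechet_derivative g (at x) e) = integral (cbox a b) G"
    by (rule integral_spike[OF N]) (auto simp: G_def)
  ultimately show "integral (cbox a b) (\<lambda>x. frechet_derivative g (at x) e) = 0" by simp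
qed

text \<open>On a box with a margin of width \<open>1\<close> around the support, shifts of length at most \<open>1\<close> keep the
  integral.\<close>

lemma integral_derivative_compact_support:
  fixes g :: "'a::euclidean_space \<Rightarrow> real"
  assumes lip: "\<And>x y. \<bar>g y - g x\<bar> \<le> L * norm (y - x)"
    and N: "negligible N" and diff: "\<And>x. x \<notin> N \<Longrightarrow> g differentiable at x"
    and S: "bounded S" and supp: "\<And>x. x \<notin> S \<Longrightarrow> g x = 0"
  shows "(\<lambda>x. frechet_derivative g (at x) e) absolutely_integrable_on UNIV"
    and "integral UNIV (\<lambda>x. frechet_derivative g (at x) e) = 0"
proof -
  define r where "r = 1 / (norm e + 1)"
  have "r > 0" by (simp add: r_def add_nonneg_pos)
  obtain B where B: "\<And>x. x \<in> S \<Longrightarrow> norm x \<le> B"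
    using S bounded_iff by blast
  define S' :: "'a set" where "S' = cball 0 (B + 1)"
  obtain c where c: "S' \<subseteq> cbox (-c) c"
    using bounded_subset_cbox_symmetric[of S'] unfolding S'_def by blast
  have out: "g (x + h) = 0" if "x \<notin> S'" "norm h \<le> 1" for x h
  proof (rule supp, rule notI)
    assume "x + h \<in> S"
    then have "norm (x + h) \<le> B" by (rule B)
    moreover have "norm x \<le> norm (x + h) + norm h"
      by (metis add_diff_cancel_right' norm_triangle_ineq4)
    ultimately show False using that by (simp add: S'_def)
  qed
  have inv: "integral (cbox (-c) c) (\<lambda>x. g (x + h *\<^sub>R e)) = integral (cbox (-c) c) g"
    if h: "0 < h" "h < r" for h
  proof -
    have he: "norm (h *\<^sub>R e) \<le> 1"
    proof -
      have "h * norm e \<le> r * norm e" using h by (intro mult_right_mono) auto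
      also have "\<dots> \<le> 1" using \<open>r > 0\<close> by (simp add: r_def divide_le_eq add_nonneg_pos)
      finally show ?thesis using h by simp
    qed
    have "integral (cbox (-c) c) (\<lambda>x. g (x + h *\<^sub>R e)) =
        integral (cbox (- c + h *\<^sub>R e) (c + h *\<^sub>R e)) g"
      using integral_shift_cbox_plus[of "-c" c g "h *\<^sub>R e"] by (simp add: o_def add.commute)
    also have "\<dots> = integral UNIV g"
    proof -
      have "integral UNIV (\<lambda>x. if x \<in> cbox (- c + h *\<^sub>R e) (c + h *\<^sub>R e) then g x else 0) = integral UNIV g"
      proof (rule integral_cong)
        fix x
        have "g x = 0" if "x \<notin> cbox (- c + h *\<^sub>R e) (c + h *\<^sub>R e)"
        proof -
          have "x - h *\<^sub>R e \<notin> cbox (-c) c"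
            using that by (auto simp: mem_box algebra_simps)
          then show ?thesis using out[of "x - h *\<^sub>R e" "h *\<^sub>R e"] c he by auto
        qed
        then show "(if x \<in> cbox (- c + h *\<^sub>R e) (c + h *\<^sub>R e) then g x else 0) = g x" by auto
      qed
      then show ?thesis by (simp add: integral_restrict_UNIV)
    qed
    also have "\<dots> = integral (cbox (-c) c) g"
    proof -
      have "integral UNIV (\<lambda>x. if x \<in> cbox (-c) c then g x else 0) = integral UNIV g"
        by (rule integral_cong) (use out[of _ 0] c in auto)
      then show ?thesis by (simp add: integral_restrict_UNIV)
    qed
    finally show ?thesis .
  qed
  note res = integral_directional_derivative_eq_0[OF lip N diff \<open>r > 0\<close> inv]
  have zero: "frechet_derivative g (at x) e = 0" if "x \<notin> cbox (-c) c" for x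
  proof -
    have "(g has_derivative (\<lambda>_. 0)) (at x)"
    proof (rule has_derivative_transform_within_open[where f="\<lambda>_. 0" and s="- cbox (-c) c"])
      show "0 = g y" if "y \<in> - cbox (-c) c" for y
        using out[of y 0] that c by auto
    qed (use that in \<open>auto simp: closed_cbox open_Compl\<close>)
    then have "frechet_derivative g (at x) = (\<lambda>_. 0)"
      by (rule frechet_derivative_at[symmetric])
    then show ?thesis by simp
  qed
  have if_eq: "(\<lambda>x. if x \<in> cbox (-c) c then frechet_derivative g (at x) e else 0) =
      (\<lambda>x. frechet_derivative g (at x) e)"
    using zero by auto
  show "(\<lambda>x. frechet_derivative g (at x) e) absolutely_integrable_on UNIV"
    using res(1) absolutely_integrable_restrict_UNIV[of "cbox (-c) c" "\<lambda>x. frechet_derivative g (at x) e"]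
    by (simp add: if_eq)
  show "integral UNIV (\<lambda>x. frechet_derivative g (at x) e) = 0"
    using res(2) integral_restrict_UNIV[of "cbox (-c) c" "\<lambda>x. frechet_derivative g (at x) e"]
    by (simp add: if_eq)
qed

text \<open>The shifted box sticks out of the original one by a slab, which is a period translate of the slab
  left behind. Cutting the shifted box at height \<open>L $ l\<close> and the original one at height \<open>h\<close> gives two
  pairs of boxes with equal integrals.\<close>

lemma integral_shift_periodic_axis:
  fixes g :: "real^'d \<Rightarrow> real"
  assumes cont: "continuous_on UNIV g" and per: "\<And>x. g (x + L $ l *\<^sub>R axis l 1) = g x"
    and L: "\<And>k. L $ k > 0" and h: "0 < h" "h < L $ l"
  shows "integral (cbox 0 L) (\<lambda>x. g (x + h *\<^sub>R axis l 1)) = integral (cbox 0 L) g"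
proof -
  define e :: "real^'d" where "e = axis l 1"
  have e: "e \<in> Basis" by (simp add: e_def)
  have en: "e $ k = (if k = l then 1 else 0)" for k by (simp add: e_def axis_def)
  have inner: "x \<bullet> e = x $ l" for x by (simp add: e_def inner_axis)
  have gint: "g integrable_on cbox a b" for a b
    by (intro integrable_continuous continuous_on_subset[OF cont] subset_UNIV)
  define lo hi :: "real^'d" where "lo = h *\<^sub>R e" and "hi = L - (L $ l - h) *\<^sub>R e"
  have "integral (cbox 0 L) (\<lambda>x. g (x + h *\<^sub>R e)) = integral (cbox (0 + h *\<^sub>R e) (L + h *\<^sub>R e)) g"
    using integral_shift_cbox_plus[of 0 L g "h *\<^sub>R e"] by (simp add: o_def add.commute)
  also have "\<dots> = integral (cbox (0 + h *\<^sub>R e) (L + h *\<^sub>R e) \<inter> {x. x \<bullet> e \<le> L $ l}) g +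
      integral (cbox (0 + h *\<^sub>R e) (L + h *\<^sub>R e) \<inter> {x. x \<bullet> e \<ge> L $ l}) g"
    by (rule integral_split[OF gint e])
  also have "cbox (0 + h *\<^sub>R e) (L + h *\<^sub>R e) \<inter> {x. x \<bullet> e \<le> L $ l} = cbox lo L"
    using h by (auto simp: inner mem_box_cart en lo_def split: if_splits) (smt (verit))+
  also have "cbox (0 + h *\<^sub>R e) (L + h *\<^sub>R e) \<inter> {x. x \<bullet> e \<ge> L $ l} =
      cbox (0 + (L $ l) *\<^sub>R e) (hi + (L $ l) *\<^sub>R e)"
    using h by (auto simp: inner mem_box_cart en hi_def split: if_splits) (smt (verit))+
  also have "integral (cbox (0 + (L $ l) *\<^sub>R e) (hi + (L $ l) *\<^sub>R e)) g = integral (cbox 0 hi) g"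
    using integral_shift_cbox_plus[of 0 hi g "(L $ l) *\<^sub>R e"] per
    by (simp add: o_def e_def add.commute)
  also have "integral (cbox lo L) g + integral (cbox 0 hi) g = integral (cbox 0 L) g"
  proof -
    have "integral (cbox 0 L) g = integral (cbox 0 L \<inter> {x. x \<bullet> e \<le> h}) g +
        integral (cbox 0 L \<inter> {x. x \<bullet> e \<ge> h}) g"
      by (rule integral_split[OF gint e])
    also have "cbox 0 L \<inter> {x. x \<bullet> e \<le> h} = cbox 0 hi"
      using h by (auto simp: inner mem_box_cart en hi_def split: if_splits) (smt (verit))+
    also have "cbox 0 L \<inter> {x. x \<bullet> e \<ge> h} = cbox lo L"
      using h by (auto simp: inner mem_box_cart en lo_def split: if_splits) (smt (verit))+
    finally show ?thesis by simp
  qed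
  finally show ?thesis by (simp add: e_def)
qed

section \<open>Change of variables for an arbitrary finite index type\<close>

text \<open>Any finite type is in bijection with this copy of an initial segment of the natural numbers. It is
  well-ordered, as the index type in \<open>has_absolute_integral_change_of_variables\<close> is.\<close>

typedef ('d::finite) ordered_index = "{..<CARD('d)}"
  by (rule exI[of _ 0]) simp

instantiation ordered_index :: (finite) linorder
begin
definition "x \<le> y \<longleftrightarrow> Rep_ordered_index x \<le> Rep_ordered_index y"
definition "x < y \<longleftrightarrow> Rep_ordered_index x < Rep_ordered_index y"
instance
  by standard (auto simp: less_eq_ordered_index_def less_ordered_index_def Rep_ordered_index_inject)
end

instance ordered_index :: (finite) wellorder
proof
  fix P :: "'a ordered_index \<Rightarrow> bool" and a
  assume step: "\<And>x. (\<And>y. y < x \<Longrightarrow> P y) \<Longrightarrow> P x"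
  show "P a"
  proof (induction "Rep_ordered_index a" arbitrary: a rule: less_induct)
    case less
    show ?case
      by (rule step, rule less) (simp add: less_ordered_index_def)
  qed
qed

instance ordered_index :: (finite) finite
proof
  show "finite (UNIV :: 'a ordered_index set)"
  proof (rule finite_imageD)
    show "finite (range (Rep_ordered_index :: 'a ordered_index \<Rightarrow> nat))"
      by (simp add: type_definition.Rep_range[OF type_definition_ordered_index])
  qed (simp add: inj_on_def Rep_ordered_index_inject)
qed

lemma ex_bij_ordered_index: "\<exists>\<sigma> :: 'd::finite ordered_index \<Rightarrow> 'd. bij \<sigma>"
proof -
  have "card (UNIV :: 'd ordered_index set) = CARD('d)"
    using type_definition.card[OF type_definition_ordered_index] by simp
  then show ?thesis
    using finite_same_card_bij[of "UNIV :: 'd ordered_index set" "UNIV :: 'd set"] by simp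
qed

text \<open>Permutation of coordinates along a bijection of index types. It maps boxes to boxes of the same
  volume, hence preserves integrals.\<close>

definition reindex :: "('n \<Rightarrow> 'k) \<Rightarrow> 'a^'k \<Rightarrow> 'a^'n" where
  "reindex \<sigma> x = (\<chi> i. x $ \<sigma> i)"

lemma reindex_nth [simp]: "reindex \<sigma> x $ i = x $ \<sigma> i"
  by (simp add: reindex_def)

lemma reindex_inv [simp]:
  "bij \<sigma> \<Longrightarrow> reindex \<sigma> (reindex (inv \<sigma>) x) = x" "bij \<sigma> \<Longrightarrow> reindex (inv \<sigma>) (reindex \<sigma> y) = y"
  by (simp_all add: vec_eq_iff bij_is_inj bij_is_surj surj_f_inv_f)

lemma bounded_linear_reindex: "bounded_linear (reindex \<sigma> :: real^'k \<Rightarrow> real^'n)"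
  by (intro linear_conv_bounded_linear[THEN iffD1] linearI) (simp_all add: vec_eq_iff)

lemma norm_reindex:
  fixes x :: "real^'k::finite" and \<sigma> :: "'n::finite \<Rightarrow> 'k"
  assumes "bij \<sigma>" shows "norm (reindex \<sigma> x) = norm x"
  unfolding norm_vec_def L2_set_def
  using sum.reindex_bij_betw[of \<sigma> UNIV UNIV "\<lambda>i. (norm (x $ i))\<^sup>2"] assms by simp

lemma reindex_cbox:
  fixes u v :: "real^'k::finite" and \<sigma> :: "'n::finite \<Rightarrow> 'k"
  assumes "bij \<sigma>" shows "reindex \<sigma> ` cbox u v = cbox (reindex \<sigma> u) (reindex \<sigma> v)"
proof -
  have all: "(\<forall>i. Q (\<sigma> i)) \<longleftrightarrow> (\<forall>k. Q k)" for Q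
    using surj_f_inv_f[OF bij_is_surj[OF assms]] by metis
  have mem: "(reindex \<sigma> x \<in> cbox (reindex \<sigma> u) (reindex \<sigma> v)) = (x \<in> cbox u v)" for x
    using all[of "\<lambda>k. u $ k \<le> x $ k \<and> x $ k \<le> v $ k"] by (simp add: mem_box_cart)
  show ?thesis
  proof (intro set_eqI iffI)
    fix y :: "real^'n" assume y: "y \<in> cbox (reindex \<sigma> u) (reindex \<sigma> v)"
    have "reindex (inv \<sigma>) y \<in> cbox u v"
      using mem[of "reindex (inv \<sigma>) y"] y by (simp add: assms)
    moreover have "y = reindex \<sigma> (reindex (inv \<sigma>) y)" by (simp add: assms)
    ultimately show "y \<in> reindex \<sigma> ` cbox u v" by (rule rev_image_eqI)
  qed (use mem in auto)
qed

lemma content_reindex_cbox: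
  fixes u v :: "real^'k::finite" and \<sigma> :: "'n::finite \<Rightarrow> 'k"
  assumes "bij \<sigma>" shows "measure lborel (reindex \<sigma> ` cbox u v) = measure lborel (cbox u v)"
proof -
  have "(cbox (reindex \<sigma> u) (reindex \<sigma> v) = {}) = (cbox u v = {})"
    using reindex_cbox[OF assms, of u v] by blast
  moreover have "(\<Prod>i\<in>UNIV. v $ \<sigma> i - u $ \<sigma> i) = (\<Prod>i\<in>UNIV. v $ i - u $ i)"
    using prod.reindex_bij_betw[of \<sigma> UNIV UNIV "\<lambda>i. v $ i - u $ i"] assms by simp
  ultimately show ?thesis
    by (simp add: reindex_cbox[OF assms] content_cbox_if_cart)
qed

lemma has_integral_reindex_cbox:
  fixes f :: "real^'n::finite \<Rightarrow> 'b::real_normed_vector" and \<sigma> :: "'n \<Rightarrow> 'k::finite"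
  assumes \<sigma>: "bij \<sigma>" and f: "(f has_integral i) (cbox (reindex \<sigma> a) (reindex \<sigma> b))"
  shows "((\<lambda>x. f (reindex \<sigma> x)) has_integral i) (cbox a b)"
proof -
  have "((\<lambda>x. f (reindex \<sigma> x)) has_integral (1 / 1) *\<^sub>R i)
      (reindex (inv \<sigma>) ` cbox (reindex \<sigma> a) (reindex \<sigma> b))"
  proof (rule has_integral_twiddle)
    show "\<exists>w z. reindex \<sigma> ` cbox u v = cbox w z" for u v :: "real^'k"
      using reindex_cbox[OF \<sigma>] by blast
    show "\<exists>w z. reindex (inv \<sigma>) ` cbox u v = cbox w z" for u v :: "real^'n"
      using reindex_cbox[OF bij_imp_bij_inv[OF \<sigma>]] by blast
    show "continuous (at x) (reindex \<sigma> :: real^'k \<Rightarrow> real^'n)" for x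
      by (rule linear_continuous_at[OF bounded_linear_reindex])
  qed (use \<sigma> f content_reindex_cbox in auto)
  then show ?thesis
    using \<sigma> by (simp add: reindex_cbox[OF bij_imp_bij_inv[OF \<sigma>]])
qed

lemma has_integral_reindex:
  fixes f :: "real^'n::finite \<Rightarrow> 'b::banach" and \<sigma> :: "'n \<Rightarrow> 'k::finite"
  assumes \<sigma>: "bij \<sigma>" and f: "(f has_integral i) (reindex \<sigma> ` S)"
  shows "((\<lambda>x. f (reindex \<sigma> x)) has_integral i) S"
proof (subst has_integral', intro allI impI)
  fix e :: real assume "e > 0"
  then obtain B where "B > 0" and B: "\<And>a b. ball 0 B \<subseteq> cbox a b \<Longrightarrow>
      \<exists>z. ((\<lambda>x. if x \<in> reindex \<sigma> ` S then f x else 0) has_integral z) (cbox a b) \<and> norm (z - i) < e"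
    using has_integral'[THEN iffD1, OF f] by blast
  have mem: "reindex \<sigma> x \<in> reindex \<sigma> ` S \<longleftrightarrow> x \<in> S" for x
    by (rule inj_image_mem_iff, rule inj_on_inverseI[of _ "reindex (inv \<sigma>)"]) (simp add: \<sigma>)
  have "\<exists>z. ((\<lambda>x. if x \<in> S then f (reindex \<sigma> x) else 0) has_integral z) (cbox a b) \<and> norm (z - i) < e"
    if ab: "ball 0 B \<subseteq> cbox a b" for a b :: "real^'k"
  proof -
    have "ball 0 B \<subseteq> cbox (reindex \<sigma> a) (reindex \<sigma> b)"
    proof
      fix y :: "real^'n" assume "y \<in> ball 0 B"
      then have "reindex (inv \<sigma>) y \<in> cbox a b"
        using ab norm_reindex[OF bij_imp_bij_inv[OF \<sigma>], of y] by auto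
      then show "y \<in> cbox (reindex \<sigma> a) (reindex \<sigma> b)"
        using reindex_cbox[OF \<sigma>, of a b] \<sigma> by (metis image_eqI reindex_inv(1))
    qed
    from B[OF this] obtain z where
      z: "((\<lambda>x. if x \<in> reindex \<sigma> ` S then f x else 0) has_integral z) (cbox (reindex \<sigma> a) (reindex \<sigma> b))"
      "norm (z - i) < e" by blast
    from has_integral_reindex_cbox[OF \<sigma> z(1)] z(2) show ?thesis
      by (auto simp: mem)
  qed
  with \<open>B > 0\<close> show "\<exists>B>0. \<forall>a b. ball 0 B \<subseteq> cbox a b \<longrightarrow>
      (\<exists>z. ((\<lambda>x. if x \<in> S then f (reindex \<sigma> x) else 0) has_integral z) (cbox a b) \<and> norm (z - i) < e)"
    by blast
qed

lemma has_integral_reindex_iff: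
  fixes f :: "real^'n::finite \<Rightarrow> 'b::banach" and \<sigma> :: "'n \<Rightarrow> 'k::finite"
  assumes \<sigma>: "bij \<sigma>"
  shows "((\<lambda>x. f (reindex \<sigma> x)) has_integral i) S \<longleftrightarrow> (f has_integral i) (reindex \<sigma> ` S)"
proof
  assume "((\<lambda>x. f (reindex \<sigma> x)) has_integral i) S"
  moreover have "S = reindex (inv \<sigma>) ` reindex \<sigma> ` S"
    using \<sigma> by (simp add: image_image)
  ultimately have "((\<lambda>x. f (reindex \<sigma> x)) has_integral i) (reindex (inv \<sigma>) ` reindex \<sigma> ` S)"
    by simp
  from has_integral_reindex[OF bij_imp_bij_inv[OF \<sigma>] this]
  show "(f has_integral i) (reindex \<sigma> ` S)"
    using \<sigma> by simp
qed (rule has_integral_reindex[OF \<sigma>])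

lemma absolute_integral_reindex_iff:
  fixes f :: "real^'n::finite \<Rightarrow> 'b::euclidean_space" and \<sigma> :: "'n \<Rightarrow> 'k::finite"
  assumes \<sigma>: "bij \<sigma>"
  shows "(\<lambda>x. f (reindex \<sigma> x)) absolutely_integrable_on S \<and> integral S (\<lambda>x. f (reindex \<sigma> x)) = b \<longleftrightarrow>
    f absolutely_integrable_on (reindex \<sigma> ` S) \<and> integral (reindex \<sigma> ` S) f = b"
  by (simp add: absolutely_integrable_on_def integral_def integrable_on_def has_integral_reindex_iff[OF \<sigma>]
      has_integral_reindex_iff[OF \<sigma>, of "\<lambda>x. norm (f x)"])

lemma conj_transpose:
  assumes "bij \<sigma>"
  shows "inv \<sigma> \<circ> Transposition.transpose a b \<circ> \<sigma> = Transposition.transpose (inv \<sigma> a) (inv \<sigma> b)"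
  using assms by (auto simp: fun_eq_iff Transposition.transpose_def bij_is_inj bij_is_surj surj_f_inv_f)

text \<open>Renaming the permuted points turns each transposition in a factorization into a transposition, so
  the parity is unchanged even between different types.\<close>

lemma swapidseq_conj:
  assumes "bij \<sigma>" "swapidseq n p"
  shows "swapidseq n (inv \<sigma> \<circ> p \<circ> \<sigma>)"
  using assms(2)
proof induction
  case id
  have "inv \<sigma> \<circ> id \<circ> \<sigma> = id"
    using assms(1) by (simp add: fun_eq_iff bij_is_inj)
  then show ?case using swapidseq.id by metis
next
  case (comp_Suc n p a b)
  have "inv \<sigma> \<circ> (Transposition.transpose a b \<circ> p) \<circ> \<sigma> = (inv \<sigma> \<circ> Transposition.transpose a b \<circ> \<sigma>) \<circ> (inv \<sigma> \<circ> p \<circ> \<sigma>)"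
    using assms(1) by (auto simp: fun_eq_iff bij_is_surj surj_f_inv_f)
  moreover have "inv \<sigma> a \<noteq> inv \<sigma> b"
    using comp_Suc assms(1) by (metis bij_is_surj surj_f_inv_f)
  ultimately show ?case
    using swapidseq.comp_Suc[OF comp_Suc.IH] conj_transpose[OF assms(1)] by metis
qed

lemma sign_conj:
  fixes \<sigma> :: "'k::finite \<Rightarrow> 'n::finite"
  assumes "bij \<sigma>" "p permutes UNIV"
  shows "sign (inv \<sigma> \<circ> p \<circ> \<sigma>) = sign p"
proof -
  have "permutation p" using assms(2) by (metis finite_class.finite_UNIV permutation_permutes)
  then obtain n where n: "swapidseq n p" by (auto simp: permutation_def)
  then have "swapidseq n (inv \<sigma> \<circ> p \<circ> \<sigma>)" by (rule swapidseq_conj[OF assms(1)])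
  with n show ?thesis by (simp add: sign_def evenperm_unique[OF _ refl])
qed

lemma det_reindex:
  fixes A :: "real^'n::finite^'n" and \<sigma> :: "'k::finite \<Rightarrow> 'n"
  assumes \<sigma>: "bij \<sigma>"
  shows "det (\<chi> i j. A $ \<sigma> i $ \<sigma> j) = det A"
proof -
  have bij: "bij_betw (\<lambda>p. inv \<sigma> \<circ> p \<circ> \<sigma>) {p. p permutes (UNIV::'n set)} {p. p permutes (UNIV::'k set)}"
  proof (rule bij_betw_byWitness[where f'="\<lambda>p. \<sigma> \<circ> p \<circ> inv \<sigma>"])
    show "\<forall>p\<in>{p. p permutes UNIV}. \<sigma> \<circ> (inv \<sigma> \<circ> p \<circ> \<sigma>) \<circ> inv \<sigma> = p"
      "\<forall>p\<in>{p. p permutes UNIV}. inv \<sigma> \<circ> (\<sigma> \<circ> p \<circ> inv \<sigma>) \<circ> \<sigma> = p"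
      using \<sigma> by (auto simp: fun_eq_iff bij_is_inj bij_is_surj surj_f_inv_f)
    show "(\<lambda>p. inv \<sigma> \<circ> p \<circ> \<sigma>) ` {p. p permutes UNIV} \<subseteq> {p. p permutes UNIV}"
      "(\<lambda>p. \<sigma> \<circ> p \<circ> inv \<sigma>) ` {p. p permutes UNIV} \<subseteq> {p. p permutes UNIV}"
      using \<sigma> by (auto intro!: bij_imp_permutes bij_comp bij_imp_bij_inv intro: permutes_bij)
  qed
  have "det (\<chi> i j. A $ \<sigma> i $ \<sigma> j) =
      (\<Sum>p\<in>{p. p permutes (UNIV::'n set)}. of_int (sign (inv \<sigma> \<circ> p \<circ> \<sigma>)) *
        (\<Prod>i\<in>UNIV. A $ \<sigma> i $ \<sigma> ((inv \<sigma> \<circ> p \<circ> \<sigma>) i)))"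
    unfolding det_def sum.reindex_bij_betw[OF bij, symmetric] by simp
  also have "\<dots> = (\<Sum>p\<in>{p. p permutes (UNIV::'n set)}. of_int (sign p) * (\<Prod>i\<in>UNIV. A $ i $ p i))"
  proof (rule sum.cong[OF refl])
    fix p :: "'n \<Rightarrow> 'n" assume p: "p \<in> {p. p permutes UNIV}"
    have "(\<Prod>i\<in>UNIV. A $ \<sigma> i $ \<sigma> ((inv \<sigma> \<circ> p \<circ> \<sigma>) i)) = (\<Prod>i\<in>UNIV. A $ \<sigma> i $ p (\<sigma> i))"
      using \<sigma> by (simp add: bij_is_surj surj_f_inv_f)
    also have "\<dots> = (\<Prod>i\<in>UNIV. A $ i $ p i)"
      using prod.reindex_bij_betw[of \<sigma> UNIV UNIV "\<lambda>i. A $ i $ p i"] \<sigma> by simp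
    finally show "of_int (sign (inv \<sigma> \<circ> p \<circ> \<sigma>)) * (\<Prod>i\<in>UNIV. A $ \<sigma> i $ \<sigma> ((inv \<sigma> \<circ> p \<circ> \<sigma>) i)) =
        of_int (sign p) * (\<Prod>i\<in>UNIV. A $ i $ p i)"
      using sign_conj[OF \<sigma>] p by simp
  qed
  finally show ?thesis by (simp add: det_def)
qed

text \<open>Conjugation with a permutation of coordinates reduces the statement to a well-ordered index type;
  it changes neither integrals nor the determinant of the derivative.\<close>

lemma absolute_integral_change_of_variables:
  fixes f :: "real^'d::finite \<Rightarrow> real" and g :: "real^'d \<Rightarrow> real^'d"
  assumes S: "S \<in> sets lebesgue"
    and der: "\<And>x. x \<in> S \<Longrightarrow> (g has_derivative g' x) (at x within S)"
    and inj: "inj_on g S"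
  shows "(\<lambda>x. \<bar>det (matrix (g' x))\<bar> * f (g x)) absolutely_integrable_on S \<and>
      integral S (\<lambda>x. \<bar>det (matrix (g' x))\<bar> * f (g x)) = b \<longleftrightarrow>
    f absolutely_integrable_on (g ` S) \<and> integral (g ` S) f = b"
proof -
  obtain \<sigma> :: "'d ordered_index \<Rightarrow> 'd" where \<sigma>: "bij \<sigma>" using ex_bij_ordered_index by blast
  define P :: "real^'d ordered_index \<Rightarrow> real^'d" where "P = reindex (inv \<sigma>)"
  define R :: "real^'d \<Rightarrow> real^'d ordered_index" where "R = reindex \<sigma>"
  have PR [simp]: "P (R x) = x" "R (P y) = y" for x y using \<sigma> by (simp_all add: P_def R_def)
  have bl: "bounded_linear P" "bounded_linear R" by (simp_all add: P_def R_def bounded_linear_reindex)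
  define G where "G = R \<circ> g \<circ> P"
  define G' where "G' y = R \<circ> g' (P y) \<circ> P" for y
  define F where "F y = (vec (f (P y)) :: real^1)" for y
  have img: "P ` (R ` S) = S" "P ` (G ` (R ` S)) = g ` S"
    by (simp_all add: image_image G_def)
  have RS: "R ` S \<in> sets lebesgue"
  proof (rule differentiable_image_in_sets_lebesgue[OF S])
    show "DIM(real^'d) \<le> DIM(real^'d ordered_index)"
      using bij_betw_same_card[OF \<sigma>] by simp
    show "R differentiable_on S"
      using bl(2) by (simp add: bounded_linear_imp_differentiable differentiable_at_imp_differentiable_on)
  qed
  have derG: "(G has_derivative G' y) (at y within R ` S)" if "y \<in> R ` S" for y
  proof -
    have "P y \<in> S" using that by auto
    have P: "(P has_derivative P) (at y within R ` S)"
      by (rule bounded_linear_imp_has_derivative[OF bl(1)])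
    have "(g has_derivative g' (P y)) (at (P y) within P ` (R ` S))"
      using der[OF \<open>P y \<in> S\<close>] by (simp add: img)
    from has_derivative_in_compose[OF P this]
    have "((\<lambda>x. g (P x)) has_derivative (\<lambda>x. g' (P y) (P x))) (at y within R ` S)" .
    from bounded_linear.has_derivative[OF bl(2) this] show ?thesis
      by (simp add: G_def G'_def o_def)
  qed
  have injG: "inj_on G (R ` S)"
    by (auto simp: inj_on_def G_def dest!: arg_cong[of "R _" "R _" P] inj_onD[OF inj])
  have matrix: "det (matrix (G' y)) = det (matrix (g' (P y)))" for y
  proof -
    have ax: "P (axis j 1) = axis (\<sigma> j) 1" for j
      using \<sigma> by (auto simp: vec_eq_iff P_def axis_def bij_is_inj bij_is_surj surj_f_inv_f)
    have "matrix (G' y) = (\<chi> i j. matrix (g' (P y)) $ \<sigma> i $ \<sigma> j)"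
      by (simp add: matrix_def G'_def vec_eq_iff R_def ax)
    then show ?thesis using det_reindex[OF \<sigma>] by simp
  qed
  have vec1: "(\<lambda>x. vec (h x) :: real^1) absolutely_integrable_on T \<and> integral T (\<lambda>x. vec (h x) :: real^1) = vec b
      \<longleftrightarrow> h absolutely_integrable_on T \<and> integral T h = b" for h :: "'z::euclidean_space \<Rightarrow> real" and T b
    by (simp add: absolutely_integrable_on_1_iff integral_on_1_eq vec_eq_iff)
  have "(\<lambda>x. \<bar>det (matrix (g' x))\<bar> * f (g x)) absolutely_integrable_on S \<and>
      integral S (\<lambda>x. \<bar>det (matrix (g' x))\<bar> * f (g x)) = b \<longleftrightarrow>
      (\<lambda>y. \<bar>det (matrix (g' (P y)))\<bar> * f (g (P y))) absolutely_integrable_on R ` S \<and>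
      integral (R ` S) (\<lambda>y. \<bar>det (matrix (g' (P y)))\<bar> * f (g (P y))) = b"
    using absolute_integral_reindex_iff[OF bij_imp_bij_inv[OF \<sigma>], where f="\<lambda>x. \<bar>det (matrix (g' x))\<bar> * f (g x)" and S="R ` S" and b=b]
    by (simp add: P_def[symmetric] img)
  also have "\<dots> \<longleftrightarrow> (\<lambda>y. \<bar>det (matrix (G' y))\<bar> *\<^sub>R F (G y)) absolutely_integrable_on R ` S \<and>
      integral (R ` S) (\<lambda>y. \<bar>det (matrix (G' y))\<bar> *\<^sub>R F (G y)) = vec b"
  proof -
    have "(\<lambda>y. \<bar>det (matrix (G' y))\<bar> *\<^sub>R F (G y)) = (\<lambda>y. vec (\<bar>det (matrix (g' (P y)))\<bar> * f (g (P y))))"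
      by (simp add: matrix F_def G_def vec_eq_iff fun_eq_iff)
    then show ?thesis by (simp add: vec1)
  qed
  also have "\<dots> \<longleftrightarrow> F absolutely_integrable_on (G ` (R ` S)) \<and> integral (G ` (R ` S)) F = vec b"
    by (rule has_absolute_integral_change_of_variables[OF RS derG injG])
  also have "\<dots> \<longleftrightarrow> (\<lambda>y. f (P y)) absolutely_integrable_on (G ` (R ` S)) \<and>
      integral (G ` (R ` S)) (\<lambda>y. f (P y)) = b"
    unfolding F_def by (rule vec1)
  also have "\<dots> \<longleftrightarrow> f absolutely_integrable_on (g ` S) \<and> integral (g ` S) f = b"
    using absolute_integral_reindex_iff[OF bij_imp_bij_inv[OF \<sigma>], where f=f and S="G ` (R ` S)" and b=b]
    by (simp add: P_def[symmetric] img)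
  finally show ?thesis .
qed

section \<open>Determinants along a line of matrices\<close>

lemma det_pencil_polynomial:
  fixes A C :: "real^'n::finite^'n"
  obtains p :: "real poly" where "degree p \<le> CARD('n)" "\<And>r. poly p r = det (A + r *\<^sub>R C)"
proof
  define p where "p = (\<Sum>\<pi> | \<pi> permutes (UNIV::'n set). [:of_int (sign \<pi>):] * (\<Prod>i\<in>UNIV. [:A $ i $ \<pi> i, C $ i $ \<pi> i:]))"
  show "poly p r = det (A + r *\<^sub>R C)" for r
    by (simp add: p_def det_def poly_sum poly_prod)
  show "degree p \<le> CARD('n)"
    unfolding p_def
  proof (rule degree_sum_le)
    fix \<pi> :: "'n \<Rightarrow> 'n"
    have "degree (\<Prod>i\<in>UNIV. [:A $ i $ \<pi> i, C $ i $ \<pi> i:]) \<le> (\<Sum>i\<in>(UNIV::'n set). degree [:A $ i $ \<pi> i, C $ i $ \<pi> i:])"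
      using degree_prod_sum_le[of "UNIV :: 'n set" "\<lambda>i. [:A $ i $ \<pi> i, C $ i $ \<pi> i:]"] by (simp add: o_def)
    also have "\<dots> \<le> (\<Sum>i\<in>(UNIV::'n set). 1)"
      by (rule sum_mono) simp
    finally have "degree (\<Prod>i\<in>UNIV. [:A $ i $ \<pi> i, C $ i $ \<pi> i:]) \<le> CARD('n)"
      by simp
    moreover have "degree ([:of_int (sign \<pi>):] * (\<Prod>i\<in>UNIV. [:A $ i $ \<pi> i, C $ i $ \<pi> i:])) \<le>
        degree ([:of_int (sign \<pi>):] :: real poly) + degree (\<Prod>i\<in>UNIV. [:A $ i $ \<pi> i, C $ i $ \<pi> i:])"
      by (rule degree_mult_le)
    ultimately show "degree ([:of_int (sign \<pi>):] * (\<Prod>i\<in>UNIV. [:A $ i $ \<pi> i, C $ i $ \<pi> i:])) \<le> CARD('n)"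
      by simp
  qed simp
qed

text \<open>Jacobi's formula. By the product rule, the derivative is the sum over \<open>k\<close> of the determinants with
  row \<open>k\<close> replaced by the row of \<open>C\<close>. As \<open>C = E (A + r C)\<close>, that row is a combination of the rows
  of \<open>A + r C\<close>, of which only the \<open>k\<close>-th one, with coefficient \<open>E\<^sub>k\<^sub>k\<close>, contributes. Stating the
  hypothesis with \<open>E\<close> avoids inverse matrices.\<close>

lemma det_pencil_derivative:
  fixes A C E :: "real^'n::finite^'n"
  assumes E: "E ** (A + r *\<^sub>R C) = C"
  shows "((\<lambda>r. det (A + r *\<^sub>R C)) has_field_derivative det (A + r *\<^sub>R C) * trace E) (at r)"
proof -
  define M where "M = A + r *\<^sub>R C"
  define M' where "M' k = (\<chi> i. if i = k then \<Sum>j\<in>UNIV. E $ k $ j *s row j M else row i M)" for k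
  have rowC: "(\<Sum>j\<in>UNIV. E $ k $ j *s row j M) $ l = C $ k $ l" for k l
    unfolding E[symmetric, folded M_def] by (simp add: matrix_matrix_mult_def row_def M_def)
  have M'_nth: "M' k $ i $ l = (if i = k then C $ k $ l else M $ i $ l)" for k i l
    using rowC[of k l] by (simp add: M'_def row_def)
  have det_M': "det (M' k) = E $ k $ k * det M" for k
    unfolding M'_def using cramer_lemma_transpose[of k "E $ k" M] by simp
  have prod': "((\<lambda>r. \<Prod>i\<in>UNIV. A $ i $ \<pi> i + r * C $ i $ \<pi> i) has_field_derivative
      (\<Sum>k\<in>UNIV. \<Prod>i\<in>UNIV. M' k $ i $ \<pi> i)) (at r)" for \<pi> :: "'n \<Rightarrow> 'n"
  proof -
    have "((\<lambda>r. \<Prod>i\<in>UNIV. A $ i $ \<pi> i + r * C $ i $ \<pi> i) has_field_derivative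
        (\<Sum>k\<in>UNIV. C $ k $ \<pi> k * (\<Prod>i\<in>UNIV - {k}. A $ i $ \<pi> i + r * C $ i $ \<pi> i))) (at r)"
      by (rule has_field_derivative_prod) (auto intro!: derivative_eq_intros)
    moreover have "C $ k $ \<pi> k * (\<Prod>i\<in>UNIV - {k}. A $ i $ \<pi> i + r * C $ i $ \<pi> i) = (\<Prod>i\<in>UNIV. M' k $ i $ \<pi> i)" for k
    proof -
      have "(\<Prod>i\<in>UNIV. M' k $ i $ \<pi> i) = M' k $ k $ \<pi> k * (\<Prod>i\<in>UNIV - {k}. M' k $ i $ \<pi> i)"
        by (rule prod.remove) auto
      also have "(\<Prod>i\<in>UNIV - {k}. M' k $ i $ \<pi> i) = (\<Prod>i\<in>UNIV - {k}. A $ i $ \<pi> i + r * C $ i $ \<pi> i)"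
        by (rule prod.cong) (auto simp: M'_nth M_def)
      finally show ?thesis by (simp add: M'_nth)
    qed
    ultimately show ?thesis
      by simp
  qed
  have "((\<lambda>r. det (A + r *\<^sub>R C)) has_field_derivative
      (\<Sum>\<pi> | \<pi> permutes UNIV. of_int (sign \<pi>) * (\<Sum>k\<in>UNIV. \<Prod>i\<in>UNIV. M' k $ i $ \<pi> i))) (at r)"
    unfolding det_def by (auto intro!: DERIV_sum DERIV_cmult prod')
  also have "(\<Sum>\<pi> | \<pi> permutes (UNIV::'n set). of_int (sign \<pi>) * (\<Sum>k\<in>UNIV. \<Prod>i\<in>UNIV. M' k $ i $ \<pi> i)) =
      (\<Sum>k\<in>UNIV. det (M' k))"
    unfolding det_def sum_distrib_left by (rule sum.swap)
  also have "\<dots> = det M * trace E"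
    by (simp add: det_M' trace_def sum_distrib_left mult.commute)
  finally show ?thesis by (simp add: M_def)
qed

text \<open>The determinant does not vanish on the segment, so it has constant sign and its absolute value is
  also a polynomial of degree at most \<open>CARD('n)\<close>. A quadrature of one degree less integrates its
  derivative, given by Jacobi's formula, exactly.\<close>

lemma quadrature_abs_det_increment:
  fixes A C :: "real^'n::finite^'n" and E :: "real \<Rightarrow> real^'n^'n"
  assumes quad: "quadrature_exact Q \<omega> \<zeta> (CARD('n) - 1)"
    and inv: "\<And>r. 0 \<le> r \<Longrightarrow> r \<le> 1 \<Longrightarrow> det (A + r *\<^sub>R C) \<noteq> 0"
    and E: "\<And>r. 0 \<le> r \<Longrightarrow> r \<le> 1 \<Longrightarrow> E r ** (A + r *\<^sub>R C) = C"
  shows "\<bar>det (A + C)\<bar> - \<bar>det A\<bar> = (\<Sum>l\<in>Q. \<omega> l * (\<bar>det (A + \<zeta> l *\<^sub>R C)\<bar> * trace (E (\<zeta> l))))"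
proof -
  obtain p where deg: "degree p \<le> CARD('n)" and p: "\<And>r. poly p r = det (A + r *\<^sub>R C)"
    using det_pencil_polynomial[of A C] by blast
  \<comment> \<open>The constant sign of the determinant on the segment.\<close>
  define \<sigma> where "\<sigma> = sgn (det A)"
  have abs: "\<bar>poly p r\<bar> = \<sigma> * poly p r" if r: "0 \<le> r" "r \<le> 1" for r
  proof -
    have "0 < poly p 0 * poly p r"
    proof (rule ccontr)
      assume "\<not> 0 < poly p 0 * poly p r"
      then have "(poly p 0 \<le> 0 \<and> 0 \<le> poly p r) \<or> (0 \<le> poly p 0 \<and> poly p r \<le> 0)"
        by (simp add: not_less mult_le_0_iff) linarith
      then have "\<exists>s\<ge>0. s \<le> r \<and> poly p s = 0"
      proof
        assume "poly p 0 \<le> 0 \<and> 0 \<le> poly p r"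
        then show ?thesis using r by (intro IVT') (auto intro: continuous_intros)
      next
        assume "0 \<le> poly p 0 \<and> poly p r \<le> 0"
        then show ?thesis using r by (intro IVT2') (auto intro: continuous_intros)
      qed
      then show False using inv r p by force
    qed
    then show ?thesis
      using p[of 0] by (auto simp: \<sigma>_def sgn_if abs_if zero_less_mult_iff split: if_splits)
  qed
  have pderiv: "poly (pderiv p) r = det (A + r *\<^sub>R C) * trace (E r)" if "0 \<le> r" "r \<le> 1" for r
  proof (rule DERIV_unique[OF poly_DERIV])
    show "(poly p has_field_derivative det (A + r *\<^sub>R C) * trace (E r)) (at r)"
      using det_pencil_derivative[OF E[OF that]] by (simp add: p[abs_def])
  qed
  have "poly p 1 - poly p 0 = integral {0..1} (poly (pderiv p))"
    by (rule integral_unique[symmetric], rule fundamental_theorem_of_calculus)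
      (auto simp: has_real_derivative_iff_has_vector_derivative[symmetric] intro: DERIV_subset poly_DERIV)
  also have "\<dots> = (\<Sum>l\<in>Q. \<omega> l * poly (pderiv p) (\<zeta> l))"
    using quad deg by (simp add: quadrature_exact_def degree_pderiv)
  finally have "\<sigma> * poly p 1 - \<sigma> * poly p 0 = (\<Sum>l\<in>Q. \<omega> l * (\<sigma> * poly (pderiv p) (\<zeta> l)))"
    by (simp add: right_diff_distrib[symmetric] sum_distrib_left ac_simps)
  also have "\<dots> = (\<Sum>l\<in>Q. \<omega> l * (\<bar>det (A + \<zeta> l *\<^sub>R C)\<bar> * trace (E (\<zeta> l))))"
  proof (rule sum.cong[OF refl])
    fix l assume "l \<in> Q"
    then have "0 \<le> \<zeta> l" "\<zeta> l \<le> 1" using quad by (auto simp: quadrature_exact_def)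
    then show "\<omega> l * (\<sigma> * poly (pderiv p) (\<zeta> l)) = \<omega> l * (\<bar>det (A + \<zeta> l *\<^sub>R C)\<bar> * trace (E (\<zeta> l)))"
      using abs[of "\<zeta> l"] by (simp add: pderiv p)
  qed
  finally show ?thesis
    using abs[of 0] abs[of 1] by (simp add: p)
qed

section \<open>Functions that are continuously differentiable on a set\<close>

lemma C1_on_imp_differentiable_on: "C1_on S g \<Longrightarrow> g differentiable_on S"
  by (auto simp: C1_on_def differentiable_on_def differentiable_def)

lemma C1_on_imp_continuous_on: "C1_on S g \<Longrightarrow> continuous_on S g"
  by (simp add: C1_on_imp_differentiable_on differentiable_imp_continuous_on)

lemma C1_on_zero: "C1_on S (\<lambda>_. 0)"
  unfolding C1_on_def by (intro exI[of _ "\<lambda>_. 0"]) (auto simp: zero_blinfun.rep_eq)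

lemma C1_on_compose:
  assumes "C1_on S g" "C1_on (g ` S) f"
  shows "C1_on S (f \<circ> g)"
proof -
  obtain g' f' where g': "continuous_on S g'" "\<And>x. x \<in> S \<Longrightarrow> (g has_derivative blinfun_apply (g' x)) (at x within S)"
    and f': "continuous_on (g ` S) f'" "\<And>y. y \<in> g ` S \<Longrightarrow> (f has_derivative blinfun_apply (f' y)) (at y within g ` S)"
    using assms unfolding C1_on_def by blast
  have "continuous_on S (\<lambda>x. f' (g x) o\<^sub>L g' x)"
    using g'(1) continuous_on_compose2[OF f'(1) C1_on_imp_continuous_on[OF assms(1)]]
    by (intro bounded_bilinear.continuous_on[OF bounded_bilinear_blinfun_compose]) auto
  moreover have "(f \<circ> g has_derivative blinfun_apply (f' (g x) o\<^sub>L g' x)) (at x within S)" if "x \<in> S" for x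
    using diff_chain_within[OF g'(2)[OF that] f'(2)] that by (simp add: o_def blinfun_compose.rep_eq)
  ultimately show ?thesis unfolding C1_on_def by blast
qed

lemma C1_on_compact_bound:
  fixes g :: "'a::euclidean_space \<Rightarrow> real"
  assumes "compact S" "C1_on S g"
  shows "\<exists>B\<ge>0. \<forall>x\<in>S. \<exists>g'. (g has_derivative g') (at x within S) \<and> (\<forall>v. \<bar>g' v\<bar> \<le> B * norm v)"
proof -
  obtain g' where g': "continuous_on S g'" "\<And>x. x \<in> S \<Longrightarrow> (g has_derivative blinfun_apply (g' x)) (at x within S)"
    using assms(2) unfolding C1_on_def by blast
  have "bounded (g' ` S)"
    by (intro compact_imp_bounded compact_continuous_image g' assms)
  then obtain B where "B > 0" and B: "\<And>x. x \<in> S \<Longrightarrow> norm (g' x) \<le> B"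
    unfolding bounded_pos by blast
  have "\<bar>blinfun_apply (g' x) v\<bar> \<le> B * norm v" if "x \<in> S" for x v
  proof -
    have "\<bar>blinfun_apply (g' x) v\<bar> \<le> norm (g' x) * norm v"
      using norm_blinfun[of "g' x" v] by simp
    also have "\<dots> \<le> B * norm v" by (intro mult_right_mono B that) simp
    finally show ?thesis .
  qed
  with g'(2) \<open>B > 0\<close> show ?thesis by (meson less_imp_le)
qed

lemma diffeo_C1_inverse:
  assumes "diffeo_on S T" "C1_on S g"
  shows "C1_on (T ` S) (g \<circ> inv_into S T)"
  by (rule C1_on_compose) (use assms in \<open>auto simp: diffeo_on_def image_inv_into_cancel\<close>)

section \<open>Finite element functions on a mesh\<close>

lemma periods_closed:
  shows "0 \<in> periods bc" "s \<in> periods bc \<Longrightarrow> s' \<in> periods bc \<Longrightarrow> s + s' \<in> periods bc"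
proof -
  show "0 \<in> periods bc"
    by (cases bc) (auto simp: vec_eq_iff intro!: exI[of _ "\<lambda>_. 0"])
  assume "s \<in> periods bc" "s' \<in> periods bc"
  then show "s + s' \<in> periods bc"
  proof (cases bc)
    case (Periodic L)
    with \<open>s \<in> periods bc\<close> \<open>s' \<in> periods bc\<close> obtain k k' :: "_ \<Rightarrow> int"
      where "s = (\<chi> l. of_int (k l) * L $ l)" "s' = (\<chi> l. of_int (k' l) * L $ l)" by auto
    then have "s + s' = (\<chi> l. of_int (k l + k' l) * L $ l)"
      by (simp add: vec_eq_iff algebra_simps)
    with Periodic show ?thesis
      by (auto intro!: exI[of _ "\<lambda>l. k l + k' l"])
  qed auto
qed

text \<open>One position of the mesh. The time steps move between instances of this locale with the same
  connectivity.\<close>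

locale mesh =
  fixes bc :: "('d::finite, 'm::finite) boundary" and M :: "'d mesh_data" and a :: "'d nodes"
  assumes data: "mesh_data_ok bc M" and matching: "matching_mesh bc M a"
begin

abbreviation "copies \<equiv> cells M \<times> periods bc"
abbreviation "\<phi> \<equiv> psi bc M a"

lemma element_ok: "K \<in> cells M \<Longrightarrow> ref_element_ok (relem M K)"
  using data by (auto simp: mesh_data_ok_def)

lemma rcell_convex_compact:
  assumes "c \<in> copies"
  shows "convex (rcell M c)" "compact (rcell M c)" "interior (rcell M c) \<noteq> {}"
  using element_ok[of "fst c"] assms
  by (auto simp: ref_element_ok_def rcell_def polytope_imp_convex polytope_imp_compact)

lemma point_in_cell:
  obtains c z where "c \<in> copies" "z \<in> rcell M c" "x = cmap M a c z"
proof -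
  have "x \<in> (\<Union>c\<in>copies. cmap M a c ` rcell M c)"
    using matching unfolding matching_mesh_def by simp
  with that show ?thesis by blast
qed

lemma locally_finite_cells: "bounded B \<Longrightarrow> finite {c \<in> copies. cmap M a c ` rcell M c \<inter> B \<noteq> {}}"
  using matching unfolding matching_mesh_def by blast

lemma psi_cmap:
  assumes "j \<in> dofs M" "c \<in> copies" "z \<in> rcell M c"
  shows "\<phi> j (cmap M a c z) = loc_shape M j (fst c) z"
  using matching assms unfolding matching_mesh_def glues_def psi_def by blast

lemma psi_geo_cmap:
  assumes "j \<in> gnodes M" "c \<in> copies" "z \<in> rcell M c"
  shows "psi_geo bc M a j (cmap M a c z) = loc_shape_geo M j (fst c) z"
  using matching assms unfolding matching_mesh_def glues_def psi_geo_def by blast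

lemma continuous_psi:
  assumes "j \<in> dofs M" shows "continuous_on S (\<phi> j)"
proof (rule continuous_on_subset)
  show "continuous_on UNIV (\<phi> j)"
    using matching assms unfolding matching_mesh_def glues_def psi_def by blast
qed simp

lemma inj_jsh: "K \<in> cells M \<Longrightarrow> inj_on (jsh M K) {..<nsh (relem M K)}"
  and inj_jgeo: "K \<in> cells M \<Longrightarrow> inj_on (jgeo M K) {..<ngeo (relem M K)}"
  using data by (auto simp: mesh_data_ok_def)

lemma jsh_dofs: "K \<in> cells M \<Longrightarrow> k < nsh (relem M K) \<Longrightarrow> jsh M K k \<in> dofs M"
  and jgeo_gnodes: "K \<in> cells M \<Longrightarrow> k < ngeo (relem M K) \<Longrightarrow> jgeo M K k \<in> gnodes M"
  using data by (auto simp: mesh_data_ok_def)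

lemma loc_shape_jsh:
  assumes "K \<in> cells M" "k < nsh (relem M K)"
  shows "loc_shape M (jsh M K k) K = th (relem M K) k"
proof -
  have "{i. i < nsh (relem M K) \<and> jsh M K i = jsh M K k} = {k}"
    using inj_jsh[OF assms(1)] assms(2) by (auto simp: inj_on_def)
  then show ?thesis by (simp add: loc_shape_def fun_eq_iff)
qed

lemma loc_shape_geo_jgeo:
  assumes "K \<in> cells M" "k < ngeo (relem M K)"
  shows "loc_shape_geo M (jgeo M K k) K = thgeo (relem M K) k"
proof -
  have "{i. i < ngeo (relem M K) \<and> jgeo M K i = jgeo M K k} = {k}"
    using inj_jgeo[OF assms(1)] assms(2) by (auto simp: inj_on_def)
  then show ?thesis by (simp add: loc_shape_geo_def fun_eq_iff)
qed

lemma loc_shape_eq_0: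
  "j \<notin> jsh M K ` {..<nsh (relem M K)} \<Longrightarrow> loc_shape M j K z = 0"
  unfolding loc_shape_def by (rule sum.neutral) auto

lemma loc_shape_geo_eq_0:
  "j \<notin> jgeo M K ` {..<ngeo (relem M K)} \<Longrightarrow> loc_shape_geo M j K z = 0"
  unfolding loc_shape_geo_def by (rule sum.neutral) auto

lemma loc_shape_nonneg:
  assumes "c \<in> copies" "z \<in> rcell M c"
  shows "loc_shape M j (fst c) z \<ge> 0"
  unfolding loc_shape_def
  using element_ok[of "fst c"] assms by (intro sum_nonneg) (auto simp: ref_element_ok_def rcell_def)

lemma C1_loc_shape:
  assumes "c \<in> copies"
  shows "C1_on (rcell M c) (loc_shape M j (fst c))"
proof (cases "j \<in> jsh M (fst c) ` {..<nsh (relem M (fst c))}")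
  case True
  then show ?thesis
    using loc_shape_jsh element_ok[of "fst c"] assms by (auto simp: ref_element_ok_def rcell_def)
next
  case False
  then have "loc_shape M j (fst c) = (\<lambda>_. 0)" by (auto simp: loc_shape_eq_0)
  then show ?thesis by (simp add: C1_on_zero)
qed

lemma psi_nonneg: "j \<in> dofs M \<Longrightarrow> \<phi> j x \<ge> 0"
  by (rule point_in_cell[of x]) (simp add: psi_cmap loc_shape_nonneg)

lemma cmap_add: "cmap M a c z + s = cmap M a (fst c, snd c + s) z"
  by (simp add: cmap_def)

lemma psi_shift:
  assumes "j \<in> dofs M" "s \<in> periods bc"
  shows "\<phi> j (x + s) = \<phi> j x"
proof (rule point_in_cell[of x])
  fix c z assume c: "c \<in> copies" "z \<in> rcell M c" "x = cmap M a c z"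
  then have "(fst c, snd c + s) \<in> copies" "z \<in> rcell M (fst c, snd c + s)"
    using periods_closed(2) assms by (auto simp: rcell_def)
  then show ?thesis
    using psi_cmap[OF assms(1)] c by (simp add: cmap_add)
qed

lemma finite_local_dofs:
  assumes "bounded B"
  shows "finite {j \<in> dofs M. \<exists>x\<in>B. \<phi> j x \<noteq> 0}"
proof (rule finite_subset)
  let ?C = "{c \<in> copies. cmap M a c ` rcell M c \<inter> B \<noteq> {}}"
  show "finite (\<Union>c\<in>?C. jsh M (fst c) ` {..<nsh (relem M (fst c))})"
    using locally_finite_cells[OF assms] by blast
  show "{j \<in> dofs M. \<exists>x\<in>B. \<phi> j x \<noteq> 0} \<subseteq> (\<Union>c\<in>?C. jsh M (fst c) ` {..<nsh (relem M (fst c))})"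
  proof clarify
    fix j x assume j: "j \<in> dofs M" and x: "x \<in> B" "\<phi> j x \<noteq> 0"
    obtain c z where c: "c \<in> copies" "z \<in> rcell M c" "x = cmap M a c z" by (rule point_in_cell)
    then have "c \<in> ?C" using x by blast
    moreover have "j \<in> jsh M (fst c) ` {..<nsh (relem M (fst c))}"
      using x psi_cmap[OF j c(1,2)] c(3) loc_shape_eq_0 by metis
    ultimately show "j \<in> (\<Union>c\<in>?C. jsh M (fst c) ` {..<nsh (relem M (fst c))})" by blast
  qed
qed

lemma fe_fun_eq_sum:
  fixes V :: "nat \<Rightarrow> 'b::real_normed_vector"
  assumes "finite J" "J \<subseteq> dofs M" "\<And>j. j \<in> dofs M - J \<Longrightarrow> \<phi> j x *\<^sub>R V j = 0"
  shows "fe_fun bc M a V x = (\<Sum>j\<in>J. \<phi> j x *\<^sub>R V j)"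
proof -
  have "fe_fun bc M a V x = (\<Sum>\<^sub>\<infinity>j\<in>J. \<phi> j x *\<^sub>R V j)"
    unfolding fe_fun_def by (rule infsum_cong_neutral) (use assms in auto)
  then show ?thesis using assms(1) by simp
qed

lemma sum_loc_shape:
  fixes V :: "nat \<Rightarrow> 'b::real_normed_vector"
  assumes "K \<in> cells M" "finite J" "jsh M K ` {..<nsh (relem M K)} \<subseteq> J"
  shows "(\<Sum>j\<in>J. loc_shape M j K z *\<^sub>R V j) = (\<Sum>k<nsh (relem M K). th (relem M K) k z *\<^sub>R V (jsh M K k))"
proof -
  have "(\<Sum>j\<in>J. loc_shape M j K z *\<^sub>R V j) = (\<Sum>j\<in>jsh M K ` {..<nsh (relem M K)}. loc_shape M j K z *\<^sub>R V j)"
    by (rule sum.mono_neutral_right) (use assms loc_shape_eq_0 in auto)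
  also have "\<dots> = (\<Sum>k<nsh (relem M K). th (relem M K) k z *\<^sub>R V (jsh M K k))"
    by (subst sum.reindex[OF inj_jsh[OF assms(1)]]) (simp add: loc_shape_jsh[OF assms(1)])
  finally show ?thesis .
qed

lemma fe_fun_cmap:
  fixes V :: "nat \<Rightarrow> 'b::real_normed_vector"
  assumes "c \<in> copies" "z \<in> rcell M c"
  shows "fe_fun bc M a V (cmap M a c z) =
    (\<Sum>k<nsh (relem M (fst c)). th (relem M (fst c)) k z *\<^sub>R V (jsh M (fst c) k))"
proof -
  let ?J = "jsh M (fst c) ` {..<nsh (relem M (fst c))}"
  have "fe_fun bc M a V (cmap M a c z) = (\<Sum>j\<in>?J. \<phi> j (cmap M a c z) *\<^sub>R V j)"
    by (rule fe_fun_eq_sum) (use assms jsh_dofs psi_cmap loc_shape_eq_0 in auto)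
  also have "\<dots> = (\<Sum>j\<in>?J. loc_shape M j (fst c) z *\<^sub>R V j)"
    by (rule sum.cong) (use assms jsh_dofs psi_cmap in auto)
  also have "\<dots> = (\<Sum>k<nsh (relem M (fst c)). th (relem M (fst c)) k z *\<^sub>R V (jsh M (fst c) k))"
    by (rule sum_loc_shape) (use assms in auto)
  finally show ?thesis .
qed

lemma fe_fun_geo_cmap:
  fixes V :: "nat \<Rightarrow> 'b::real_normed_vector"
  assumes "c \<in> copies" "z \<in> rcell M c"
  shows "fe_fun_geo bc M a V (cmap M a c z) =
    (\<Sum>k<ngeo (relem M (fst c)). thgeo (relem M (fst c)) k z *\<^sub>R V (jgeo M (fst c) k))"
proof -
  let ?J = "jgeo M (fst c) ` {..<ngeo (relem M (fst c))}"
  have K: "fst c \<in> cells M" using assms by auto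
  have "fe_fun_geo bc M a V (cmap M a c z) = (\<Sum>\<^sub>\<infinity>j\<in>?J. psi_geo bc M a j (cmap M a c z) *\<^sub>R V j)"
    unfolding fe_fun_geo_def
    by (rule infsum_cong_neutral) (use assms jgeo_gnodes psi_geo_cmap loc_shape_geo_eq_0 in auto)
  also have "\<dots> = (\<Sum>j\<in>?J. loc_shape_geo M j (fst c) z *\<^sub>R V j)"
    by (simp, rule sum.cong) (use assms jgeo_gnodes psi_geo_cmap in auto)
  also have "\<dots> = (\<Sum>k<ngeo (relem M (fst c)). thgeo (relem M (fst c)) k z *\<^sub>R V (jgeo M (fst c) k))"
    by (subst sum.reindex[OF inj_jgeo[OF K]]) (simp add: loc_shape_geo_jgeo[OF K])
  finally show ?thesis .
qed

lemma fe_fun_const: "fe_fun bc M a (\<lambda>_. v) x = v"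
proof (rule point_in_cell[of x])
  fix c z assume c: "c \<in> copies" "z \<in> rcell M c" "x = cmap M a c z"
  then have "(\<Sum>k<nsh (relem M (fst c)). th (relem M (fst c)) k z) = 1"
    using element_ok[of "fst c"] by (auto simp: ref_element_ok_def rcell_def)
  then show ?thesis
    using fe_fun_cmap[OF c(1,2), of "\<lambda>_. v"] c(3) by (simp flip: scaleR_sum_left)
qed

lemma sum_psi:
  assumes "finite J" "J \<subseteq> dofs M" "\<And>j. j \<in> dofs M - J \<Longrightarrow> \<phi> j x = 0"
  shows "(\<Sum>j\<in>J. \<phi> j x) = 1"
  using fe_fun_const[of "1::real" x] fe_fun_eq_sum[OF assms(1,2), of x "\<lambda>_. 1::real"] assms(3) by simp

lemma diffeo_cell: "c \<in> copies \<Longrightarrow> diffeo_on (rcell M c) (gmap M a (fst c))"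
  using matching unfolding matching_mesh_def rcell_def by auto

lemma cmap_eq: "cmap M a c = (\<lambda>z. gmap M a (fst c) z + snd c)"
  by (simp add: cmap_def fun_eq_iff)

lemma continuous_cmap: "c \<in> copies \<Longrightarrow> continuous_on (rcell M c) (cmap M a c)"
  using diffeo_cell[of c] unfolding cmap_eq diffeo_on_def
  by (intro continuous_intros C1_on_imp_continuous_on) auto

lemma inj_cmap: "c \<in> copies \<Longrightarrow> inj_on (cmap M a c) (rcell M c)"
  using diffeo_cell[of c] by (auto simp: cmap_eq diffeo_on_def inj_on_def)

lemma compact_cell: "c \<in> copies \<Longrightarrow> compact (cmap M a c ` rcell M c)"
  by (intro compact_continuous_image continuous_cmap rcell_convex_compact)

lemma open_cell: "c \<in> copies \<Longrightarrow> open (cmap M a c ` interior (rcell M c))"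
  by (intro invariance_of_domain continuous_on_subset[OF continuous_cmap] inj_on_subset[OF inj_cmap])
    (auto simp: interior_subset)

text \<open>On a cell, a shape function is a reference function composed with the inverse of the geometric map,
  and so has bounded derivative relative to the cell. The finitely many reference cells where it does not
  vanish give one bound for all cells, since period translates share it.\<close>

lemma psi_lipschitz:
  assumes j: "j \<in> dofs M"
  obtains L where "\<And>x y. \<bar>\<phi> j y - \<phi> j x\<bar> \<le> L * norm (y - x)"
proof -
  let ?Kj = "{K \<in> cells M. j \<in> jsh M K ` {..<nsh (relem M K)}}"
  have fin: "finite ?Kj" using data by (auto simp: mesh_data_ok_def)
  define g where "g K = loc_shape M j K \<circ> inv_into (rdom (relem M K)) (gmap M a K)" for K
  have K0: "(K, 0) \<in> copies" if "K \<in> cells M" for K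
    using that periods_closed(1) by auto
  have C1: "C1_on (gmap M a K ` rdom (relem M K)) (g K)" if "K \<in> cells M" for K
    using diffeo_C1_inverse[OF diffeo_cell[OF K0[OF that]] C1_loc_shape[OF K0[OF that]], of j]
    by (simp add: g_def rcell_def)
  have cpt: "compact (gmap M a K ` rdom (relem M K))" if "K \<in> cells M" for K
    using compact_cell[OF K0[OF that]] by (simp add: cmap_eq rcell_def)
  define bound where "bound K B \<longleftrightarrow> 0 \<le> B \<and> (\<forall>x\<in>gmap M a K ` rdom (relem M K). \<exists>g'. (g K has_derivative g')
      (at x within gmap M a K ` rdom (relem M K)) \<and> (\<forall>v. \<bar>g' v\<bar> \<le> B * norm v))" for K B
  have "\<exists>B. bound K B" if "K \<in> cells M" for K
    using C1_on_compact_bound[OF cpt[OF that] C1[OF that]] by (auto simp: bound_def)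
  then obtain B where B': "\<And>K. K \<in> cells M \<Longrightarrow> bound K (B K)"
    by metis
  then have B: "\<And>K. K \<in> cells M \<Longrightarrow> B K \<ge> 0"
    "\<And>K x. K \<in> cells M \<Longrightarrow> x \<in> gmap M a K ` rdom (relem M K) \<Longrightarrow> \<exists>g'. (g K has_derivative g')
      (at x within gmap M a K ` rdom (relem M K)) \<and> (\<forall>v. \<bar>g' v\<bar> \<le> B K * norm v)"
    unfolding bound_def by blast+
  \<comment> \<open>The sum serves as an upper bound of finitely many constants that is also defined for the empty set.\<close>
  define L where "L = (\<Sum>K\<in>?Kj. B K)"
  have L: "L \<ge> 0" unfolding L_def by (rule sum_nonneg) (use B(1) in auto)
  have BL: "B K \<le> L" if "K \<in> ?Kj" for K
    unfolding L_def by (rule member_le_sum) (use that B(1) fin in auto)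
  have "\<bar>\<phi> j y - \<phi> j x\<bar> \<le> L * norm (y - x)" for x y
  proof (rule lipschitz_piecewise[where C="\<lambda>c. cmap M a c ` rcell M c" and I=copies])
    show "(\<Union>c\<in>copies. cmap M a c ` rcell M c) = UNIV"
      using matching unfolding matching_mesh_def by simp
    show "closed (cmap M a c ` rcell M c)" if "c \<in> copies" for c
      using compact_cell[OF that] by (rule compact_imp_closed)
    show "finite {c \<in> copies. cmap M a c ` rcell M c \<inter> ball x 1 \<noteq> {}}" for x
      by (rule locally_finite_cells) simp
    show "0 \<le> L" by (rule L)
    fix c x assume c: "c \<in> copies" and x: "x \<in> cmap M a c ` rcell M c"
    let ?S = "gmap M a (fst c) ` rdom (relem M (fst c))"
    have K: "fst c \<in> cells M" using c by auto
    have img: "(\<lambda>y. y - snd c) ` cmap M a c ` rcell M c = ?S"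
      by (simp add: cmap_eq rcell_def image_image)
    have x': "x - snd c \<in> ?S" using x img by blast
    have eq: "\<phi> j y = g (fst c) (y - snd c)" if y: "y \<in> cmap M a c ` rcell M c" for y
    proof -
      obtain z where z: "z \<in> rcell M c" "y = cmap M a c z" using y by blast
      then have "inv_into (rdom (relem M (fst c))) (gmap M a (fst c)) (y - snd c) = z"
        using diffeo_cell[OF c] by (simp add: cmap_eq diffeo_on_def rcell_def)
      then show ?thesis using psi_cmap[OF j c z(1)] z(2) by (simp add: g_def)
    qed
    show "\<exists>f'. (\<phi> j has_derivative f') (at x within cmap M a c ` rcell M c) \<and> (\<forall>v. \<bar>f' v\<bar> \<le> L * norm v)"
    proof (cases "j \<in> jsh M (fst c) ` {..<nsh (relem M (fst c))}")
      case True
      obtain g' where g': "(g (fst c) has_derivative g') (at (x - snd c) within ?S)"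
        "\<And>v. \<bar>g' v\<bar> \<le> B (fst c) * norm v"
        using B(2)[OF K x'] by blast
      have "((\<lambda>y. y - snd c) has_derivative (\<lambda>v. v)) (at x within cmap M a c ` rcell M c)"
        by (auto intro!: derivative_eq_intros)
      then have g'': "((\<lambda>y. g (fst c) (y - snd c)) has_derivative (\<lambda>v. g' v)) (at x within cmap M a c ` rcell M c)"
        by (rule has_derivative_in_compose) (simp add: img g')
      have "(\<phi> j has_derivative g') (at x within cmap M a c ` rcell M c)"
        by (rule has_derivative_transform[OF x _ g'']) (rule eq)
      moreover have "\<bar>g' v\<bar> \<le> L * norm v" for v
      proof (rule order_trans[OF g'(2)])
        show "B (fst c) * norm v \<le> L * norm v"
          using BL[of "fst c"] True K by (intro mult_right_mono) auto
      qed
      ultimately show ?thesis by blast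
    next
      case False
      then have "\<phi> j y = 0" if "y \<in> cmap M a c ` rcell M c" for y
        using psi_cmap[OF j c] that by (auto simp: loc_shape_eq_0)
      then have "(\<phi> j has_derivative (\<lambda>_. 0)) (at x within cmap M a c ` rcell M c)"
        by (intro has_derivative_transform[OF x _ has_derivative_const])
      then show ?thesis using L by (intro exI[of _ "\<lambda>_. 0"]) simp
    qed
  qed
  with that show ?thesis by blast
qed

end

section \<open>Gradients of the shape functions\<close>

context mesh
begin

text \<open>In the interior of a cell, derivatives relative to the cell are full derivatives, as the image of the
  interior is open by invariance of domain. The derivatives of the geometric map and of its inverse are
  then mutually inverse by the chain rule.\<close>

lemma cell_inverse:
  assumes c: "c \<in> copies" and z: "z \<in> interior (rcell M c)"
  obtains T' G G' where "(cmap M a c has_derivative T') (at z)" "(G has_derivative G') (at (cmap M a c z))"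
    "\<And>y. y \<in> rcell M c \<Longrightarrow> G (cmap M a c y) = y" "G' \<circ> T' = id" "T' \<circ> G' = id"
proof -
  let ?S = "rcell M c" and ?T = "gmap M a (fst c)"
  have diffeo: "inj_on ?T ?S" "C1_on ?S ?T" "C1_on (?T ` ?S) (inv_into ?S ?T)"
    using diffeo_cell[OF c] by (auto simp: diffeo_on_def)
  have zS: "z \<in> ?S" using z interior_subset by blast
  obtain T' where "(?T has_derivative T') (at z within ?S)"
    using diffeo(2) zS unfolding C1_on_def by blast
  then have T: "(?T has_derivative T') (at z)"
    using at_within_interior[OF z] by simp
  then have cm: "(cmap M a c has_derivative T') (at z)"
    unfolding cmap_eq by (auto intro!: derivative_eq_intros)
  define G where "G y = inv_into ?S ?T (y - snd c)" for y
  have G_inv: "G (cmap M a c y) = y" if "y \<in> ?S" for y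
    using inv_into_f_f[OF diffeo(1) that] by (simp add: G_def cmap_eq)
  have "open (?T ` interior ?S)"
    by (intro invariance_of_domain C1_on_imp_continuous_on[THEN continuous_on_subset, OF diffeo(2)]
      inj_on_subset[OF diffeo(1)]) (auto simp: interior_subset)
  moreover have "?T ` interior ?S \<subseteq> ?T ` ?S" using interior_subset by (intro image_mono)
  ultimately have Tz: "?T z \<in> interior (?T ` ?S)"
    using z by (meson imageI interiorI)
  obtain G' where "(inv_into ?S ?T has_derivative G') (at (?T z) within ?T ` ?S)"
    using diffeo(3) zS unfolding C1_on_def by blast
  then have "(inv_into ?S ?T has_derivative G') (at (cmap M a c z - snd c))"
    using at_within_interior[OF Tz] by (simp add: cmap_eq)
  moreover have "((\<lambda>y. y - snd c) has_derivative (\<lambda>v. v)) (at (cmap M a c z))"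
    by (auto intro!: derivative_eq_intros)
  ultimately have G: "(G has_derivative G') (at (cmap M a c z))"
    unfolding G_def[abs_def] by (rule has_derivative_compose[rotated])
  have zint: "open (interior ?S)" by simp
  have "((\<lambda>y. y) has_derivative G' \<circ> T') (at z)"
    by (rule has_derivative_transform_within_open[OF diff_chain_at[OF cm G] zint z])
      (use G_inv interior_subset in auto)
  then have id1: "G' \<circ> T' = id"
    using has_derivative_unique[OF _ has_derivative_ident] by (auto simp: id_def)
  have "(cmap M a c has_derivative T') (at (G (cmap M a c z)))"
    using cm G_inv[OF zS] by simp
  from diff_chain_at[OF G this]
  have "((\<lambda>y. y) has_derivative T' \<circ> G') (at (cmap M a c z))"
    by (rule has_derivative_transform_within_open[OF _ open_cell[OF c]])
      (use z in \<open>auto simp: G_inv[OF interior_subset[THEN subsetD]]\<close>)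
  then have id2: "T' \<circ> G' = id"
    using has_derivative_unique[OF _ has_derivative_ident] by (auto simp: id_def)
  show ?thesis by (rule that[OF cm G G_inv id1 id2])
qed

lemma derivative_via_cell:
  assumes c: "c \<in> copies" and z: "z \<in> interior (rcell M c)"
    and G: "(G has_derivative G') (at (cmap M a c z))" "\<And>y. y \<in> rcell M c \<Longrightarrow> G (cmap M a c y) = y"
    and \<theta>: "(\<theta> has_derivative \<theta>') (at z)" and f: "\<And>y. y \<in> rcell M c \<Longrightarrow> f (cmap M a c y) = \<theta> y"
  shows "(f has_derivative \<theta>' \<circ> G') (at (cmap M a c z))"
proof (rule has_derivative_transform_within_open[OF _ open_cell[OF c]])
  have "(\<theta> has_derivative \<theta>') (at (G (cmap M a c z)))"
    using \<theta> z G(2) interior_subset by (metis subsetD)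
  from diff_chain_at[OF G(1) this] show "(\<theta> \<circ> G has_derivative \<theta>' \<circ> G') (at (cmap M a c z))" .
  show "(\<theta> \<circ> G) x = f x" if "x \<in> cmap M a c ` interior (rcell M c)" for x
    using that f G(2) interior_subset by fastforce
qed (use z in auto)

text \<open>The points where all shape functions are known to be differentiable. Integrals and gradients are
  computed here, as the complement is a null set.\<close>

definition "cell_interiors = (\<Union>c\<in>copies. cmap M a c ` interior (rcell M c))"

lemma psi_differentiable:
  assumes j: "j \<in> dofs M" and x: "x \<in> cell_interiors"
  shows "\<phi> j differentiable at x"
proof -
  obtain c z where c: "c \<in> copies" and z: "z \<in> interior (rcell M c)" and x: "x = cmap M a c z"
    using x by (auto simp: cell_interiors_def)
  obtain T' G G' where G: "(G has_derivative G') (at (cmap M a c z))" "\<And>y. y \<in> rcell M c \<Longrightarrow> G (cmap M a c y) = y"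
    by (rule cell_inverse[OF c z]) blast
  have "z \<in> rcell M c" using z interior_subset by blast
  then obtain \<theta>' where "(loc_shape M j (fst c) has_derivative \<theta>') (at z within rcell M c)"
    using C1_loc_shape[OF c, of j] unfolding C1_on_def by blast
  then have "(loc_shape M j (fst c) has_derivative \<theta>') (at z)"
    using at_within_interior[OF z] by simp
  from derivative_via_cell[OF c z G this] psi_cmap[OF j c] show ?thesis
    unfolding x differentiable_def by blast
qed

lemma psi_has_derivative:
  "j \<in> dofs M \<Longrightarrow> x \<in> cell_interiors \<Longrightarrow> (\<phi> j has_derivative frechet_derivative (\<phi> j) (at x)) (at x)"
  using psi_differentiable frechet_derivative_works by blast

lemma countable_copies: "countable copies"
proof (rule countable_subset)
  have "finite {c \<in> copies. cmap M a c ` rcell M c \<inter> cball 0 (real n) \<noteq> {}}" for n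
    by (rule locally_finite_cells) simp
  then show "countable (\<Union>n. {c \<in> copies. cmap M a c ` rcell M c \<inter> cball 0 (real n) \<noteq> {}})"
    by (rule countable_UN[OF countableI_type countable_finite])
  show "copies \<subseteq> (\<Union>n. {c \<in> copies. cmap M a c ` rcell M c \<inter> cball 0 (real n) \<noteq> {}})"
  proof
    fix c assume c: "c \<in> copies"
    then obtain z where z: "z \<in> rcell M c" using rcell_convex_compact(3) interior_subset by blast
    obtain n where "norm (cmap M a c z) \<le> real n" using real_arch_simple by blast
    then have "cmap M a c z \<in> cmap M a c ` rcell M c \<inter> cball 0 (real n)" using z by simp
    with c show "c \<in> (\<Union>n. {c \<in> copies. cmap M a c ` rcell M c \<inter> cball 0 (real n) \<noteq> {}})" by blast
  qed
qed

text \<open>Frontiers of the convex reference cells are null sets, differentiable maps preserve this, and there are countably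
  many cells.\<close>

lemma negligible_cell_boundaries: "negligible (- cell_interiors)"
proof (rule negligible_subset)
  show "negligible (\<Union>c\<in>copies. cmap M a c ` (rcell M c - interior (rcell M c)))"
  proof (rule negligible_countable_Union)
    show "countable ((\<lambda>c. cmap M a c ` (rcell M c - interior (rcell M c))) ` copies)"
      using countable_copies by (rule countable_image)
    show "negligible X" if X: "X \<in> (\<lambda>c. cmap M a c ` (rcell M c - interior (rcell M c))) ` copies" for X
    proof -
      obtain c where c: "c \<in> copies" and X: "X = cmap M a c ` (rcell M c - interior (rcell M c))"
        using X by blast
      have "negligible (frontier (rcell M c))"
        by (rule negligible_convex_frontier[OF rcell_convex_compact(1)[OF c]])
      moreover have "rcell M c - interior (rcell M c) = frontier (rcell M c)"
        using rcell_convex_compact(2)[OF c] by (simp add: frontier_def compact_imp_closed)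
      moreover have "cmap M a c differentiable_on rcell M c - interior (rcell M c)"
      proof (rule differentiable_on_subset)
        have "gmap M a (fst c) differentiable_on rcell M c"
          using diffeo_cell[OF c] by (simp add: diffeo_on_def C1_on_imp_differentiable_on)
        then show "cmap M a c differentiable_on rcell M c"
          unfolding cmap_eq by (intro differentiable_on_add) (auto simp: differentiable_on_const)
      qed blast
      ultimately show ?thesis
        unfolding X by (intro negligible_differentiable_image_negligible) auto
    qed
  qed
  show "- cell_interiors \<subseteq> (\<Union>c\<in>copies. cmap M a c ` (rcell M c - interior (rcell M c)))"
  proof
    fix x assume x: "x \<in> - cell_interiors"
    obtain c z where c: "c \<in> copies" "z \<in> rcell M c" "x = cmap M a c z" by (rule point_in_cell)
    with x have "z \<notin> interior (rcell M c)" by (auto simp: cell_interiors_def)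
    with c show "x \<in> (\<Union>c\<in>copies. cmap M a c ` (rcell M c - interior (rcell M c)))" by blast
  qed
qed

lemma psi_cover:
  assumes j: "j \<in> dofs M" and x: "\<phi> j x \<noteq> 0"
  obtains c z where "c \<in> copies" "z \<in> rcell M c" "x = cmap M a c z" "j \<in> jsh M (fst c) ` {..<nsh (relem M (fst c))}"
proof -
  obtain c z where c: "c \<in> copies" "z \<in> rcell M c" "x = cmap M a c z" by (rule point_in_cell)
  then have "loc_shape M j (fst c) z \<noteq> 0" using x psi_cmap[OF j c(1,2)] by simp
  then have "j \<in> jsh M (fst c) ` {..<nsh (relem M (fst c))}" using loc_shape_eq_0 by metis
  from that[OF c this] show ?thesis .
qed

lemma finite_cells_of_dof: "finite {K \<in> cells M. j \<in> jsh M K ` {..<nsh (relem M K)}}"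
  using data by (auto simp: mesh_data_ok_def)

lemma supp_subset_cells:
  assumes bc: "bc = Cauchy u" and j: "j \<in> dofs M"
  shows "supp bc M a j \<subseteq> (\<Union>K\<in>{K \<in> cells M. j \<in> jsh M K ` {..<nsh (relem M K)}}. cmap M a (K, 0) ` rcell M (K, 0))"
    (is "_ \<subseteq> ?U")
  unfolding supp_def
proof (rule closure_minimal)
  show "closed ?U"
  proof (intro closed_UN finite_cells_of_dof ballI)
    fix K assume "K \<in> {K \<in> cells M. j \<in> jsh M K ` {..<nsh (relem M K)}}"
    then have "(K, 0) \<in> copies" using periods_closed(1) by auto
    then show "closed (cmap M a (K, 0) ` rcell M (K, 0))" by (intro compact_imp_closed compact_cell)
  qed
  show "{x. \<phi> j x \<noteq> 0} \<subseteq> ?U"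
  proof clarify
    fix x assume "\<phi> j x \<noteq> 0"
    then obtain c z where c: "c \<in> copies" "z \<in> rcell M c" "x = cmap M a c z" "j \<in> jsh M (fst c) ` {..<nsh (relem M (fst c))}"
      by (rule psi_cover[OF j])
    moreover have "c = (fst c, 0)" using c(1) bc by (auto simp: prod_eq_iff)
    ultimately show "x \<in> ?U" by (intro UN_I[of "fst c"]) auto
  qed
qed

lemma bounded_supp:
  assumes "bc = Cauchy u" "j \<in> dofs M"
  shows "bounded (supp bc M a j)"
proof (rule bounded_subset[OF _ supp_subset_cells[OF assms]], rule bounded_UN[OF finite_cells_of_dof], rule ballI)
  fix K assume "K \<in> {K \<in> cells M. j \<in> jsh M K ` {..<nsh (relem M K)}}"
  then have "(K, 0) \<in> copies" using periods_closed(1) by auto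
  then show "bounded (cmap M a (K, 0) ` rcell M (K, 0))" by (intro compact_imp_bounded compact_cell)
qed

lemma psi_in_supp: "\<phi> j x \<noteq> 0 \<Longrightarrow> x \<in> supp bc M a j"
  unfolding supp_def by (rule closure_subset[THEN subsetD]) simp

lemma domain_lebesgue: "domain bc \<in> sets lebesgue"
  by (cases bc) auto

lemma axis_period:
  assumes "bc = Periodic L" shows "L $ l *\<^sub>R axis l 1 \<in> periods bc"
proof -
  have "L $ l *\<^sub>R axis l 1 = (\<chi> k. of_int (if k = l then 1 else 0) * L $ k)"
    by (simp add: vec_eq_iff axis_def)
  then show ?thesis unfolding assms periods.simps by (intro CollectI exI)
qed

lemma periodic_positive: "bc = Periodic L \<Longrightarrow> L $ l > 0"
  using data by (auto simp: mesh_data_ok_def)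

lemma grad_psi_component:
  assumes j: "j \<in> dofs M"
  shows "(\<lambda>x. grad (\<phi> j) x $ l) absolutely_integrable_on domain bc"
    and "integral (domain bc) (\<lambda>x. grad (\<phi> j) x $ l) = 0"
proof -
  obtain C where lip: "\<And>x y. \<bar>\<phi> j y - \<phi> j x\<bar> \<le> C * norm (y - x)"
    using psi_lipschitz[OF j] by blast
  have comp: "grad (\<phi> j) x $ l = frechet_derivative (\<phi> j) (at x) (axis l 1)" for x
    by (simp add: grad_def)
  have "(\<lambda>x. grad (\<phi> j) x $ l) absolutely_integrable_on domain bc \<and>
      integral (domain bc) (\<lambda>x. grad (\<phi> j) x $ l) = 0"
  proof (cases bc)
    case (Cauchy u)
    then have dom: "domain bc = UNIV" by simp
    have zero: "\<phi> j x = 0" if "x \<notin> supp bc M a j" for x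
      using that psi_in_supp by blast
    show ?thesis
      unfolding comp dom
      by (intro conjI integral_derivative_compact_support[OF lip negligible_cell_boundaries _ bounded_supp[OF Cauchy j]])
        (simp_all add: psi_differentiable[OF j] zero)
  next
    case (Periodic L)
    then have dom: "domain bc = cbox 0 L" by simp
    have shift: "integral (cbox 0 L) (\<lambda>x. \<phi> j (x + h *\<^sub>R axis l 1)) = integral (cbox 0 L) (\<phi> j)"
      if "0 < h" "h < L $ l" for h
      by (rule integral_shift_periodic_axis)
        (use that continuous_psi[OF j] psi_shift[OF j axis_period[OF Periodic]] periodic_positive[OF Periodic] in auto)
    show ?thesis
      unfolding comp dom
      by (intro conjI integral_directional_derivative_eq_0[OF lip negligible_cell_boundaries _ periodic_positive[OF Periodic, of l]])
        (simp_all add: psi_differentiable[OF j] shift)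
  qed
  then show "(\<lambda>x. grad (\<phi> j) x $ l) absolutely_integrable_on domain bc"
    "integral (domain bc) (\<lambda>x. grad (\<phi> j) x $ l) = 0" by blast+
qed

lemma grad_psi_integral:
  assumes j: "j \<in> dofs M"
  shows "grad (\<phi> j) absolutely_integrable_on domain bc" "integral (domain bc) (grad (\<phi> j)) = 0"
proof -
  show int: "grad (\<phi> j) absolutely_integrable_on domain bc"
    using grad_psi_component(1)[OF j]
    by (subst absolutely_integrable_componentwise_iff) (auto simp: Basis_vec_def inner_axis)
  have "integral (domain bc) (grad (\<phi> j)) $ l = 0" for l
  proof -
    have "integral (domain bc) (grad (\<phi> j)) \<bullet> axis l 1 = integral (domain bc) (\<lambda>x. grad (\<phi> j) x \<bullet> axis l 1)"
      using int by (intro integral_component_eq[symmetric]) (simp add: absolutely_integrable_on_def)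
    then show ?thesis using grad_psi_component(2)[OF j, of l] by (simp add: inner_axis)
  qed
  then show "integral (domain bc) (grad (\<phi> j)) = 0" by (simp add: vec_eq_iff)
qed

lemma psi_le_1:
  assumes "i \<in> dofs M" shows "\<phi> i x \<le> 1"
proof -
  let ?J = "insert i {j \<in> dofs M. \<exists>y\<in>{x}. \<phi> j y \<noteq> 0}"
  have "\<phi> i x \<le> (\<Sum>j\<in>?J. \<phi> j x)"
    by (rule member_le_sum) (use assms finite_local_dofs[of "{x}"] psi_nonneg in auto)
  also have "\<dots> = 1"
    by (rule sum_psi) (use assms finite_local_dofs[of "{x}"] in auto)
  finally show ?thesis .
qed

lemma psi_grad_integrable:
  assumes i: "i \<in> dofs M" and j: "j \<in> dofs M"
  shows "(\<lambda>x. \<phi> i x *\<^sub>R grad (\<phi> j) x) absolutely_integrable_on domain bc"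
proof (rule absolutely_integrable_bounded_measurable_product[where h="(*\<^sub>R)" and f="\<phi> i",
      OF _ _ domain_lebesgue _ grad_psi_integral(1)[OF j]])
  show "bilinear ( (*\<^sub>R) :: real \<Rightarrow> real^'d \<Rightarrow> real^'d)"
    by (simp add: bilinear_conv_bounded_bilinear bounded_bilinear_scaleR)
  show "\<phi> i \<in> borel_measurable (lebesgue_on (domain bc))"
    by (rule continuous_imp_measurable_on_sets_lebesgue[OF continuous_psi[OF i] domain_lebesgue])
  show "bounded (\<phi> i ` domain bc)"
    unfolding bounded_iff using psi_nonneg[OF i] psi_le_1[OF i] by (intro exI[of _ 1]) auto
qed

lemma cvec_eq_integral:
  assumes "i \<in> dofs M" "j \<in> dofs M"
  shows "cvec bc M a i j = integral (domain bc) (\<lambda>x. \<phi> i x *\<^sub>R grad (\<phi> j) x)"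
  unfolding cvec_def by (rule set_lebesgue_integral_eq_integral[OF psi_grad_integrable[OF assms]])

text \<open>Two shape functions interact if they are nonzero at a common point. This condition, in contrast to
  supports that meet in a set of positive measure, can be read off from the reference cells.\<close>

definition "overlap i j \<longleftrightarrow> (\<exists>x. \<phi> i x * \<phi> j x \<noteq> 0)"

lemma overlap_sym: "overlap i j \<longleftrightarrow> overlap j i"
  by (simp add: overlap_def mult.commute)

lemma open_psi_nonzero: "i \<in> dofs M \<Longrightarrow> open {x. \<phi> i x \<noteq> 0}"
  using open_vimage[OF _ continuous_psi, of "- {0::real}" i] by (simp add: vimage_def open_Compl)

lemma grad_eq_0:
  assumes "open S" "x \<in> S" "\<And>y. y \<in> S \<Longrightarrow> f y = 0"
  shows "grad f x = 0"
proof -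
  have "(f has_derivative (\<lambda>_. 0)) (at x)"
    by (rule has_derivative_transform_within_open[OF has_derivative_const[of 0] assms(1,2)])
      (use assms(3) in auto)
  then have "frechet_derivative f (at x) = (\<lambda>_. 0)" by (rule frechet_derivative_at[symmetric])
  then show ?thesis by (simp add: grad_def vec_eq_iff)
qed

text \<open>Where \<open>\<phi> i\<close> is nonzero it is so in a neighborhood, on which \<open>\<phi> j\<close> vanishes identically.\<close>

lemma psi_grad_eq_0:
  assumes i: "i \<in> dofs M" and "\<not> overlap i j"
  shows "\<phi> i x = 0 \<or> grad (\<phi> j) x = 0"
proof (cases "\<phi> i x = 0")
  case False
  with assms(2) have "grad (\<phi> j) x = 0"
    by (intro grad_eq_0[OF open_psi_nonzero[OF i]]) (auto simp: overlap_def)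
  then show ?thesis ..
qed simp

text \<open>Where \<open>grad (\<phi> j)\<close> is nonzero, all shape functions outside \<open>J\<close> vanish, so those in \<open>J\<close> sum
  to \<open>1\<close>. Hence the column sum is the integral of \<open>grad (\<phi> j)\<close>.\<close>

lemma cvec_column_sum:
  assumes j: "j \<in> dofs M" and J: "finite J" "J \<subseteq> dofs M" "{i \<in> dofs M. overlap i j} \<subseteq> J"
  shows "(\<Sum>i\<in>J. cvec bc M a i j) = 0"
proof -
  have "(\<Sum>i\<in>J. cvec bc M a i j) = (\<Sum>i\<in>J. integral (domain bc) (\<lambda>x. \<phi> i x *\<^sub>R grad (\<phi> j) x))"
    by (rule sum.cong) (use J j cvec_eq_integral in auto)
  also have "\<dots> = integral (domain bc) (\<lambda>x. \<Sum>i\<in>J. \<phi> i x *\<^sub>R grad (\<phi> j) x)"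
    by (rule integral_sum[symmetric])
      (use J j psi_grad_integrable in \<open>auto simp: absolutely_integrable_on_def\<close>)
  also have "(\<lambda>x. \<Sum>i\<in>J. \<phi> i x *\<^sub>R grad (\<phi> j) x) = grad (\<phi> j)"
  proof
    fix x
    show "(\<Sum>i\<in>J. \<phi> i x *\<^sub>R grad (\<phi> j) x) = grad (\<phi> j) x"
    proof (cases "grad (\<phi> j) x = 0")
      case False
      then have "\<phi> i x = 0" if "i \<in> dofs M - J" for i
        using that J(3) psi_grad_eq_0[of i j x] by blast
      then show ?thesis using sum_psi[OF J(1,2)] by (simp flip: scaleR_sum_left)
    qed simp
  qed
  also have "integral (domain bc) (grad (\<phi> j)) = 0" by (rule grad_psi_integral(2)[OF j])
  finally show ?thesis .
qed

lemma divg_fe_fun: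
  assumes x: "x \<in> cell_interiors" and J: "finite J" "J \<subseteq> dofs M" "{j \<in> dofs M. \<exists>y\<in>ball x 1. \<phi> j y \<noteq> 0} \<subseteq> J"
  shows "divg (fe_fun bc M a V) x = (\<Sum>j\<in>J. V j \<bullet> grad (\<phi> j) x)"
proof -
  have der: "((\<lambda>y. \<Sum>j\<in>J. \<phi> j y *\<^sub>R V j) has_derivative
      (\<lambda>v. \<Sum>j\<in>J. frechet_derivative (\<phi> j) (at x) v *\<^sub>R V j)) (at x)"
    by (intro has_derivative_sum has_derivative_scaleR_left psi_has_derivative x) (use J in auto)
  have eq: "(\<Sum>j\<in>J. \<phi> j y *\<^sub>R V j) = fe_fun bc M a V y" if "y \<in> ball x 1" for y
  proof (rule fe_fun_eq_sum[symmetric, OF J(1,2)])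
    show "\<phi> j y *\<^sub>R V j = 0" if "j \<in> dofs M - J" for j
      using that J(3) \<open>y \<in> ball x 1\<close> by fastforce
  qed
  have "(fe_fun bc M a V has_derivative
      (\<lambda>v. \<Sum>j\<in>J. frechet_derivative (\<phi> j) (at x) v *\<^sub>R V j)) (at x)"
    by (rule has_derivative_transform_within_open[OF der open_ball _ eq]) auto
  then have "frechet_derivative (fe_fun bc M a V) (at x) = (\<lambda>v. \<Sum>j\<in>J. frechet_derivative (\<phi> j) (at x) v *\<^sub>R V j)"
    by (rule frechet_derivative_at[symmetric])
  then have "divg (fe_fun bc M a V) x = (\<Sum>l\<in>UNIV. \<Sum>j\<in>J. frechet_derivative (\<phi> j) (at x) (axis l 1) * V j $ l)"
    by (simp add: divg_def)
  also have "\<dots> = (\<Sum>j\<in>J. \<Sum>l\<in>UNIV. frechet_derivative (\<phi> j) (at x) (axis l 1) * V j $ l)"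
    by (rule sum.swap)
  also have "\<dots> = (\<Sum>j\<in>J. V j \<bullet> grad (\<phi> j) x)"
    by (simp add: inner_vec_def grad_def mult.commute)
  finally show ?thesis .
qed

text \<open>Near a point in the interior of a cell, the velocity is a finite combination of shape functions, and its
  divergence is \<open>\<Sum>\<^sub>j V\<^sub>j \<bullet> \<nabla>\<psi>\<^sub>j\<close>. After multiplication with \<open>\<phi> i\<close> only indices interacting with \<open>i\<close>
  remain.\<close>

lemma divergence_integral:
  assumes i: "i \<in> dofs M" and J: "finite J" "J \<subseteq> dofs M" "{j \<in> dofs M. overlap i j} \<subseteq> J"
  shows "(\<lambda>x. \<phi> i x * divg (fe_fun bc M a V) x) absolutely_integrable_on domain bc"
    and "integral (domain bc) (\<lambda>x. \<phi> i x * divg (fe_fun bc M a V) x) = (\<Sum>j\<in>J. V j \<bullet> cvec bc M a i j)"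
proof -
  define g where "g x = (\<Sum>j\<in>J. V j \<bullet> (\<phi> i x *\<^sub>R grad (\<phi> j) x))" for x
  have eq: "g x = \<phi> i x * divg (fe_fun bc M a V) x" if x: "x \<in> cell_interiors" for x
  proof (cases "\<phi> i x = 0")
    case False
    \<comment> \<open>Near \<open>x\<close> the velocity involves these indices; those outside \<open>J\<close> do not interact with \<open>i\<close>.\<close>
    let ?J = "J \<union> {j \<in> dofs M. \<exists>y\<in>ball x 1. \<phi> j y \<noteq> 0}"
    have fin: "finite ?J" using J(1) finite_local_dofs[of "ball x 1"] by simp
    have "divg (fe_fun bc M a V) x = (\<Sum>j\<in>?J. V j \<bullet> grad (\<phi> j) x)"
      by (rule divg_fe_fun[OF x fin]) (use J in auto)
    also have "\<dots> = (\<Sum>j\<in>J. V j \<bullet> grad (\<phi> j) x)"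
    proof (rule sum.mono_neutral_right[OF fin])
      have "grad (\<phi> j) x = 0" if "j \<in> dofs M - J" for j
        using that J(3) False psi_grad_eq_0[OF i, of j x] by blast
      then show "\<forall>j\<in>?J - J. V j \<bullet> grad (\<phi> j) x = 0" by auto
    qed simp
    finally show ?thesis by (simp add: g_def sum_distrib_left)
  qed (simp add: g_def)
  have int: "(\<lambda>x. V j \<bullet> (\<phi> i x *\<^sub>R grad (\<phi> j) x)) absolutely_integrable_on domain bc"
    "integral (domain bc) (\<lambda>x. V j \<bullet> (\<phi> i x *\<^sub>R grad (\<phi> j) x)) = V j \<bullet> cvec bc M a i j" if "j \<in> J" for j
  proof -
    have j: "j \<in> dofs M" using that J by blast
    show "(\<lambda>x. V j \<bullet> (\<phi> i x *\<^sub>R grad (\<phi> j) x)) absolutely_integrable_on domain bc"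
      using absolutely_integrable_linear[OF psi_grad_integrable[OF i j] bounded_linear_inner_right[of "V j"]]
      by (simp add: o_def)
    show "integral (domain bc) (\<lambda>x. V j \<bullet> (\<phi> i x *\<^sub>R grad (\<phi> j) x)) = V j \<bullet> cvec bc M a i j"
      using integral_linear[OF _ bounded_linear_inner_right[of "V j"], of "\<lambda>x. \<phi> i x *\<^sub>R grad (\<phi> j) x" "domain bc"]
        psi_grad_integrable[OF i j] cvec_eq_integral[OF i j]
      by (simp add: o_def absolutely_integrable_on_def)
  qed
  have "g absolutely_integrable_on domain bc"
    unfolding g_def by (intro absolutely_integrable_sum int J(1))
  then show "(\<lambda>x. \<phi> i x * divg (fe_fun bc M a V) x) absolutely_integrable_on domain bc"
    by (rule absolutely_integrable_spike[OF _ negligible_cell_boundaries]) (use eq in auto)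
  have "integral (domain bc) (\<lambda>x. \<phi> i x * divg (fe_fun bc M a V) x) = integral (domain bc) g"
    by (rule integral_spike[OF negligible_cell_boundaries]) (use eq in auto)
  also have "\<dots> = (\<Sum>j\<in>J. V j \<bullet> cvec bc M a i j)"
    unfolding g_def using int J(1) by (subst integral_sum) (auto simp: absolutely_integrable_on_def)
  finally show "integral (domain bc) (\<lambda>x. \<phi> i x * divg (fe_fun bc M a V) x) = (\<Sum>j\<in>J. V j \<bullet> cvec bc M a i j)" .
qed

text \<open>The divergence of a constant velocity vanishes.\<close>

lemma cvec_row_sum:
  assumes i: "i \<in> dofs M" and J: "finite J" "J \<subseteq> dofs M" "{j \<in> dofs M. overlap i j} \<subseteq> J"
  shows "(\<Sum>j\<in>J. cvec bc M a i j) = 0"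
proof -
  have "(\<Sum>j\<in>J. cvec bc M a i j) $ l = 0" for l
  proof -
    have "fe_fun bc M a (\<lambda>_. axis l 1) = (\<lambda>_. axis l 1 :: real^'d)"
      using fe_fun_const by auto
    then have "divg (fe_fun bc M a (\<lambda>_. axis l 1)) x = 0" for x
      by (simp add: divg_def)
    then show ?thesis
      using divergence_integral(2)[OF i J, of "\<lambda>_. axis l 1"] by (simp add: inner_axis' inner_sum_right[symmetric])
  qed
  then show ?thesis by (simp add: vec_eq_iff)
qed

end

section \<open>Conservation of the excess in an abstract step\<close>

lemma tensor_diff: "tensor (u - v) w = tensor u w - tensor v w"
  by (simp add: tensor_def vec_eq_iff left_diff_distrib)

lemma tensor_zero: "tensor 0 w = 0"
  by (simp add: tensor_def vec_eq_iff)

lemma tensor_mult_vec: "tensor u w *v c = (w \<bullet> c) *\<^sub>R u"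
  by (simp add: tensor_def matrix_vector_mult_def vec_eq_iff inner_vec_def sum_distrib_left mult_ac)

lemma sum_matrix_vector_mult: "(\<Sum>i\<in>S. (A :: real^'d^'m) *v x i) = A *v (\<Sum>i\<in>S. x i)"
  by (induction S rule: infinite_finite_induct) (simp_all add: matrix_vector_right_distrib)

lemma visc_off_sym:
  assumes "j \<in> N i \<longleftrightarrow> i \<in> N j"
  shows "visc_off lmax f N c W U i j = visc_off lmax f N c W U j i"
  using assms by (simp add: visc_off_def max.commute)

lemma visc_sym:
  assumes "j \<in> N i \<longleftrightarrow> i \<in> N j"
  shows "visc lmax f N c W U i j = visc lmax f N c W U j i"
  using visc_off_sym[OF assms, of lmax f c W U] by (simp add: visc_def)

text \<open>The diagonal entry is minus a column sum, which is a row sum by symmetry. It takes part in the sum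
  over the neighborhood only if \<open>i\<close> is its own neighbor; an empty neighborhood gives an empty sum.\<close>

lemma visc_row_sum:
  assumes fin: "finite (N i)" and self: "N i \<noteq> {} \<Longrightarrow> i \<in> N i"
    and sym: "\<And>j. j \<in> N i \<Longrightarrow> i \<in> N j"
  shows "(\<Sum>j\<in>N i. visc lmax f N c W U i j) = 0"
proof (cases "N i = {}")
  case False
  then have i: "i \<in> N i" by (rule self)
  have "(\<Sum>j\<in>N i. visc lmax f N c W U i j) =
      visc lmax f N c W U i i + (\<Sum>j\<in>N i - {i}. visc lmax f N c W U i j)"
    by (rule sum.remove[OF fin i])
  also have "(\<Sum>j\<in>N i - {i}. visc lmax f N c W U i j) = (\<Sum>k\<in>N i - {i}. visc_off lmax f N c W U k i)"
    by (rule sum.cong) (use sym visc_off_sym[where lmax=lmax and f=f and N=N and c=c and W=W and U=U] in \<open>auto simp: visc_def\<close>)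
  finally show ?thesis by (simp add: visc_def)
qed simp

text \<open>Vanishing row sums allow \<open>f u\<close>, \<open>(W j \<bullet> c i j) *\<^sub>R u\<close> and \<open>d i j *\<^sub>R u\<close> to be subtracted in
  the sum over \<open>j\<close>; the middle terms are accounted for by the change of the masses. What remains is
  \<open>H i j\<close>, which vanishes unless \<open>j\<close> carries excess. So the step only reaches the finite set \<open>Y\<close> of
  excess indices and their neighbors, and summation over \<open>i\<close> first gives column sums. For a nonzero
  mass, vanishing \<open>m' i *\<^sub>R (U' i - u)\<close> means vanishing excess.\<close>

lemma ale_step_conserves_excess:
  fixes U U' :: "nat \<Rightarrow> real^'m::finite" and W :: "nat \<Rightarrow> real^'d::finite"
  assumes step: "ale_step lmax f I N c W \<tau> m U m' U'" and "\<tau> > 0"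
    and fin: "\<And>i. i \<in> I \<Longrightarrow> finite (N i)" and sub: "\<And>i. i \<in> I \<Longrightarrow> N i \<subseteq> I"
    and sym: "\<And>i j. i \<in> I \<Longrightarrow> j \<in> N i \<Longrightarrow> i \<in> N j"
    and self: "\<And>i. i \<in> I \<Longrightarrow> N i \<noteq> {} \<Longrightarrow> i \<in> N i"
    and row: "\<And>i. i \<in> I \<Longrightarrow> (\<Sum>j\<in>N i. c i j) = 0"
    and col: "\<And>j. j \<in> I \<Longrightarrow> (\<Sum>i\<in>N j. c i j) = 0"
    and gcl: "\<And>i. i \<in> I \<Longrightarrow> (m' i - m i) *\<^sub>R u = (\<tau> * (\<Sum>j\<in>N i. W j \<bullet> c i j)) *\<^sub>R u"
    and finU: "finite {i \<in> I. U i \<noteq> u}"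
    and nonzero: "finite I \<or> (\<forall>i\<in>I. m' i \<noteq> 0)"
  shows "finite {i \<in> I. U' i \<noteq> u}"
    and "(\<Sum>\<^sub>\<infinity>i\<in>I. m' i *\<^sub>R (U' i - u)) = (\<Sum>\<^sub>\<infinity>i\<in>I. m i *\<^sub>R (U i - u))"
proof -
  define d where "d = visc lmax f N c W U"
  have d_sym: "d i j = d j i" if "i \<in> I" "j \<in> N i" for i j
    unfolding d_def using that sym sub by (intro visc_sym) blast
  have d_row: "(\<Sum>j\<in>N i. d i j) = 0" if "i \<in> I" for i
    unfolding d_def by (rule visc_row_sum[OF fin self sym]) (use that in auto)
  have d_col: "(\<Sum>i\<in>N j. d i j) = 0" if "j \<in> I" for j
    using d_row[OF that] d_sym[OF that] by (simp cong: sum.cong)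
  define H where "H i j = (f (U j) - f u - tensor (U j - u) (W j)) *v c i j - d i j *\<^sub>R (U j - u)" for i j
  have H0: "H i j = 0" if "U j = u" for i j
    using that by (simp add: H_def tensor_zero)
  have key: "m' i *\<^sub>R (U' i - u) = m i *\<^sub>R (U i - u) - \<tau> *\<^sub>R (\<Sum>j\<in>N i. H i j)" if i: "i \<in> I" for i
  proof -
    define S where "S = (\<Sum>j\<in>N i. (f (U j) - tensor (U j) (W j)) *v c i j - d i j *\<^sub>R U j)"
    have "(m' i *\<^sub>R U' i - m i *\<^sub>R U i) /\<^sub>R \<tau> + S = 0"
      using step i unfolding ale_step_def S_def d_def by blast
    then have "\<tau> *\<^sub>R ((m' i *\<^sub>R U' i - m i *\<^sub>R U i) /\<^sub>R \<tau> + S) = 0" by simp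
    then have 1: "m' i *\<^sub>R U' i - m i *\<^sub>R U i = - \<tau> *\<^sub>R S"
      using \<open>\<tau> > 0\<close> by (simp add: scaleR_add_right add_eq_0_iff2)
    have "H i j = ((f (U j) - tensor (U j) (W j)) *v c i j - d i j *\<^sub>R U j)
        - f u *v c i j + (W j \<bullet> c i j) *\<^sub>R u + d i j *\<^sub>R u" for j
      by (simp add: H_def tensor_diff matrix_vector_mult_diff_rdistrib tensor_mult_vec algebra_simps)
    then have "(\<Sum>j\<in>N i. H i j) = S - (\<Sum>j\<in>N i. f u *v c i j) + (\<Sum>j\<in>N i. (W j \<bullet> c i j) *\<^sub>R u)
        + (\<Sum>j\<in>N i. d i j *\<^sub>R u)"
      by (simp add: S_def sum.distrib sum_subtractf)
    also have "(\<Sum>j\<in>N i. f u *v c i j) = 0"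
      by (simp add: sum_matrix_vector_mult row[OF i])
    also have "(\<Sum>j\<in>N i. d i j *\<^sub>R u) = 0"
      by (simp add: d_row[OF i] flip: scaleR_sum_left)
    finally have "\<tau> *\<^sub>R (\<Sum>j\<in>N i. H i j) = \<tau> *\<^sub>R S + (m' i - m i) *\<^sub>R u"
      using gcl[OF i] by (simp only: scaleR_sum_left[symmetric] scaleR_add_right scaleR_scaleR diff_zero add_0_right)
    with 1 show ?thesis by (simp add: algebra_simps)
  qed
  define X where "X = {i \<in> I. U i \<noteq> u}"
  define Y where "Y = X \<union> (\<Union>j\<in>X. N j)"
  have X: "X \<subseteq> I" "finite X" using finU by (auto simp: X_def)
  have Y: "finite Y" "Y \<subseteq> I" using X fin sub by (auto simp: Y_def)
  have out: "U i = u" "(\<Sum>j\<in>N i. H i j) = 0" if i: "i \<in> I - Y" for i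
  proof -
    show "U i = u" using i by (auto simp: Y_def X_def)
    have "U j = u" if "j \<in> N i" for j
      using that i sym[of i j] sub[of i] by (auto simp: Y_def X_def)
    then show "(\<Sum>j\<in>N i. H i j) = 0" by (intro sum.neutral ballI H0)
  qed
  have out': "m' i *\<^sub>R (U' i - u) = 0" if "i \<in> I - Y" for i
    using key[of i] out[OF that] that by simp
  show "finite {i \<in> I. U' i \<noteq> u}"
    using nonzero
  proof
    assume "\<forall>i\<in>I. m' i \<noteq> 0"
    then have "{i \<in> I. U' i \<noteq> u} \<subseteq> Y" using out' by force
    then show ?thesis using Y(1) finite_subset by blast
  qed simp
  have "(\<Sum>i\<in>Y. \<Sum>j\<in>N i. H i j) = (\<Sum>i\<in>Y. \<Sum>j\<in>X. if j \<in> N i then H i j else 0)"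
  proof (rule sum.cong[OF refl])
    fix i assume "i \<in> Y"
    then have i: "i \<in> I" using Y by blast
    have "(\<Sum>j\<in>N i. H i j) = (\<Sum>j\<in>N i \<inter> X. H i j)"
      by (rule sum.mono_neutral_right) (use fin i sub[OF i] H0 in \<open>auto simp: X_def\<close>)
    also have "\<dots> = (\<Sum>j\<in>X. if j \<in> N i then H i j else 0)"
      using X(2) by (simp add: sum.inter_restrict Int_commute)
    finally show "(\<Sum>j\<in>N i. H i j) = (\<Sum>j\<in>X. if j \<in> N i then H i j else 0)" .
  qed
  also have "\<dots> = (\<Sum>j\<in>X. \<Sum>i\<in>Y. if j \<in> N i then H i j else 0)"
    by (rule sum.swap)
  also have "\<dots> = 0"
  proof (rule sum.neutral, rule ballI)
    fix j assume j: "j \<in> X"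
    then have jI: "j \<in> I" using X by blast
    have "(\<Sum>i\<in>Y. if j \<in> N i then H i j else 0) = (\<Sum>i\<in>Y \<inter> N j. H i j)"
    proof -
      have "(\<Sum>i\<in>Y. if j \<in> N i then H i j else 0) = (\<Sum>i\<in>Y. if i \<in> N j then H i j else 0)"
        by (rule sum.cong) (use sym jI Y in auto)
      then show ?thesis using Y(1) by (simp add: sum.inter_restrict)
    qed
    also have "Y \<inter> N j = N j" using j by (auto simp: Y_def)
    also have "(\<Sum>i\<in>N j. H i j) = (f (U j) - f u - tensor (U j - u) (W j)) *v (\<Sum>i\<in>N j. c i j)
        - (\<Sum>i\<in>N j. d i j) *\<^sub>R (U j - u)"
      by (simp add: H_def sum_subtractf sum_matrix_vector_mult scaleR_sum_left)
    also have "\<dots> = 0" by (simp add: col[OF jI] d_col[OF jI])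
    finally show "(\<Sum>i\<in>Y. if j \<in> N i then H i j else 0) = 0" .
  qed
  finally have zero: "(\<Sum>i\<in>Y. \<Sum>j\<in>N i. H i j) = 0" .
  have "(\<Sum>\<^sub>\<infinity>i\<in>I. m' i *\<^sub>R (U' i - u)) = (\<Sum>\<^sub>\<infinity>i\<in>Y. m' i *\<^sub>R (U' i - u))"
    by (rule infsum_cong_neutral) (use out' Y in auto)
  also have "\<dots> = (\<Sum>i\<in>Y. m i *\<^sub>R (U i - u) - \<tau> *\<^sub>R (\<Sum>j\<in>N i. H i j))"
    using Y by (auto intro!: sum.cong key)
  also have "\<dots> = (\<Sum>i\<in>Y. m i *\<^sub>R (U i - u))"
    by (simp add: sum_subtractf zero flip: scaleR_sum_right)
  also have "\<dots> = (\<Sum>\<^sub>\<infinity>i\<in>Y. m i *\<^sub>R (U i - u))" using Y(1) by simp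
  also have "\<dots> = (\<Sum>\<^sub>\<infinity>i\<in>I. m i *\<^sub>R (U i - u))"
    by (rule infsum_cong_neutral) (use out Y in auto)
  finally show "(\<Sum>\<^sub>\<infinity>i\<in>I. m' i *\<^sub>R (U' i - u)) = (\<Sum>\<^sub>\<infinity>i\<in>I. m i *\<^sub>R (U i - u))" .
qed

section \<open>Neighborhoods, masses and the excess on a mesh\<close>

context mesh
begin

lemma reference_copy: "K \<in> cells M \<Longrightarrow> (K, 0) \<in> copies"
  using periods_closed(1) by auto

text \<open>Every point lies in a cell, where the shape functions are given by reference functions. The right-hand
  side does not mention the node positions.\<close>

lemma overlap_iff:
  assumes "i \<in> dofs M" "j \<in> dofs M"
  shows "overlap i j \<longleftrightarrow> (\<exists>K\<in>cells M. \<exists>z\<in>rdom (relem M K). loc_shape M i K z * loc_shape M j K z \<noteq> 0)"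
proof
  assume "overlap i j"
  then obtain x where x: "\<phi> i x * \<phi> j x \<noteq> 0" by (auto simp: overlap_def)
  obtain c z where c: "c \<in> copies" "z \<in> rcell M c" "x = cmap M a c z" by (rule point_in_cell)
  with x psi_cmap[OF assms(1) c(1,2)] psi_cmap[OF assms(2) c(1,2)]
  show "\<exists>K\<in>cells M. \<exists>z\<in>rdom (relem M K). loc_shape M i K z * loc_shape M j K z \<noteq> 0"
    by (intro bexI[of _ "fst c"] bexI[of _ z]) (auto simp: rcell_def)
next
  assume "\<exists>K\<in>cells M. \<exists>z\<in>rdom (relem M K). loc_shape M i K z * loc_shape M j K z \<noteq> 0"
  then obtain K z where K: "K \<in> cells M" "z \<in> rdom (relem M K)" "loc_shape M i K z * loc_shape M j K z \<noteq> 0" by blast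
  then have c: "(K, 0) \<in> copies" "z \<in> rcell M (K, 0)"
    using periods_closed(1) by (auto simp: rcell_def)
  show "overlap i j"
    unfolding overlap_def
    using K(3) psi_cmap[OF assms(1) c] psi_cmap[OF assms(2) c] by (intro exI[of _ "cmap M a (K, 0) z"]) simp
qed

definition "nbrs i = infl bc M a (supp bc M a i)"

lemma nbrs_dofs: "nbrs i \<subseteq> dofs M"
  by (auto simp: nbrs_def infl_def)

lemma nbrs_sym: "i \<in> dofs M \<Longrightarrow> j \<in> nbrs i \<Longrightarrow> i \<in> nbrs j"
  by (simp add: nbrs_def infl_def Int_commute)

lemma nbrs_self:
  assumes "i \<in> dofs M" "nbrs i \<noteq> {}"
  shows "i \<in> nbrs i"
proof -
  obtain j where j: "emeasure lebesgue (supp bc M a j \<inter> supp bc M a i \<inter> domain bc) \<noteq> 0"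
    using assms(2) by (auto simp: nbrs_def infl_def)
  have "emeasure lebesgue (supp bc M a j \<inter> supp bc M a i \<inter> domain bc) \<le>
      emeasure lebesgue (supp bc M a i \<inter> supp bc M a i \<inter> domain bc)"
    by (rule emeasure_mono) (auto simp: supp_def intro!: sets.Int domain_lebesgue)
  with j assms(1) show ?thesis by (auto simp: nbrs_def infl_def)
qed

lemma finite_dofs_periodic: "bc = Periodic L \<Longrightarrow> finite (dofs M)"
  using data by (auto simp: mesh_data_ok_def)

text \<open>In the Cauchy problem there are infinitely many indices, but the bounded support of \<open>\<phi> i\<close> meets only
  finitely many cells.\<close>

lemma finite_nbrs:
  assumes i: "i \<in> dofs M" shows "finite (nbrs i)"
proof (cases bc)
  case (Cauchy u)
  let ?C = "{c \<in> copies. cmap M a c ` rcell M c \<inter> supp bc M a i \<noteq> {}}"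
  have "finite (\<Union>c\<in>?C. jsh M (fst c) ` {..<nsh (relem M (fst c))})"
    using locally_finite_cells[OF bounded_supp[OF Cauchy i]] by blast
  moreover have "nbrs i \<subseteq> (\<Union>c\<in>?C. jsh M (fst c) ` {..<nsh (relem M (fst c))})"
  proof
    fix j assume j: "j \<in> nbrs i"
    then have "supp bc M a j \<inter> supp bc M a i \<noteq> {}" and jd: "j \<in> dofs M"
      by (auto simp: nbrs_def infl_def)
    then obtain x where x: "x \<in> supp bc M a j" "x \<in> supp bc M a i" by blast
    then obtain K where K: "K \<in> cells M" "j \<in> jsh M K ` {..<nsh (relem M K)}" "x \<in> cmap M a (K, 0) ` rcell M (K, 0)"
      using supp_subset_cells[OF Cauchy jd] by auto
    then have "(K, 0) \<in> ?C" using x(2) periods_closed(1) by auto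
    then show "j \<in> (\<Union>c\<in>?C. jsh M (fst c) ` {..<nsh (relem M (fst c))})"
      using K(2) by (intro UN_I[of "(K, 0)"]) auto
  qed
  ultimately show ?thesis by (rule finite_subset[rotated])
next
  case (Periodic L)
  then show ?thesis using finite_dofs_periodic nbrs_dofs finite_subset by blast
qed

lemma translate_into_domain:
  obtains s where "s \<in> periods bc" "x + s \<in> domain bc"
proof (cases bc)
  case (Cauchy u)
  then show ?thesis using that[of 0] periods_closed(1) by simp
next
  case (Periodic L)
  \<comment> \<open>Reduction of each coordinate modulo its period.\<close>
  define s where "s = (\<chi> l. of_int (- \<lfloor>x $ l / L $ l\<rfloor>) * L $ l)"
  have L: "L $ l > 0" for l by (rule periodic_positive[OF Periodic])
  have "s \<in> periods bc"
    unfolding Periodic s_def periods.simps by (rule CollectI, rule exI[of _ "\<lambda>l. - \<lfloor>x $ l / L $ l\<rfloor>"]) simp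
  moreover have "x + s \<in> domain bc"
  proof -
    have "0 \<le> x $ l + s $ l \<and> x $ l + s $ l \<le> L $ l" for l
    proof -
      have "of_int \<lfloor>x $ l / L $ l\<rfloor> \<le> x $ l / L $ l" "x $ l / L $ l \<le> of_int \<lfloor>x $ l / L $ l\<rfloor> + 1"
        by linarith+
      then have "of_int \<lfloor>x $ l / L $ l\<rfloor> * L $ l \<le> x $ l" "x $ l \<le> (of_int \<lfloor>x $ l / L $ l\<rfloor> + 1) * L $ l"
        using L[of l] by (simp_all only: pos_le_divide_eq pos_divide_le_eq)
      then show ?thesis by (simp add: s_def algebra_simps)
    qed
    then show ?thesis by (simp add: Periodic mem_box_cart)
  qed
  ultimately show ?thesis by (rule that)
qed

lemma domain_subset_closure: "domain bc \<subseteq> closure (interior (domain bc))"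
proof (cases bc)
  case (Periodic L)
  have "box 0 L \<noteq> {}"
    using periodic_positive[OF Periodic] by (simp add: interval_ne_empty_cart)
  then show ?thesis by (simp add: Periodic interior_cbox closure_box)
qed simp

text \<open>Interacting shape functions are both nonzero on a nonempty open set. In the periodic case this set
  may lie far from the period cell; a translate of it meets the cell, and then also the interior of the
  cell, in a nonempty open set. Such a set has positive measure.\<close>

lemma overlap_nbrs:
  assumes ij: "i \<in> dofs M" "j \<in> dofs M" and ov: "overlap i j"
  shows "j \<in> nbrs i"
proof (rule ccontr)
  assume "j \<notin> nbrs i"
  then have "emeasure lebesgue (supp bc M a j \<inter> supp bc M a i \<inter> domain bc) = 0"
    using ij by (simp add: nbrs_def infl_def)
  moreover have "supp bc M a j \<inter> supp bc M a i \<inter> domain bc \<in> sets lebesgue"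
    by (auto simp: supp_def intro!: sets.Int domain_lebesgue)
  ultimately have null: "negligible (supp bc M a j \<inter> supp bc M a i \<inter> domain bc)"
    by (simp add: negligible_iff_null_sets null_sets_def)
  define Z where "Z = {x. \<phi> i x \<noteq> 0} \<inter> {x. \<phi> j x \<noteq> 0}"
  have Z: "open Z" unfolding Z_def using ij open_psi_nonzero by blast
  obtain x where x: "x \<in> Z" using ov by (auto simp: overlap_def Z_def)
  obtain s where s: "s \<in> periods bc" "x + s \<in> domain bc" by (rule translate_into_domain)
  have "x + s \<in> Z" using x psi_shift[OF _ s(1)] ij by (simp add: Z_def)
  then have "Z \<inter> closure (interior (domain bc)) \<noteq> {}" using s(2) domain_subset_closure by blast
  then have "Z \<inter> interior (domain bc) \<noteq> {}" using open_Int_closure_eq_empty[OF Z] by blast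
  moreover have "open (Z \<inter> interior (domain bc))" using Z by blast
  moreover have "negligible (Z \<inter> interior (domain bc))"
  proof (rule negligible_subset[OF null])
    show "Z \<inter> interior (domain bc) \<subseteq> supp bc M a j \<inter> supp bc M a i \<inter> domain bc"
      using interior_subset[of "domain bc"] psi_in_supp by (auto simp: Z_def)
  qed
  ultimately show False using open_not_negligible by blast
qed

lemma overlap_subset_nbrs:
  assumes "i \<in> dofs M"
  shows "{j \<in> dofs M. overlap i j} \<subseteq> nbrs i" "{j \<in> dofs M. overlap j i} \<subseteq> nbrs i"
  using overlap_nbrs[OF assms] overlap_sym by auto

lemma psi_integrable:
  assumes i: "i \<in> dofs M"
  shows "\<phi> i absolutely_integrable_on domain bc"
proof (cases bc)
  case (Periodic L)
  then show ?thesis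
    using absolutely_integrable_continuous[OF continuous_psi[OF i, of "cbox 0 L"]] by simp
next
  case (Cauchy u)
  obtain c where c: "supp bc M a i \<subseteq> cbox (-c) c"
    using bounded_subset_cbox_symmetric[OF bounded_supp[OF Cauchy i]] by blast
  have "(\<lambda>x. if x \<in> cbox (-c) c then \<phi> i x else 0) = \<phi> i"
    using c psi_in_supp by fastforce
  then show ?thesis
    using absolutely_integrable_continuous[OF continuous_psi[OF i, of "cbox (-c) c"]]
      absolutely_integrable_restrict_UNIV[of "cbox (-c) c" "\<phi> i"] by (simp add: Cauchy)
qed

lemma mass_eq_integral: "i \<in> dofs M \<Longrightarrow> mass bc M a i = integral (domain bc) (\<phi> i)"
  unfolding mass_def by (rule set_lebesgue_integral_eq_integral[OF psi_integrable])

lemma shapes_independent: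
  assumes "K \<in> cells M" "k < nsh (relem M K)"
    and "\<And>z. z \<in> rdom (relem M K) \<Longrightarrow> (\<Sum>l<nsh (relem M K). c l * th (relem M K) l z) = 0"
  shows "c k = 0"
  using element_ok[OF assms(1)] assms(2,3) unfolding ref_element_ok_def by blast

lemma psi_nontrivial:
  assumes i: "i \<in> dofs M"
  shows "\<exists>x. \<phi> i x \<noteq> 0"
proof -
  obtain K k where K: "K \<in> cells M" "k < nsh (relem M K)" "i = jsh M K k"
    using i data by (auto simp: mesh_data_ok_def)
  let ?R = "relem M K"
  have "\<exists>z\<in>rdom ?R. th ?R k z \<noteq> 0"
  proof (rule ccontr)
    assume "\<not> ?thesis"
    then have "(\<Sum>l<nsh ?R. (if l = k then 1 else 0) * th ?R l z) = 0" if "z \<in> rdom ?R" for z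
      using that by (auto intro!: sum.neutral)
    from shapes_independent[OF K(1,2), of "\<lambda>l. if l = k then 1 else 0", OF this] show False by simp
  qed
  then obtain z where z: "z \<in> rdom ?R" "th ?R k z \<noteq> 0" by blast
  then have "\<phi> i (cmap M a (K, 0) z) \<noteq> 0"
    using psi_cmap[OF i reference_copy[OF K(1)], of z] loc_shape_jsh[OF K(1,2)] K(3) by (simp add: rcell_def)
  then show ?thesis by blast
qed

text \<open>A nonnegative continuous function with vanishing integral is zero, whereas independent reference
  shape functions are not.\<close>

lemma mass_pos:
  assumes bc: "bc = Cauchy u" and i: "i \<in> dofs M"
  shows "mass bc M a i > 0"
proof -
  have int: "integrable lebesgue (\<phi> i)"
    using psi_integrable[OF i] by (simp add: bc set_integrable_def)
  have mass: "mass bc M a i = integral\<^sup>L lebesgue (\<phi> i)"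
    by (simp add: mass_def bc set_lebesgue_integral_def)
  have "integral\<^sup>L lebesgue (\<phi> i) \<noteq> 0"
  proof
    assume "integral\<^sup>L lebesgue (\<phi> i) = 0"
    then have "AE x in lebesgue. \<phi> i x = 0"
      using integral_nonneg_eq_0_iff_AE[OF int] psi_nonneg[OF i] by simp
    then have "negligible {x. \<phi> i x \<noteq> 0}"
      using AE_iff_null[of lebesgue "\<lambda>x. \<phi> i x = 0"] open_psi_nonzero[OF i]
      by (simp add: negligible_iff_null_sets borel_open)
    then show False
      using open_not_negligible[OF open_psi_nonzero[OF i]] psi_nontrivial[OF i] by blast
  qed
  moreover have "integral\<^sup>L lebesgue (\<phi> i) \<ge> 0"
    by (rule Bochner_Integration.integral_nonneg) (rule psi_nonneg[OF i])
  ultimately show ?thesis by (simp add: mass)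
qed

text \<open>On a cell outside the compact set, the approximation is the constant \<open>u\<close>. As the shape functions
  sum to \<open>1\<close> and are independent, all its coefficients on that cell equal \<open>u\<close>. Only finitely many cells
  meet the compact set.\<close>

lemma finite_excess:
  fixes u :: "real^'m"
  assumes bc: "bc = Cauchy u" and U: "data_ok bc M a U"
  shows "finite {i \<in> dofs M. U i \<noteq> u}"
proof -
  obtain C where C: "compact C" "\<And>x. x \<notin> C \<Longrightarrow> fe_fun bc M a U x = u"
    using U by (auto simp: data_ok_def bc)
  let ?C = "{c \<in> copies. cmap M a c ` rcell M c \<inter> C \<noteq> {}}"
  have "finite (\<Union>c\<in>?C. jsh M (fst c) ` {..<nsh (relem M (fst c))})"
    using locally_finite_cells[OF compact_imp_bounded[OF C(1)]] by blast
  moreover have "{i \<in> dofs M. U i \<noteq> u} \<subseteq> (\<Union>c\<in>?C. jsh M (fst c) ` {..<nsh (relem M (fst c))})"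
  proof clarify
    fix i assume i: "i \<in> dofs M" "U i \<noteq> u"
    then obtain K k where K: "K \<in> cells M" "k < nsh (relem M K)" "i = jsh M K k"
      using data by (auto simp: mesh_data_ok_def)
    let ?R = "relem M K"
    have c: "(K, 0) \<in> copies" using K periods_closed(1) by auto
    have "(K, 0) \<in> ?C"
    proof (rule ccontr)
      assume "(K, 0) \<notin> ?C"
      then have const: "fe_fun bc M a U (cmap M a (K, 0) z) = u" if "z \<in> rdom ?R" for z
        using c that C(2) by (auto simp: rcell_def)
      have "U i $ p = u $ p" for p
      proof -
        have "(\<Sum>l<nsh ?R. (U (jsh M K l) $ p - u $ p) * th ?R l z) = 0" if z: "z \<in> rdom ?R" for z
        proof -
          have "(\<Sum>l<nsh ?R. th ?R l z *\<^sub>R U (jsh M K l)) = u"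
            using const[OF z] fe_fun_cmap[OF c, of z U] z by (simp add: rcell_def)
          then have "(\<Sum>l<nsh ?R. th ?R l z *\<^sub>R U (jsh M K l)) $ p = u $ p" by simp
          then have "(\<Sum>l<nsh ?R. U (jsh M K l) $ p * th ?R l z) = u $ p" by (simp add: mult.commute)
          moreover have "(\<Sum>l<nsh ?R. th ?R l z) = 1"
            using element_ok[OF K(1)] z by (simp add: ref_element_ok_def)
          ultimately show ?thesis
            by (simp add: left_diff_distrib sum_subtractf flip: sum_distrib_left)
        qed
        from shapes_independent[OF K(1,2), of "\<lambda>l. U (jsh M K l) $ p - u $ p", OF this]
        show ?thesis using K(3) by simp
      qed
      then show False using i(2) by (simp add: vec_eq_iff)
    qed
    then show "i \<in> (\<Union>c\<in>?C. jsh M (fst c) ` {..<nsh (relem M (fst c))})"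
      using K by (intro UN_I[of "(K, 0)"]) auto
  qed
  ultimately show ?thesis by (rule finite_subset[rotated])
qed

lemma excess_integral:
  fixes U :: "nat \<Rightarrow> real^'m" and u :: "real^'m"
  assumes fin: "finite {i \<in> dofs M. U i \<noteq> u}"
  shows "set_integrable lebesgue (domain bc) (\<lambda>x. fe_fun bc M a U x - u)"
    and "(LINT x:domain bc|lebesgue. fe_fun bc M a U x - u) = (\<Sum>\<^sub>\<infinity>i\<in>dofs M. mass bc M a i *\<^sub>R (U i - u))"
proof -
  let ?X = "{i \<in> dofs M. U i \<noteq> u}"
  have eq: "fe_fun bc M a U x - u = (\<Sum>i\<in>?X. \<phi> i x *\<^sub>R (U i - u))" for x
  proof -
    let ?J = "?X \<union> {j \<in> dofs M. \<exists>y\<in>{x}. \<phi> j y \<noteq> 0}"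
    have J: "finite ?J" "?J \<subseteq> dofs M" using fin finite_local_dofs[of "{x}"] by auto
    have "fe_fun bc M a U x = (\<Sum>i\<in>?J. \<phi> i x *\<^sub>R U i)"
      by (rule fe_fun_eq_sum[OF J]) auto
    moreover have "u = (\<Sum>i\<in>?J. \<phi> i x *\<^sub>R u)"
      using sum_psi[OF J, of x] by (simp flip: scaleR_sum_left)
    ultimately have "fe_fun bc M a U x - u = (\<Sum>i\<in>?J. \<phi> i x *\<^sub>R (U i - u))"
      by (simp add: scaleR_diff_right sum_subtractf)
    also have "\<dots> = (\<Sum>i\<in>?X. \<phi> i x *\<^sub>R (U i - u))"
      by (rule sum.mono_neutral_right[OF J(1)]) auto
    finally show ?thesis .
  qed
  have int: "set_integrable lebesgue (domain bc) (\<lambda>x. \<phi> i x *\<^sub>R (U i - u))"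
    "(LINT x:domain bc|lebesgue. \<phi> i x *\<^sub>R (U i - u)) = mass bc M a i *\<^sub>R (U i - u)" if "i \<in> ?X" for i
  proof -
    have psi: "integrable lebesgue (\<lambda>x. indicator (domain bc) x *\<^sub>R \<phi> i x)"
      using psi_integrable[of i] that by (simp add: set_integrable_def)
    have assoc: "indicator (domain bc) x *\<^sub>R \<phi> i x *\<^sub>R (U i - u) = (indicator (domain bc) x *\<^sub>R \<phi> i x) *\<^sub>R (U i - u)" for x
      by simp
    show "set_integrable lebesgue (domain bc) (\<lambda>x. \<phi> i x *\<^sub>R (U i - u))"
      unfolding set_integrable_def assoc by (rule integrable_scaleR_left[OF psi])
    show "(LINT x:domain bc|lebesgue. \<phi> i x *\<^sub>R (U i - u)) = mass bc M a i *\<^sub>R (U i - u)"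
      unfolding set_lebesgue_integral_def mass_def assoc by (rule integral_scaleR_left[OF psi])
  qed
  show "set_integrable lebesgue (domain bc) (\<lambda>x. fe_fun bc M a U x - u)"
    unfolding eq by (rule absolutely_integrable_sum[OF fin int(1)])
  have "(LINT x:domain bc|lebesgue. fe_fun bc M a U x - u) =
      (LINT x:domain bc|lebesgue. \<Sum>i\<in>?X. \<phi> i x *\<^sub>R (U i - u))" by (simp only: eq)
  also have "\<dots> = (\<Sum>i\<in>?X. LINT x:domain bc|lebesgue. \<phi> i x *\<^sub>R (U i - u))"
    unfolding set_lebesgue_integral_def scaleR_sum_right
    by (rule Bochner_Integration.integral_sum) (use int(1) in \<open>simp add: set_integrable_def\<close>)
  also have "\<dots> = (\<Sum>i\<in>?X. mass bc M a i *\<^sub>R (U i - u))"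
    using int(2) by (intro sum.cong) auto
  also have "\<dots> = (\<Sum>\<^sub>\<infinity>i\<in>?X. mass bc M a i *\<^sub>R (U i - u))" using fin by simp
  also have "\<dots> = (\<Sum>\<^sub>\<infinity>i\<in>dofs M. mass bc M a i *\<^sub>R (U i - u))"
    by (rule infsum_cong_neutral) auto
  finally show "(LINT x:domain bc|lebesgue. fe_fun bc M a U x - u) =
      (\<Sum>\<^sub>\<infinity>i\<in>dofs M. mass bc M a i *\<^sub>R (U i - u))" .
qed

end

section \<open>The geometric conservation law\<close>

context mesh
begin

text \<open>Distinct cells meet in a proper face, which does not reach the interior.\<close>

lemma cell_interiors_disjoint:
  assumes c: "c \<in> copies" "c' \<in> copies" "c \<noteq> c'"
  shows "cmap M a c ` interior (rcell M c) \<inter> cmap M a c' ` interior (rcell M c') = {}"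
proof (rule ccontr)
  assume "\<not> ?thesis"
  then obtain z z' where z: "z \<in> interior (rcell M c)" and z': "z' \<in> interior (rcell M c')"
    and eq: "cmap M a c z = cmap M a c' z'" by blast
  obtain F F' where F: "F face_of rcell M c" "F \<noteq> rcell M c"
    and int: "cmap M a c ` rcell M c \<inter> cmap M a c' ` rcell M c' = cmap M a c ` F"
    using matching c unfolding matching_mesh_def by meson
  have zS: "z \<in> rcell M c" "z' \<in> rcell M c'"
    using z z' interior_subset by blast+
  have "cmap M a c z \<in> cmap M a c ` rcell M c \<inter> cmap M a c' ` rcell M c'"
    using zS eq by (metis IntI imageI)
  then obtain y where y: "y \<in> F" "cmap M a c z = cmap M a c y"
    unfolding int by blast
  then have "y = z"
    using inj_cmap[OF c(1)] zS(1) face_of_imp_subset[OF F(1)] by (metis inj_onD subsetD)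
  then show False
    using face_of_disjoint_interior[OF F] y(1) z by blast
qed

lemma gmap_has_derivative:
  assumes "K \<in> cells M" "z \<in> interior (rdom (relem M K))"
  shows "(gmap M a K has_derivative frechet_derivative (gmap M a K) (at z)) (at z)"
proof -
  have z: "z \<in> interior (rcell M (K, 0))" using assms by (simp add: rcell_def)
  obtain T' where "(cmap M a (K, 0) has_derivative T') (at z)"
    by (rule cell_inverse[OF reference_copy[OF assms(1)] z])
  then have "(gmap M a K has_derivative T') (at z)" by (simp add: cmap_eq)
  then show ?thesis
    unfolding frechet_derivative_works[symmetric] by (rule differentiableI)
qed

abbreviation "cells_of i \<equiv> {K \<in> cells M. i \<in> jsh M K ` {..<nsh (relem M K)}}"

text \<open>The pullback to the reference cells. The finitely many open cell interiors on which \<open>\<phi> i\<close> does not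
  vanish are disjoint, and they carry the integral up to a null set.\<close>

lemma integral_over_cells:
  fixes g :: "real^'d \<Rightarrow> real"
  defines "h \<equiv> \<lambda>i K z. \<bar>det (matrix (frechet_derivative (gmap M a K) (at z)))\<bar> *
      (loc_shape M i K z * g (gmap M a K z))"
  assumes bc: "bc = Cauchy u" and i: "i \<in> dofs M"
    and int: "(\<lambda>x. \<phi> i x * g x) absolutely_integrable_on UNIV"
  shows "K \<in> cells_of i \<Longrightarrow> h i K integrable_on interior (rdom (relem M K))"
    and "integral UNIV (\<lambda>x. \<phi> i x * g x) = (\<Sum>K\<in>cells_of i. integral (interior (rdom (relem M K))) (h i K))"
proof -
  define T where "T K = gmap M a K ` interior (rdom (relem M K))" for K
  have T: "T K = cmap M a (K, 0) ` interior (rcell M (K, 0))" for K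
    by (simp add: T_def cmap_eq rcell_def)
  have openT: "open (T K)" if "K \<in> cells M" for K
    unfolding T by (rule open_cell[OF reference_copy[OF that]])
  have intT: "(\<lambda>x. \<phi> i x * g x) absolutely_integrable_on T K" if "K \<in> cells M" for K
    by (rule set_integrable_subset[OF int]) (use openT[OF that] in auto)
  have cov: "h i K absolutely_integrable_on interior (rdom (relem M K)) \<and>
      integral (interior (rdom (relem M K))) (h i K) = integral (T K) (\<lambda>x. \<phi> i x * g x)" if K: "K \<in> cells M" for K
  proof -
    let ?S = "interior (rdom (relem M K))"
    let ?h = "\<lambda>z. \<bar>det (matrix (frechet_derivative (gmap M a K) (at z)))\<bar> * (\<phi> i (gmap M a K z) * g (gmap M a K z))"
    have "inj_on (gmap M a K) ?S"
      using inj_cmap[OF reference_copy[OF K]] interior_subset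
      by (auto simp: cmap_eq rcell_def intro: inj_on_subset)
    then have "?h absolutely_integrable_on ?S \<and> integral ?S ?h = integral (T K) (\<lambda>x. \<phi> i x * g x)"
      unfolding T_def using intT[OF K]
      by (subst absolute_integral_change_of_variables) (auto intro: has_derivative_at_withinI[OF gmap_has_derivative[OF K]] simp: T_def)
    moreover have "?h z = h i K z" if "z \<in> ?S" for z
    proof -
      have "z \<in> rcell M (K, 0)" using that interior_subset[of "rdom (relem M K)"] by (auto simp: rcell_def)
      from psi_cmap[OF i reference_copy[OF K] this] show ?thesis by (simp add: h_def cmap_eq)
    qed
    ultimately show ?thesis
      using set_integrable_cong[of lebesgue lebesgue ?S ?S ?h "h i K"] integral_cong[of ?S ?h "h i K"] by simp
  qed
  show "h i K integrable_on interior (rdom (relem M K))" if "K \<in> cells_of i"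
    using cov[of K] that by (simp add: absolutely_integrable_on_def)
  have "((\<lambda>x. \<phi> i x * g x) has_integral (\<Sum>K\<in>cells_of i. integral (T K) (\<lambda>x. \<phi> i x * g x))) (\<Union>K\<in>cells_of i. T K)"
  proof (rule has_integral_UN[OF finite_cells_of_dof])
    show "((\<lambda>x. \<phi> i x * g x) has_integral integral (T K) (\<lambda>x. \<phi> i x * g x)) (T K)" if "K \<in> cells_of i" for K
      using intT[of K] that by (auto simp: absolutely_integrable_on_def)
    show "pairwise (\<lambda>K K'. negligible (T K \<inter> T K')) (cells_of i)"
      unfolding pairwise_def T using cell_interiors_disjoint[OF reference_copy reference_copy] by auto
  qed
  moreover have "((\<lambda>x. \<phi> i x * g x) has_integral s) (\<Union>K\<in>cells_of i. T K) \<longleftrightarrow>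
      ((\<lambda>x. \<phi> i x * g x) has_integral s) UNIV" for s
  proof (rule has_integral_spike_set_eq)
    show "negligible {x \<in> (\<Union>K\<in>cells_of i. T K) - UNIV. \<phi> i x * g x \<noteq> 0}" by simp
    show "negligible {x \<in> UNIV - (\<Union>K\<in>cells_of i. T K). \<phi> i x * g x \<noteq> 0}"
    proof (rule negligible_subset[OF negligible_cell_boundaries], rule subsetI, rule ccontr)
      fix x assume x: "x \<in> {x \<in> UNIV - (\<Union>K\<in>cells_of i. T K). \<phi> i x * g x \<noteq> 0}" and "x \<notin> - cell_interiors"
      then obtain c z where c: "c \<in> copies" "z \<in> interior (rcell M c)" "x = cmap M a c z"
        by (auto simp: cell_interiors_def)
      then have c0: "c = (fst c, 0)" using bc by (auto simp: prod_eq_iff)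
      have "z \<in> rcell M c" using c(2) interior_subset by blast
      then have "loc_shape M i (fst c) z \<noteq> 0" using x psi_cmap[OF i c(1)] c(3) by auto
      then have "fst c \<in> cells_of i" using c(1) loc_shape_eq_0 by auto
      moreover have "x \<in> T (fst c)" unfolding T using c c0 by (metis imageI)
      ultimately show False using x by blast
    qed
  qed
  ultimately have "integral UNIV (\<lambda>x. \<phi> i x * g x) = (\<Sum>K\<in>cells_of i. integral (T K) (\<lambda>x. \<phi> i x * g x))"
    by (simp add: integral_unique)
  also have "\<dots> = (\<Sum>K\<in>cells_of i. integral (interior (rdom (relem M K))) (h i K))"
    by (rule sum.cong) (use cov in auto)
  finally show "integral UNIV (\<lambda>x. \<phi> i x * g x) = (\<Sum>K\<in>cells_of i. integral (interior (rdom (relem M K))) (h i K))" .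
qed

text \<open>On the cell, \<open>w\<close> is the reference velocity \<open>v\<close> composed with the inverse of the geometric map.
  Therefore its derivative is \<open>E = v' D\<^sup>-\<^sup>1\<close>, and the divergence is the trace of \<open>E\<close>. This is the form
  in which Jacobi's formula consumes it.\<close>

lemma divg_in_cell:
  assumes K: "K \<in> cells M" and z: "z \<in> interior (rdom (relem M K))"
    and v: "(v has_derivative v') (at z)" and w: "\<And>y. y \<in> rdom (relem M K) \<Longrightarrow> w (gmap M a K y) = v y"
  defines "D \<equiv> matrix (frechet_derivative (gmap M a K) (at z))"
  shows "det D \<noteq> 0" and "\<exists>E. E ** D = matrix v' \<and> divg w (gmap M a K z) = trace E"
proof -
  have c: "(K, 0) \<in> copies" by (rule reference_copy[OF K])
  have z0: "z \<in> interior (rcell M (K, 0))" using z by (simp add: rcell_def)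
  have cm: "cmap M a (K, 0) = gmap M a K" by (simp add: cmap_eq)
  obtain T' G G' where T': "(gmap M a K has_derivative T') (at z)"
    and G: "(G has_derivative G') (at (gmap M a K z))" "\<And>y. y \<in> rcell M (K, 0) \<Longrightarrow> G (gmap M a K y) = y"
    and id: "G' \<circ> T' = id" "T' \<circ> G' = id"
    by (rule cell_inverse[OF c z0, unfolded cm]) blast
  have D: "D = matrix T'" by (simp add: D_def frechet_derivative_at[OF T', symmetric])
  note lin = has_derivative_linear[OF T'] has_derivative_linear[OF G(1)] has_derivative_linear[OF v]
  have "matrix G' ** D = matrix (G' \<circ> T')"
    unfolding D by (rule matrix_compose[OF lin(1,2), symmetric])
  then have GD: "matrix G' ** D = mat 1" by (simp only: id(1) matrix_id_mat_1)
  then have "det (matrix G') * det D = 1" by (metis det_I det_mul)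
  then show "det D \<noteq> 0" by auto
  have "(w has_derivative v' \<circ> G') (at (gmap M a K z))"
    using derivative_via_cell[OF c z0, unfolded cm, OF G v, of w] w by (simp add: rcell_def)
  then have "divg w (gmap M a K z) = trace (matrix (v' \<circ> G'))"
    by (simp add: divg_def frechet_derivative_at[symmetric] trace_def matrix_def)
  moreover have "matrix (v' \<circ> G') ** D = matrix v'"
    by (simp add: matrix_compose[OF lin(2,3)] GD flip: matrix_mul_assoc)
  ultimately show "\<exists>E. E ** D = matrix v' \<and> divg w (gmap M a K z) = trace E" by blast
qed

end

text \<open>On a reference cell, the nodes move linearly in time, so the Jacobian matrix of the geometric map
  after the fraction \<open>r\<close> of the step is \<open>A + r C\<close>, with \<open>C\<close> the derivative of \<open>\<tau>\<close> times the reference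
  velocity \<open>v\<close>. The velocity at all intermediate times is the same function \<open>v\<close> on the reference cell,
  because the coefficients \<open>W\<close> represent the geometric velocity. At each point of the cell,
  \<open>quadrature_abs_det_increment\<close> relates the mass densities at both ends to the divergence at the
  quadrature times; integration over the cells gives the claim.\<close>

lemma geometric_conservation_law:
  fixes bc :: "('d::finite, 'm::finite) boundary" and M :: "'d mesh_data" and W :: "nat \<Rightarrow> real^'d"
  assumes bc: "bc = Cauchy u" and "\<tau> > 0" and quad: "quadrature_exact Q \<omega> \<zeta> (CARD('d) - 1)"
    and data: "mesh_data_ok bc M"
    and meshes: "\<And>s. tn \<le> s \<Longrightarrow> s \<le> tn + \<tau> \<Longrightarrow> matching_mesh bc M (moving a Wg tn s)"
    and w: "\<And>x. fe_fun_geo bc M a Wg x = fe_fun bc M a W x"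
    and i: "i \<in> dofs M"
  shows "mass bc M (moving a Wg tn (tn + \<tau>)) i - mass bc M a i =
    \<tau> * (\<Sum>j\<in>infl bc M a (supp bc M a i). W j \<bullet>
      (\<Sum>l\<in>Q. \<omega> l *\<^sub>R cvec bc M (moving a Wg tn (tn + \<tau> * \<zeta> l)) i j))"
proof -
  define m where "m r = moving a Wg tn (tn + \<tau> * r)" for r
  have m0: "m 0 = a" by (simp add: m_def moving_def fun_eq_iff)
  have mesh: "mesh bc M (m r)" if "0 \<le> r" "r \<le> 1" for r
    unfolding m_def using that \<open>\<tau> > 0\<close> by (intro mesh.intro data meshes) (auto simp: mult_left_le)
  have Q: "0 \<le> \<zeta> l" "\<zeta> l \<le> 1" if "l \<in> Q" for l using quad that by (auto simp: quadrature_exact_def)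
  interpret a: mesh bc M a using mesh[of 0] by (simp add: m0)
  let ?N = "infl bc M a (supp bc M a i)"
  have N: "finite ?N" "?N \<subseteq> dofs M"
    using a.finite_nbrs[OF i] a.nbrs_dofs by (auto simp: a.nbrs_def)
  \<comment> \<open>The velocity on the reference cell, in the geometric basis; the period offsets of the nodes are constant in time.\<close>
  define v where "v K z = (\<Sum>k<ngeo (relem M K). thgeo (relem M K) k z *\<^sub>R Wg (jgeo M K k))" for K z
  have v_eq: "v K z = (\<Sum>k<nsh (relem M K). th (relem M K) k z *\<^sub>R W (jsh M K k))"
    if "K \<in> cells M" "z \<in> rdom (relem M K)" for K z
  proof -
    have c: "(K, 0) \<in> a.copies" "z \<in> rcell M (K, 0)"
      using that a.reference_copy by (auto simp: rcell_def)
    show ?thesis using w[of "cmap M a (K, 0) z"] a.fe_fun_cmap[OF c, of W] a.fe_fun_geo_cmap[OF c, of Wg]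
      by (simp add: v_def)
  qed
  have gmap_m: "gmap M (m r) K z = gmap M a K z + (r * \<tau>) *\<^sub>R v K z" for r K z
    by (simp add: gmap_def m_def moving_def v_def algebra_simps sum.distrib scaleR_sum_right)
  have w_cell: "fe_fun bc M (m r) W (gmap M (m r) K z) = v K z"
    if "0 \<le> r" "r \<le> 1" "K \<in> cells M" "z \<in> rdom (relem M K)" for r K z
  proof -
    interpret m: mesh bc M "m r" by (rule mesh[OF that(1,2)])
    have c: "(K, 0) \<in> m.copies" "z \<in> rcell M (K, 0)"
      using that m.reference_copy by (auto simp: rcell_def)
    show ?thesis using m.fe_fun_cmap[OF c, of W] v_eq[OF that(3,4)] by (simp add: m.cmap_eq)
  qed
  have v_der: "(v K has_derivative frechet_derivative (v K) (at z)) (at z)"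
    if K: "K \<in> cells M" and z: "z \<in> interior (rdom (relem M K))" for K z
  proof -
    have "thgeo (relem M K) k differentiable at z" if "k < ngeo (relem M K)" for k
    proof -
      have "C1_on (rdom (relem M K)) (thgeo (relem M K) k)"
        using a.element_ok[OF K] that by (simp add: ref_element_ok_def)
      then have "thgeo (relem M K) k differentiable (at z within rdom (relem M K))"
        using z interior_subset[of "rdom (relem M K)"] C1_on_imp_differentiable_on
        unfolding differentiable_on_def by blast
      then show ?thesis by (simp add: at_within_interior[OF z])
    qed
    then have "v K differentiable at z"
      unfolding v_def by (intro differentiable_sum differentiable_scaleR) auto
    then show ?thesis by (simp add: frechet_derivative_works)
  qed
  define A where "A K z = matrix (frechet_derivative (gmap M a K) (at z))" for K z
  define C where "C K z = \<tau> *\<^sub>R matrix (frechet_derivative (v K) (at z))" for K z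
  have jac: "matrix (frechet_derivative (gmap M (m r) K) (at z)) = A K z + r *\<^sub>R C K z"
    if "K \<in> cells M" "z \<in> interior (rdom (relem M K))" for r K z
  proof -
    have "(gmap M (m r) K has_derivative
        (\<lambda>y. frechet_derivative (gmap M a K) (at z) y + (r * \<tau>) *\<^sub>R frechet_derivative (v K) (at z) y)) (at z)"
      unfolding gmap_m
      by (intro has_derivative_add has_derivative_scaleR_right a.gmap_has_derivative v_der that)
    from frechet_derivative_at[OF this] show ?thesis
      by (simp add: A_def C_def matrix_def vec_eq_iff fun_eq_iff)
  qed
  have pointwise: "\<bar>det (A K z + C K z)\<bar> - \<bar>det (A K z)\<bar> =
      (\<Sum>l\<in>Q. \<omega> l * (\<bar>det (A K z + \<zeta> l *\<^sub>R C K z)\<bar> *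
        (\<tau> * divg (fe_fun bc M (m (\<zeta> l)) W) (gmap M (m (\<zeta> l)) K z))))"
    if K: "K \<in> cells M" and z: "z \<in> interior (rdom (relem M K))" for K z
  proof -
    have step: "det (A K z + r *\<^sub>R C K z) \<noteq> 0"
      "\<exists>E. E ** (A K z + r *\<^sub>R C K z) = C K z \<and>
        trace E = \<tau> * divg (fe_fun bc M (m r) W) (gmap M (m r) K z)" if r: "0 \<le> r" "r \<le> 1" for r
    proof -
      interpret m: mesh bc M "m r" by (rule mesh[OF r])
      note res = m.divg_in_cell[OF K z v_der[OF K z] w_cell[OF r K], unfolded jac[OF K z]]
      show "det (A K z + r *\<^sub>R C K z) \<noteq> 0" by (rule res(1))
      from res(2) obtain E where E: "E ** (A K z + r *\<^sub>R C K z) = matrix (frechet_derivative (v K) (at z))"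
        "divg (fe_fun bc M (m r) W) (gmap M (m r) K z) = trace E" by blast
      have scaleR_assoc: "(\<tau> *\<^sub>R X) ** Y = \<tau> *\<^sub>R (X ** Y)" for X Y :: "real^'d^'d"
        by (simp add: matrix_matrix_mult_def vec_eq_iff sum_distrib_left mult.assoc)
      have "(\<tau> *\<^sub>R E) ** (A K z + r *\<^sub>R C K z) = C K z"
        unfolding scaleR_assoc E(1) by (simp add: C_def)
      moreover have "trace (\<tau> *\<^sub>R E) = \<tau> * trace E" by (simp add: trace_def sum_distrib_left)
      ultimately show "\<exists>E. E ** (A K z + r *\<^sub>R C K z) = C K z \<and>
        trace E = \<tau> * divg (fe_fun bc M (m r) W) (gmap M (m r) K z)" using E(2) by metis
    qed
    then have "\<exists>E. \<forall>r. 0 \<le> r \<and> r \<le> 1 \<longrightarrow> E r ** (A K z + r *\<^sub>R C K z) = C K z \<and>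
        trace (E r) = \<tau> * divg (fe_fun bc M (m r) W) (gmap M (m r) K z)"
      by (intro choice) blast
    then obtain E where E: "\<And>r. 0 \<le> r \<Longrightarrow> r \<le> 1 \<Longrightarrow> E r ** (A K z + r *\<^sub>R C K z) = C K z"
      "\<And>r. 0 \<le> r \<Longrightarrow> r \<le> 1 \<Longrightarrow> trace (E r) = \<tau> * divg (fe_fun bc M (m r) W) (gmap M (m r) K z)"
      by blast
    have "\<bar>det (A K z + C K z)\<bar> - \<bar>det (A K z)\<bar> =
        (\<Sum>l\<in>Q. \<omega> l * (\<bar>det (A K z + \<zeta> l *\<^sub>R C K z)\<bar> * trace (E (\<zeta> l))))"
      by (rule quadrature_abs_det_increment[OF quad step(1) E(1)])
    also have "\<dots> = (\<Sum>l\<in>Q. \<omega> l * (\<bar>det (A K z + \<zeta> l *\<^sub>R C K z)\<bar> *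
        (\<tau> * divg (fe_fun bc M (m (\<zeta> l)) W) (gmap M (m (\<zeta> l)) K z))))"
      by (rule sum.cong) (use E(2) Q in auto)
    finally show ?thesis .
  qed
  define S where "S K = interior (rdom (relem M K))" for K
  \<comment> \<open>The integrands of the mass and of \<open>\<psi>\<^sub>i \<nabla>\<cdot>w\<close> after the fraction \<open>r\<close> of the step, pulled back to the reference cell.\<close>
  define hm where "hm r K z = \<bar>det (A K z + r *\<^sub>R C K z)\<bar> * loc_shape M i K z" for r K z
  define hd where "hd r K z = \<bar>det (A K z + r *\<^sub>R C K z)\<bar> *
      (loc_shape M i K z * divg (fe_fun bc M (m r) W) (gmap M (m r) K z))" for r K z
  define Ki where "Ki = {K \<in> cells M. i \<in> jsh M K ` {..<nsh (relem M K)}}"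
  have mass_cells: "(\<forall>K\<in>Ki. hm r K integrable_on S K) \<and> mass bc M (m r) i = (\<Sum>K\<in>Ki. integral (S K) (hm r K))"
    and div_cells: "(\<forall>K\<in>Ki. hd r K integrable_on S K) \<and>
      (\<Sum>j\<in>?N. W j \<bullet> cvec bc M (m r) i j) = (\<Sum>K\<in>Ki. integral (S K) (hd r K))"
    if r: "0 \<le> r" "r \<le> 1" for r
  proof -
    interpret m: mesh bc M "m r" by (rule mesh[OF r])
    have dom: "domain bc = UNIV" by (simp add: bc)
    let ?J = "\<lambda>K z. \<bar>det (matrix (frechet_derivative (gmap M (m r) K) (at z)))\<bar>"
    have psi: "(\<lambda>x. psi bc M (m r) i x * 1) absolutely_integrable_on UNIV"
      using m.psi_integrable[OF i] by (simp add: dom)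
    note cells = m.integral_over_cells[OF bc i psi]
    have eq: "?J K z * (loc_shape M i K z * 1) = hm r K z" if "K \<in> Ki" "z \<in> S K" for K z
      using jac[of K z r] that by (simp add: hm_def Ki_def S_def)
    have "hm r K integrable_on S K" if "K \<in> Ki" for K
      using integrable_eq[OF cells(1)[of K] eq[of K]] that by (simp add: Ki_def S_def)
    moreover have "mass bc M (m r) i = (\<Sum>K\<in>Ki. integral (S K) (hm r K))"
    proof -
      have "mass bc M (m r) i = integral UNIV (\<lambda>x. psi bc M (m r) i x * 1)"
        using m.mass_eq_integral[OF i] by (simp add: dom)
      also have "\<dots> = (\<Sum>K\<in>Ki. integral (S K) (\<lambda>z. ?J K z * (loc_shape M i K z * 1)))"
        unfolding cells(2) Ki_def S_def ..
      also have "\<dots> = (\<Sum>K\<in>Ki. integral (S K) (hm r K))"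
        by (intro sum.cong refl integral_cong eq)
      finally show ?thesis .
    qed
    ultimately show "(\<forall>K\<in>Ki. hm r K integrable_on S K) \<and> mass bc M (m r) i = (\<Sum>K\<in>Ki. integral (S K) (hm r K))"
      by blast
    have "{j \<in> dofs M. m.overlap i j} \<subseteq> ?N"
      using a.overlap_subset_nbrs(1)[OF i] a.overlap_iff[OF i] m.overlap_iff[OF i] by (auto simp: a.nbrs_def)
    note div = m.divergence_integral[OF i N this, of W, unfolded dom]
    note cells' = m.integral_over_cells[OF bc i div(1)]
    have eq': "?J K z * (loc_shape M i K z * divg (fe_fun bc M (m r) W) (gmap M (m r) K z)) = hd r K z"
      if "K \<in> Ki" "z \<in> S K" for K z
      using jac[of K z r] that by (simp add: hd_def Ki_def S_def)
    have "hd r K integrable_on S K" if "K \<in> Ki" for K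
      using integrable_eq[OF cells'(1)[of K] eq'[of K]] that by (simp add: Ki_def S_def)
    moreover have "(\<Sum>j\<in>?N. W j \<bullet> cvec bc M (m r) i j) = (\<Sum>K\<in>Ki. integral (S K) (hd r K))"
    proof -
      have "(\<Sum>j\<in>?N. W j \<bullet> cvec bc M (m r) i j) = (\<Sum>K\<in>Ki. integral (S K)
          (\<lambda>z. ?J K z * (loc_shape M i K z * divg (fe_fun bc M (m r) W) (gmap M (m r) K z))))"
        unfolding div(2)[symmetric] cells'(2) Ki_def S_def ..
      also have "\<dots> = (\<Sum>K\<in>Ki. integral (S K) (hd r K))"
        by (intro sum.cong refl integral_cong eq')
      finally show ?thesis .
    qed
    ultimately show "(\<forall>K\<in>Ki. hd r K integrable_on S K) \<and>
      (\<Sum>j\<in>?N. W j \<bullet> cvec bc M (m r) i j) = (\<Sum>K\<in>Ki. integral (S K) (hd r K))" by blast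
  qed
  have finQ: "finite Q" using quad by (simp add: quadrature_exact_def)
  have cell: "integral (S K) (hm 1 K) - integral (S K) (hm 0 K) = (\<Sum>l\<in>Q. \<omega> l * (\<tau> * integral (S K) (hd (\<zeta> l) K)))"
    if K: "K \<in> Ki" for K
  proof -
    have "integral (S K) (hm 1 K) - integral (S K) (hm 0 K) = integral (S K) (\<lambda>z. hm 1 K z - hm 0 K z)"
      using mass_cells[of 0] mass_cells[of 1] K by (intro integral_diff[symmetric]) auto
    also have "\<dots> = integral (S K) (\<lambda>z. \<Sum>l\<in>Q. (\<omega> l * \<tau>) * hd (\<zeta> l) K z)"
    proof (rule integral_cong)
      fix z assume z: "z \<in> S K"
      have "hm 1 K z - hm 0 K z = (\<bar>det (A K z + C K z)\<bar> - \<bar>det (A K z)\<bar>) * loc_shape M i K z"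
        by (simp add: hm_def left_diff_distrib)
      also have "\<dots> = (\<Sum>l\<in>Q. (\<omega> l * \<tau>) * hd (\<zeta> l) K z)"
        using pointwise[of K z] K z by (simp add: Ki_def S_def hd_def sum_distrib_right sum_distrib_left mult_ac)
      finally show "hm 1 K z - hm 0 K z = (\<Sum>l\<in>Q. (\<omega> l * \<tau>) * hd (\<zeta> l) K z)" .
    qed
    also have "\<dots> = (\<Sum>l\<in>Q. integral (S K) (\<lambda>z. (\<omega> l * \<tau>) * hd (\<zeta> l) K z))"
      using div_cells Q K finQ by (intro integral_sum) (auto intro: integrable_on_mult_right)
    finally show ?thesis by (simp add: mult.assoc)
  qed
  have "mass bc M (m 1) i - mass bc M (m 0) i = (\<Sum>K\<in>Ki. integral (S K) (hm 1 K) - integral (S K) (hm 0 K))"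
    using mass_cells[of 0] mass_cells[of 1] by (simp add: sum_subtractf)
  also have "\<dots> = (\<Sum>K\<in>Ki. \<Sum>l\<in>Q. \<omega> l * (\<tau> * integral (S K) (hd (\<zeta> l) K)))"
    by (rule sum.cong) (use cell in auto)
  also have "\<dots> = (\<Sum>l\<in>Q. \<Sum>K\<in>Ki. \<omega> l * (\<tau> * integral (S K) (hd (\<zeta> l) K)))"
    by (rule sum.swap)
  also have "\<dots> = (\<Sum>l\<in>Q. \<omega> l * (\<tau> * (\<Sum>j\<in>?N. W j \<bullet> cvec bc M (m (\<zeta> l)) i j)))"
    by (rule sum.cong) (use div_cells Q in \<open>auto simp: sum_distrib_left\<close>)
  also have "\<dots> = \<tau> * (\<Sum>j\<in>?N. \<Sum>l\<in>Q. \<omega> l * (W j \<bullet> cvec bc M (m (\<zeta> l)) i j))"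
    by (subst sum.swap) (simp add: sum_distrib_left mult.left_commute)
  also have "\<dots> = \<tau> * (\<Sum>j\<in>?N. W j \<bullet> (\<Sum>l\<in>Q. \<omega> l *\<^sub>R cvec bc M (m (\<zeta> l)) i j))"
    by (simp add: inner_sum_right)
  finally show ?thesis unfolding m0 by (simp add: m_def)
qed

section \<open>Conservation for the two schemes\<close>

text \<open>The end position of a step and the start of the next one are only known to agree at the geometric
  nodes; this identifies their shape functions.\<close>

lemma psi_cong:
  assumes "mesh_data_ok bc M" "\<And>i. i \<in> gnodes M \<Longrightarrow> a i = a' i"
  shows "psi bc M a = psi bc M a'"
proof -
  have "jgeo M K i \<in> gnodes M" if "K \<in> cells M" "i < ngeo (relem M K)" for K i
    using assms(1) that by (auto simp: mesh_data_ok_def)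
  then have "gmap M a K z = gmap M a' K z" if "K \<in> cells M" for K z
    unfolding gmap_def using that assms(2) by (intro sum.cong) auto
  then have "cmap M a c z = cmap M a' c z" if "c \<in> cells M \<times> periods bc" for c z
    using that by (auto simp: cmap_def)
  then show ?thesis
    unfolding psi_def glue_def fun_eq_iff by (simp cong: bex_cong)
qed

lemma mass_cong:
  assumes "mesh_data_ok bc M" "\<And>i. i \<in> gnodes M \<Longrightarrow> a i = a' i"
  shows "mass bc M a = mass bc M a'"
proof
  have "psi bc M a = psi bc M a'" by (rule psi_cong[OF assms])
  then show "mass bc M a i = mass bc M a' i" for i by (simp add: mass_def)
qed

context mesh
begin

lemma overlap_other_mesh:
  assumes "mesh bc M a'" "i \<in> dofs M"
  shows "{j \<in> dofs M. mesh.overlap bc M a' i j} \<subseteq> nbrs i" "{j \<in> dofs M. mesh.overlap bc M a' j i} \<subseteq> nbrs i"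
  using overlap_subset_nbrs[OF assms(2)] overlap_iff[OF assms(2)] overlap_iff[OF _ assms(2)]
    mesh.overlap_iff[OF assms] mesh.overlap_iff[OF assms(1) _ assms(2)] by auto

lemma finite_excess_initial:
  assumes "data_ok bc M a U"
  shows "finite {i \<in> dofs M. U i \<noteq> far_state bc}"
proof (cases bc)
  case (Cauchy u)
  then show ?thesis using finite_excess[OF Cauchy assms] by simp
next
  case (Periodic L)
  then show ?thesis using finite_dofs_periodic by simp
qed

text \<open>Covers both versions: in Version 1 the quadrature has a single stage, the current mesh with weight
  \<open>1\<close>. Row and column sums vanish stage by stage; the neighborhoods of the mesh at the beginning of the
  step are large enough for every stage.\<close>

lemma step_conserves_excess:
  fixes U U' :: "nat \<Rightarrow> real^'m" and \<omega> :: "nat \<Rightarrow> real"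
  assumes step: "ale_step lmax f (dofs M) (\<lambda>i. infl bc M a (supp bc M a i))
      (\<lambda>i j. \<Sum>l\<in>Q. \<omega> l *\<^sub>R cvec bc M (b l) i j) W \<tau> \<mu> U \<mu>' U'"
    and "\<tau> > 0" and b: "\<And>l. l \<in> Q \<Longrightarrow> mesh bc M (b l)"
    and gcl: "\<And>i. i \<in> dofs M \<Longrightarrow> (\<mu>' i - \<mu> i) *\<^sub>R far_state bc =
      (\<tau> * (\<Sum>j\<in>infl bc M a (supp bc M a i). W j \<bullet> (\<Sum>l\<in>Q. \<omega> l *\<^sub>R cvec bc M (b l) i j))) *\<^sub>R far_state bc"
    and fin: "finite {i \<in> dofs M. U i \<noteq> far_state bc}"
    and pos: "\<And>u i. bc = Cauchy u \<Longrightarrow> i \<in> dofs M \<Longrightarrow> \<mu>' i \<noteq> 0"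
  shows "finite {i \<in> dofs M. U' i \<noteq> far_state bc}"
    and "(\<Sum>\<^sub>\<infinity>i\<in>dofs M. \<mu>' i *\<^sub>R (U' i - far_state bc)) = (\<Sum>\<^sub>\<infinity>i\<in>dofs M. \<mu> i *\<^sub>R (U i - far_state bc))"
proof -
  let ?c = "\<lambda>i j. \<Sum>l\<in>Q. \<omega> l *\<^sub>R cvec bc M (b l) i j"
  have row: "(\<Sum>j\<in>nbrs i. ?c i j) = 0" if i: "i \<in> dofs M" for i
  proof -
    have "(\<Sum>j\<in>nbrs i. ?c i j) = (\<Sum>l\<in>Q. \<omega> l *\<^sub>R (\<Sum>j\<in>nbrs i. cvec bc M (b l) i j))"
      by (subst sum.swap) (simp add: scaleR_sum_right)
    also have "\<dots> = 0"
      using mesh.cvec_row_sum[OF b i finite_nbrs[OF i] nbrs_dofs] overlap_other_mesh(1)[OF b i]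
      by (intro sum.neutral) auto
    finally show ?thesis .
  qed
  have col: "(\<Sum>i\<in>nbrs j. ?c i j) = 0" if j: "j \<in> dofs M" for j
  proof -
    have "(\<Sum>i\<in>nbrs j. ?c i j) = (\<Sum>l\<in>Q. \<omega> l *\<^sub>R (\<Sum>i\<in>nbrs j. cvec bc M (b l) i j))"
      by (subst sum.swap) (simp add: scaleR_sum_right)
    also have "\<dots> = 0"
      using mesh.cvec_column_sum[OF b j finite_nbrs[OF j] nbrs_dofs] overlap_other_mesh(2)[OF b j]
      by (intro sum.neutral) auto
    finally show ?thesis .
  qed
  \<comment> \<open>A periodic domain has finitely many cells.\<close>
  have nonzero: "finite (dofs M) \<or> (\<forall>i\<in>dofs M. \<mu>' i \<noteq> 0)"
    using pos finite_dofs_periodic by (cases bc) auto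
  note conserves = ale_step_conserves_excess[OF step[folded nbrs_def] \<open>\<tau> > 0\<close> finite_nbrs nbrs_dofs
    nbrs_sym nbrs_self row col gcl[folded nbrs_def] fin nonzero]
  show "finite {i \<in> dofs M. U' i \<noteq> far_state bc}" by (rule conserves(1))
  show "(\<Sum>\<^sub>\<infinity>i\<in>dofs M. \<mu>' i *\<^sub>R (U' i - far_state bc)) = (\<Sum>\<^sub>\<infinity>i\<in>dofs M. \<mu> i *\<^sub>R (U i - far_state bc))"
    by (rule conserves(2))
qed

lemma divergence_integral_supp:
  assumes i: "i \<in> dofs M"
  shows "(LINT x:supp bc M a i \<inter> domain bc|lebesgue. \<phi> i x * divg (fe_fun bc M a V) x) =
    (\<Sum>j\<in>nbrs i. V j \<bullet> cvec bc M a i j)"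
proof -
  note div = divergence_integral[OF i finite_nbrs[OF i] nbrs_dofs overlap_subset_nbrs(1)[OF i], of V]
  have "(LINT x:supp bc M a i \<inter> domain bc|lebesgue. \<phi> i x * divg (fe_fun bc M a V) x) =
      (LINT x:domain bc|lebesgue. \<phi> i x * divg (fe_fun bc M a V) x)"
    unfolding set_lebesgue_integral_def
    by (rule Bochner_Integration.integral_cong) (use psi_in_supp[of i] in \<open>auto simp: indicator_def\<close>)
  also have "\<dots> = integral (domain bc) (\<lambda>x. \<phi> i x * divg (fe_fun bc M a V) x)"
    by (rule set_lebesgue_integral_eq_integral[OF div(1)])
  finally show ?thesis by (simp only: div(2))
qed

end

lemma scheme1_conserves_excess:
  fixes U :: "nat \<Rightarrow> nat \<Rightarrow> real^'m::finite" and bc :: "('d::finite, 'm) boundary"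
  assumes data: "mesh_data_ok bc M" and sch: "scheme1 bc M lmax f t a W mm U"
  shows "finite {i \<in> dofs M. U n i \<noteq> far_state bc} \<and>
    (\<Sum>\<^sub>\<infinity>i\<in>dofs M. mm n i *\<^sub>R (U n i - far_state bc)) = (\<Sum>\<^sub>\<infinity>i\<in>dofs M. mm 0 i *\<^sub>R (U 0 i - far_state bc))"
proof -
  have mesh: "mesh bc M (a n)" for n
    using sch data by (simp add: scheme1_def Let_def mesh_def)
  have \<tau>: "t (Suc n) - t n > 0" for n
    using sch by (simp add: scheme1_def strict_mono_def)
  have pos: "mm n i > 0" if "i \<in> dofs M" for n i
    using sch that by (simp add: scheme1_def Let_def)
  have mass: "mm (Suc n) i = mm n i + (t (Suc n) - t n) * (LINT x:supp bc M (a n) i \<inter> domain bc|lebesgue.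
      psi bc M (a n) i x * divg (fe_fun bc M (a n) (W n)) x)" if "i \<in> dofs M" for n i
    using sch that by (simp add: scheme1_def Let_def)
  have step: "ale_step lmax f (dofs M) (\<lambda>i. infl bc M (a n) (supp bc M (a n) i)) (cvec bc M (a n)) (W n)
      (t (Suc n) - t n) (mm n) (U n) (mm (Suc n)) (U (Suc n))" for n
    using sch by (simp add: scheme1_def Let_def)
  show ?thesis
  proof (induction n)
    case 0
    show ?case
      using mesh.finite_excess_initial[OF mesh[of 0], of "U 0"] sch by (simp add: scheme1_def)
  next
    case (Suc n)
    interpret m: mesh bc M "a n" by (rule mesh)
    have "(mm (Suc n) i - mm n i) = (t (Suc n) - t n) *
        (\<Sum>j\<in>infl bc M (a n) (supp bc M (a n) i). W n j \<bullet> cvec bc M (a n) i j)" if "i \<in> dofs M" for i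
      using mass[OF that] m.divergence_integral_supp[OF that, of "W n"] by (simp add: m.nbrs_def)
    then show ?case
      using m.step_conserves_excess[where lmax=lmax and f=f and Q="{0::nat}" and \<omega>="\<lambda>_. 1" and b="\<lambda>_. a n"
          and W="W n" and \<tau>="t (Suc n) - t n" and \<mu>="mm n" and U="U n" and \<mu>'="mm (Suc n)" and U'="U (Suc n)"]
        step[of n] \<tau>[of n] mesh[of n] pos[of _ "Suc n"] Suc
      by (simp add: less_imp_neq[symmetric])
  qed
qed

lemma scheme2_conserves_excess:
  fixes U :: "nat \<Rightarrow> nat \<Rightarrow> real^'m::finite" and bc :: "('d::finite, 'm) boundary"
  assumes data: "mesh_data_ok bc M" and sch: "scheme2 bc M lmax f Q \<omega> \<zeta> t a Wg W U"
  shows "mesh bc M (a n)"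
    and "finite {i \<in> dofs M. U n i \<noteq> far_state bc} \<and>
    (\<Sum>\<^sub>\<infinity>i\<in>dofs M. mass bc M (a n) i *\<^sub>R (U n i - far_state bc)) =
      (\<Sum>\<^sub>\<infinity>i\<in>dofs M. mass bc M (a 0) i *\<^sub>R (U 0 i - far_state bc))"
proof -
  have \<tau>: "t (Suc n) - t n > 0" for n
    using sch by (simp add: scheme2_def strict_mono_def)
  have quad: "quadrature_exact Q \<omega> \<zeta> (CARD('d) - 1)"
    using sch by (simp add: scheme2_def)
  have w: "fe_fun_geo bc M (a n) (Wg n) x = fe_fun bc M (a n) (W n) x" for n x
    using sch by (simp add: scheme2_def Let_def)
  have matching: "matching_mesh bc M (moving (a n) (Wg n) (t n) s)" if "t n \<le> s" "s \<le> t (Suc n)" for n s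
    using sch that unfolding scheme2_def Let_def by (meson atLeastAtMost_iff)
  have next_nodes: "a (Suc n) i = moving (a n) (Wg n) (t n) (t (Suc n)) i" if "i \<in> gnodes M" for n i
    using sch that by (simp add: scheme2_def Let_def)
  have step: "ale_step lmax f (dofs M) (\<lambda>i. infl bc M (a n) (supp bc M (a n) i))
      (\<lambda>i j. \<Sum>l\<in>Q. \<omega> l *\<^sub>R cvec bc M (moving (a n) (Wg n) (t n) (t n + (t (Suc n) - t n) * \<zeta> l)) i j) (W n)
      (t (Suc n) - t n) (mass bc M (a n)) (U n) (mass bc M (a (Suc n))) (U (Suc n))" for n
    using sch unfolding scheme2_def Let_def by blast
  have mesh: "mesh bc M (a n)" for n
  proof (rule mesh.intro[OF data])
    have "moving (a n) (Wg n) (t n) (t n) = a n" by (simp add: moving_def fun_eq_iff)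
    then show "matching_mesh bc M (a n)" using matching[of n "t n"] \<tau>[of n] by simp
  qed
  then show "mesh bc M (a n)" .
  have stages: "mesh bc M (moving (a n) (Wg n) (t n) (t n + (t (Suc n) - t n) * \<zeta> l))" if "l \<in> Q" for n l
  proof (rule mesh.intro[OF data matching])
    have "0 \<le> \<zeta> l" "\<zeta> l \<le> 1" using quad that by (auto simp: quadrature_exact_def)
    then have "0 \<le> (t (Suc n) - t n) * \<zeta> l" "(t (Suc n) - t n) * \<zeta> l \<le> t (Suc n) - t n"
      using \<tau>[of n] by (auto intro: mult_left_le)
    then show "t n \<le> t n + (t (Suc n) - t n) * \<zeta> l" "t n + (t (Suc n) - t n) * \<zeta> l \<le> t (Suc n)"
      by auto
  qed
  show "finite {i \<in> dofs M. U n i \<noteq> far_state bc} \<and>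
    (\<Sum>\<^sub>\<infinity>i\<in>dofs M. mass bc M (a n) i *\<^sub>R (U n i - far_state bc)) =
      (\<Sum>\<^sub>\<infinity>i\<in>dofs M. mass bc M (a 0) i *\<^sub>R (U 0 i - far_state bc))"
  proof (induction n)
    case 0
    show ?case
      using mesh.finite_excess_initial[OF mesh[of 0], of "U 0"] sch by (simp add: scheme2_def)
  next
    case (Suc n)
    interpret m: mesh bc M "a n" by (rule mesh)
    have gcl: "(mass bc M (a (Suc n)) i - mass bc M (a n) i) *\<^sub>R far_state bc = ((t (Suc n) - t n) *
        (\<Sum>j\<in>infl bc M (a n) (supp bc M (a n) i). W n j \<bullet> (\<Sum>l\<in>Q. \<omega> l *\<^sub>R
          cvec bc M (moving (a n) (Wg n) (t n) (t n + (t (Suc n) - t n) * \<zeta> l)) i j))) *\<^sub>R far_state bc"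
      if i: "i \<in> dofs M" for i
    proof (cases bc)
      case (Cauchy u)
      have "mass bc M (a (Suc n)) = mass bc M (moving (a n) (Wg n) (t n) (t n + (t (Suc n) - t n)))"
        using next_nodes[of _ n] by (intro mass_cong[OF data]) simp
      moreover have "mass bc M (moving (a n) (Wg n) (t n) (t n + (t (Suc n) - t n))) i - mass bc M (a n) i =
          (t (Suc n) - t n) * (\<Sum>j\<in>infl bc M (a n) (supp bc M (a n) i). W n j \<bullet> (\<Sum>l\<in>Q. \<omega> l *\<^sub>R
            cvec bc M (moving (a n) (Wg n) (t n) (t n + (t (Suc n) - t n) * \<zeta> l)) i j))"
        by (rule geometric_conservation_law[OF Cauchy \<tau> quad data _ w i]) (rule matching, simp_all)
      ultimately show ?thesis by simp
    qed simp
    have pos: "mass bc M (a (Suc n)) i \<noteq> 0" if "bc = Cauchy u" "i \<in> dofs M" for u i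
      using mesh.mass_pos[OF mesh[of "Suc n"] that] by simp
    show ?case
      using m.step_conserves_excess[OF step \<tau> stages gcl conjunct1[OF Suc] pos] Suc by simp
  qed
qed

theorem lemma5p1:
  fixes f :: "('d::finite, 'm::finite) flux"
    and A :: "('d, 'm) flux \<Rightarrow> (real^'m) set"
    and lamL lamR :: "('d, 'm) speed"
    and bc :: "('d, 'm) boundary"
    and M :: "'d mesh_data"
  assumes "\<And>w. riemann_well_posed A lamL lamR (ale_flux f w)"
    and "mesh_data_ok bc M"
  shows "(\<forall>Q \<omega> \<zeta> t a Wg W U. scheme2 bc M (lambda_max lamL lamR) f Q \<omega> \<zeta> t a Wg W U \<longrightarrow>
            (\<forall>n. set_integrable lebesgue (domain bc) (\<lambda>x. fe_fun bc M (a n) (U n) x - far_state bc) \<and>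
               (LINT x:domain bc|lebesgue. fe_fun bc M (a n) (U n) x - far_state bc) =
               (LINT x:domain bc|lebesgue. fe_fun bc M (a 0) (U 0) x - far_state bc))) \<and>
         (\<forall>t a W mm U. scheme1 bc M (lambda_max lamL lamR) f t a W mm U \<longrightarrow>
            (\<forall>n. finite {i\<in>dofs M. mm n i *\<^sub>R (U n i - far_state bc) \<noteq> 0} \<and>
               (\<Sum>\<^sub>\<infinity>i\<in>dofs M. mm n i *\<^sub>R (U n i - far_state bc)) =
               (\<Sum>\<^sub>\<infinity>i\<in>dofs M. mm 0 i *\<^sub>R (U 0 i - far_state bc))))"
proof (intro conjI allI impI)
  fix Q \<omega> \<zeta> t a Wg W U n
  assume sch: "scheme2 bc M (lambda_max lamL lamR) f Q \<omega> \<zeta> t a Wg W U"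
  note mesh = scheme2_conserves_excess(1)[OF assms(2) sch]
  note excess = scheme2_conserves_excess(2)[OF assms(2) sch]
  show "set_integrable lebesgue (domain bc) (\<lambda>x. fe_fun bc M (a n) (U n) x - far_state bc)"
    by (rule mesh.excess_integral(1)[OF mesh conjunct1[OF excess]])
  show "(LINT x:domain bc|lebesgue. fe_fun bc M (a n) (U n) x - far_state bc) =
      (LINT x:domain bc|lebesgue. fe_fun bc M (a 0) (U 0) x - far_state bc)"
    unfolding mesh.excess_integral(2)[OF mesh conjunct1[OF excess]] by (rule conjunct2[OF excess])
next
  fix t a W mm U n
  assume "scheme1 bc M (lambda_max lamL lamR) f t a W mm U"
  note excess = scheme1_conserves_excess[OF assms(2) this, of n]
  show "finite {i\<in>dofs M. mm n i *\<^sub>R (U n i - far_state bc) \<noteq> 0}"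
    by (rule finite_subset[OF _ conjunct1[OF excess]]) auto
  show "(\<Sum>\<^sub>\<infinity>i\<in>dofs M. mm n i *\<^sub>R (U n i - far_state bc)) =
      (\<Sum>\<^sub>\<infinity>i\<in>dofs M. mm 0 i *\<^sub>R (U 0 i - far_state bc))"
    by (rule conjunct2[OF excess])
qed

end
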